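(* For the 2D compressible Euler equations $$\begin{cases}\partial_t\varrho+\nabla\cdot(\varrho u)=0,\\ \varrho\{\partial_t+(u\cdot\nabla)\}u+\nabla p=0,\\ \partial_tS+(u\cdot\nabla)S=0,\end{cases}\qquad p=Ae^S\varrho^\gamma,$$ the Cauchy problem is ill-posed in $H^{\frac74-\epsilon}(\mathbb{R}^2)$, and anisotropically ill-posed in $H^{\frac74}$, with respect to the fluid velocity and density, in the following sense. For any small $\epsilon>0$, let $X=H^{\frac74-\epsilon}(\mathbb{R}^2)$ or $X=H^{\frac74-\epsilon,\epsilon}(\mathbb{R}^2)$. There exists a family, indexed by a small parameter $\eta>0$, of smooth initial data $(\varrho_0^{(\eta)},u_0^{(\eta)},S_0^{(\eta)})$, with $(\varrho_0^{(\eta)}-1,u_0^{(\eta)},S_0^{(\eta)})$ compactly supported, such that $$\|\varrho_0^{(\eta)}-1\|_X+\|u_0^{(\eta)}\|_X+\|S_0^{(\eta)}\|_X\to0\quad\text{as }\eta\to0,$$ and for each $\eta$ there is a finite time $T_\eta^*>0$ at which a singularity forms in $\mathcal{D}(\Omega_0;T_\eta^* )$ and the solution ceases to be smooth. This singularity formation is instantaneous: $T_\eta^*\to0$ as $\eta\to0$. Furthermore, the singularity at $T_\eta^*$ corresponds to the (first) shock in the planar symmetric region, and the $H^1$-norms of the velocity component $u_1$ and of the density blow up at the shock formation time: $$\lim_{t\to T_\eta^*}\|u_1^{(\eta)}(\cdot,t)\|_{H^1(\Omega_t)}=+\infty,\qquad\lim_{t\to T_\eta^*}\|\varrho^{(\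eta)}(\cdot,t)\|_{H^1(\Omega_t)}=+\infty.$$
   Context: Here $(x_1,x_2)\in\mathbb{R}^2$, $\varrho$ is the density (close to $1$), $u=(u_1,u_2)$ the velocity, $S$ the entropy, $A>0$ and $\gamma>1$ are constants; non-trivial vorticity and entropy are allowed. The equilibrium state is $\varrho=1,u=0,S=0$, with sound speed $\lambda_1(0)=\sqrt{A\gamma}$. Given $\eta$ and $T_\eta^*$, set $$\Omega_0=\{(x_1,x_2):(x_1-\lambda_1(0)T_\eta^*-2\eta)^2+x_2^2\le(\lambda_1(0)T_\eta^*+\eta)^2\},$$ the spatial region in which the initial data are planar symmetric (depend only on $x_1$). $\mathcal{D}(\Omega_0;T_\eta^* )$ is the domain of dependence of $\Omega_0$ in the time interval $[0,T_\eta^* )$, i.e. the spacetime region in which the solution is determined purely by the initial data in $\Omega_0$; $\Omega_t$ is its slice at time $t$. A shock forming at $T_\eta^*$ means that the solution is smooth in $\mathcal{D}(\Omega_0;T_\eta^* )$ and $(u,\varrho-1,S)$ stays small there while its first derivatives blow up as $t\to T_\eta^*$. For real $s_1,s_2$, the anisotropic Sobolev space $H^{s_1,s_2}(\mathbb{R}^2)$ consists of tempered distributions $f$ with $\|f\|_{H^{s_1,s_2}}=\big(\int_{\mathbb{R}^2}(1+|\xi_1|^2)^{s_1}(1+|\xi_2|^2)^{s_2}|\hat f(\xi)|^2d\xi\big)^{1/2}<\infty$. *)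

theory Defs
  imports "HOL-Analysis.Analysis"
begin

type_synonym plane = "real \<times> real"
type_synonym spacetime = "real \<times> plane"  \<comment> \<open>points \<open>(t, (x\<^sub>1, x\<^sub>2))\<close>\<close>


section \<open>Smooth functions\<close>

text \<open>Meant for open \<open>V\<close>, where the Frechet derivative is unique.\<close>

primrec C_k_on :: "nat \<Rightarrow> 'a::euclidean_space set \<Rightarrow> ('a \<Rightarrow> 'b::real_normed_vector) \<Rightarrow> bool" where
  "C_k_on 0 V f \<longleftrightarrow> continuous_on V f"
| "C_k_on (Suc k) V f \<longleftrightarrow> f differentiable_on V \<and>
     (\<forall>e\<in>Basis. C_k_on k V (\<lambda>p. frechet_derivative f (at p) e))"

text \<open>
  Smoothness on a set that need not be open (such as a time slab including its initial slice)
  is smoothness on an open neighbourhood, as usual.  In a slab \<open>[0,T) \<times> \<real>\<^sup>2\<close> this is smoothness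
  up to \<open>t = 0\<close>; the values for \<open>t < 0\<close> are an arbitrary smooth extension, on which the
  derivatives at \<open>t = 0\<close> do not depend.
\<close>

definition smooth_on :: "'a::euclidean_space set \<Rightarrow> ('a \<Rightarrow> 'b::real_normed_vector) \<Rightarrow> bool" where
  "smooth_on G f \<longleftrightarrow> (\<exists>V. open V \<and> G \<subseteq> V \<and> (\<forall>k. C_k_on k V f))"

definition compactly_supported :: "('a::topological_space \<Rightarrow> 'b::zero) \<Rightarrow> bool" where
  "compactly_supported f \<longleftrightarrow> compact (closure {x. f x \<noteq> 0})"


section \<open>Sobolev norms\<close>

definition fourier :: "(plane \<Rightarrow> real) \<Rightarrow> plane \<Rightarrow> complex" where
  "fourier f \<xi> = (LINT x|lborel. cis (- (x \<bullet> \<xi>)) * complex_of_real (f x))"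

definition isotropic_weight :: "real \<Rightarrow> plane \<Rightarrow> real" where
  "isotropic_weight s \<xi> = (1 + (norm \<xi>)\<^sup>2) powr s"

definition anisotropic_weight :: "real \<Rightarrow> real \<Rightarrow> plane \<Rightarrow> real" where
  "anisotropic_weight s\<^sub>1 s\<^sub>2 \<xi> = (1 + (fst \<xi>)\<^sup>2) powr s\<^sub>1 * (1 + (snd \<xi>)\<^sup>2) powr s\<^sub>2"

text \<open>
  \<open>in_sobolev w\<close> is the \<open>L\<^sup>1\<close> part of the Sobolev space with Fourier weight \<open>w\<close>, where the Fourier
  transform is an integral; smooth compactly supported functions lie in this part.  The
  integrability condition is the finiteness of the norm (\<open>LINT\<close> is 0 for a non-integrable
  function).  For vector-valued \<open>f\<close> the components are combined in the Euclidean way.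
\<close>

definition in_sobolev :: "(plane \<Rightarrow> real) \<Rightarrow> (plane \<Rightarrow> 'b::euclidean_space) \<Rightarrow> bool" where
  "in_sobolev w f \<longleftrightarrow> integrable lborel f \<and>
     (\<forall>b\<in>Basis. integrable lborel (\<lambda>\<xi>. w \<xi> * (cmod (fourier (\<lambda>x. f x \<bullet> b) \<xi>))\<^sup>2))"

definition sobolev_norm :: "(plane \<Rightarrow> real) \<Rightarrow> (plane \<Rightarrow> 'b::euclidean_space) \<Rightarrow> real" where
  "sobolev_norm w f =
     sqrt (\<Sum>b\<in>Basis. LINT \<xi>|lborel. w \<xi> * (cmod (fourier (\<lambda>x. f x \<bullet> b) \<xi>))\<^sup>2)"

text \<open>
  The value is 0 if the integral diverges, so a statement that this norm tends to \<open>+\<infinity>\<close>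
  includes that it is eventually finite.
\<close>

definition H1_norm :: "plane set \<Rightarrow> (plane \<Rightarrow> real) \<Rightarrow> real" where
  "H1_norm \<Omega> f = sqrt (LINT x:\<Omega>|lborel.
     (f x)\<^sup>2 + (frechet_derivative f (at x) (1, 0))\<^sup>2 + (frechet_derivative f (at x) (0, 1))\<^sup>2)"


section \<open>The compressible Euler equations\<close>

definition pressure :: "real \<Rightarrow> real \<Rightarrow> real \<Rightarrow> real \<Rightarrow> real" where
  "pressure A \<gamma> r s = A * exp s * r powr \<gamma>"

text \<open>The square root of \<open>\<partial>p/\<partial>\<rho>\<close> at fixed entropy; its value at the equilibrium is \<open>sqrt (A * \<gamma>)\<close>.\<close>

definition sound_speed :: "real \<Rightarrow> real \<Rightarrow> real \<Rightarrow> real \<Rightarrow> real" where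
  "sound_speed A \<gamma> r s = sqrt (A * \<gamma> * exp s * r powr (\<gamma> - 1))"

definition D\<^sub>t :: "(spacetime \<Rightarrow> 'b::real_normed_vector) \<Rightarrow> spacetime \<Rightarrow> 'b" where
  "D\<^sub>t f p = frechet_derivative f (at p) (1, (0, 0))"

definition D\<^sub>1 :: "(spacetime \<Rightarrow> 'b::real_normed_vector) \<Rightarrow> spacetime \<Rightarrow> 'b" where
  "D\<^sub>1 f p = frechet_derivative f (at p) (0, (1, 0))"

definition D\<^sub>2 :: "(spacetime \<Rightarrow> 'b::real_normed_vector) \<Rightarrow> spacetime \<Rightarrow> 'b" where
  "D\<^sub>2 f p = frechet_derivative f (at p) (0, (0, 1))"

definition convective_derivative ::
  "(spacetime \<Rightarrow> plane) \<Rightarrow> (spacetime \<Rightarrow> 'b::real_normed_vector) \<Rightarrow> spacetime \<Rightarrow> 'b" where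
  "convective_derivative u f p = D\<^sub>t f p + fst (u p) *\<^sub>R D\<^sub>1 f p + snd (u p) *\<^sub>R D\<^sub>2 f p"

definition euler_on :: "real \<Rightarrow> real \<Rightarrow> spacetime set \<Rightarrow>
    (spacetime \<Rightarrow> real) \<Rightarrow> (spacetime \<Rightarrow> plane) \<Rightarrow> (spacetime \<Rightarrow> real) \<Rightarrow> bool" where
  "euler_on A \<gamma> G \<rho> u S \<longleftrightarrow> (\<forall>p\<in>G.
     D\<^sub>t \<rho> p + D\<^sub>1 (\<lambda>q. \<rho> q * fst (u q)) p + D\<^sub>2 (\<lambda>q. \<rho> q * snd (u q)) p = 0 \<and>
     \<rho> p *\<^sub>R convective_derivative u u p
       + (D\<^sub>1 (\<lambda>q. pressure A \<gamma> (\<rho> q) (S q)) p, D\<^sub>2 (\<lambda>q. pressure A \<gamma> (\<rho> q) (S q)) p) = 0 \<and>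
     convective_derivative u S p = 0)"

definition smooth_fields_on :: "spacetime set \<Rightarrow>
    (spacetime \<Rightarrow> real) \<Rightarrow> (spacetime \<Rightarrow> plane) \<Rightarrow> (spacetime \<Rightarrow> real) \<Rightarrow> bool" where
  "smooth_fields_on G \<rho> u S \<longleftrightarrow> smooth_on G (\<lambda>p. (\<rho> p, u p, S p)) \<and> (\<forall>p\<in>G. \<rho> p > 0)"

abbreviation slab :: "real \<Rightarrow> spacetime set" where
  "slab T \<equiv> {0..<T} \<times> UNIV"

definition cauchy_solution :: "real \<Rightarrow> real \<Rightarrow> real \<Rightarrow>
    (plane \<Rightarrow> real) \<Rightarrow> (plane \<Rightarrow> plane) \<Rightarrow> (plane \<Rightarrow> real) \<Rightarrow>
    (spacetime \<Rightarrow> real) \<Rightarrow> (spacetime \<Rightarrow> plane) \<Rightarrow> (spacetime \<Rightarrow> real) \<Rightarrow> bool" where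
  "cauchy_solution A \<gamma> T \<rho>\<^sub>0 u\<^sub>0 S\<^sub>0 \<rho> u S \<longleftrightarrow>
     smooth_fields_on (slab T) \<rho> u S \<and> euler_on A \<gamma> (slab T) \<rho> u S \<and>
     (\<forall>x. \<rho> (0, x) = \<rho>\<^sub>0 x \<and> u (0, x) = u\<^sub>0 x \<and> S (0, x) = S\<^sub>0 x)"


section \<open>Domain of dependence\<close>

text \<open>
  Causal curves of the Euler flow with velocity \<open>u\<close> and sound speed \<open>c\<close>: relative to the fluid
  they move at most with the speed of sound.  The particle paths, which carry vorticity and
  entropy, are among them.
\<close>

definition causal_curve ::
  "(spacetime \<Rightarrow> plane) \<Rightarrow> (spacetime \<Rightarrow> real) \<Rightarrow> real \<Rightarrow> (real \<Rightarrow> plane) \<Rightarrow> bool" where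
  "causal_curve u c t z \<longleftrightarrow> z piecewise_C1_differentiable_on {0..t} \<and>
     (\<exists>F. finite F \<and> (\<forall>s\<in>{0..t} - F. \<exists>v. (z has_vector_derivative v) (at s) \<and>
        norm (v - u (s, z s)) \<le> c (s, z s)))"

text \<open>
  The points \<open>(t, x)\<close> with \<open>0 \<le> t < T\<close> at which the solution is determined by the data in \<open>\<Omega>\<close>
  alone: no causal curve reaches \<open>(t, x)\<close> from a point outside \<open>\<Omega>\<close> at time 0.
\<close>

definition domain_of_dependence :: "real \<Rightarrow> real \<Rightarrow> plane set \<Rightarrow> real \<Rightarrow>
    (spacetime \<Rightarrow> real) \<Rightarrow> (spacetime \<Rightarrow> plane) \<Rightarrow> (spacetime \<Rightarrow> real) \<Rightarrow> spacetime set" where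
  "domain_of_dependence A \<gamma> \<Omega> T \<rho> u S = {(t, x). 0 \<le> t \<and> t < T \<and>
     (\<forall>z. causal_curve u (\<lambda>p. sound_speed A \<gamma> (\<rho> p) (S p)) t z \<and> z t = x \<longrightarrow> z 0 \<in> \<Omega>)}"

definition slice :: "spacetime set \<Rightarrow> real \<Rightarrow> plane set" where
  "slice D t = {x. (t, x) \<in> D}"

definition initial_region :: "real \<Rightarrow> real \<Rightarrow> real \<Rightarrow> real \<Rightarrow> plane set" where
  "initial_region A \<gamma> \<eta> T = {(x\<^sub>1, x\<^sub>2).
     (x\<^sub>1 - sqrt (A * \<gamma>) * T - 2 * \<eta>)\<^sup>2 + x\<^sub>2\<^sup>2 \<le> (sqrt (A * \<gamma>) * T + \<eta>)\<^sup>2}"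

text \<open>
  The classical solution in the domain of dependence of \<open>\<Omega>\<close> with data \<open>\<rho>\<^sub>0, u\<^sub>0, S\<^sub>0\<close>.  The
  equations are imposed there and only there, since the solution need not stay smooth up to
  time \<open>T\<close> elsewhere.  The values outside are an arbitrary smooth extension (with positive
  density) to the whole slab.  It has no influence on the domain of dependence: causal curves
  ending in that set never leave it, and because the extension is smooth its sound cones match
  those of the solution across the boundary.  With fields that are irregular outside, the set
  of points satisfying the defining condition could be made artificially small.
\<close>

definition solution_in_domain_of_dependence :: "real \<Rightarrow> real \<Rightarrow> plane set \<Rightarrow> real \<Rightarrow>
    (plane \<Rightarrow> real) \<Rightarrow> (plane \<Rightarrow> plane) \<Rightarrow> (plane \<Rightarrow> real) \<Rightarrow>
    (spacetime \<Rightarrow> real) \<Rightarrow> (spacetime \<Rightarrow> plane) \<Rightarrow> (spacetime \<Rightarrow> real) \<Rightarrow> bool" where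
  "solution_in_domain_of_dependence A \<gamma> \<Omega> T \<rho>\<^sub>0 u\<^sub>0 S\<^sub>0 \<rho> u S \<longleftrightarrow>
     smooth_fields_on (slab T) \<rho> u S \<and>
     euler_on A \<gamma> (domain_of_dependence A \<gamma> \<Omega> T \<rho> u S) \<rho> u S \<and>
     (\<forall>x\<in>\<Omega>. \<rho> (0, x) = \<rho>\<^sub>0 x \<and> u (0, x) = u\<^sub>0 x \<and> S (0, x) = S\<^sub>0 x)"

text \<open>
  A shock at time \<open>T\<close> in \<open>D\<close>: the (smooth) solution stays within distance \<open>\<kappa>\<close> of the equilibrium
  in \<open>D\<close>, while its first derivatives become unbounded on the slices as \<open>t\<close> tends to \<open>T\<close>.
\<close>

definition shock_in :: "spacetime set \<Rightarrow> real \<Rightarrow> real \<Rightarrow>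
    (spacetime \<Rightarrow> real) \<Rightarrow> (spacetime \<Rightarrow> plane) \<Rightarrow> (spacetime \<Rightarrow> real) \<Rightarrow> bool" where
  "shock_in D T \<kappa> \<rho> u S \<longleftrightarrow>
     (\<forall>p\<in>D. norm (u p, \<rho> p - 1, S p) \<le> \<kappa>) \<and>
     (\<forall>M. \<forall>\<^sub>F t in at_left T. \<exists>x\<in>slice D t.
        M \<le> onorm (frechet_derivative (\<lambda>p. (\<rho> p, u p, S p)) (at (t, x))))"

definition planar_symmetric_on :: "plane set \<Rightarrow> (plane \<Rightarrow> 'b) \<Rightarrow> bool" where
  "planar_symmetric_on \<Omega> f \<longleftrightarrow> (\<forall>x\<in>\<Omega>. \<forall>y\<in>\<Omega>. fst x = fst y \<longrightarrow> f x = f y)"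

end

theory Submission
  imports Defs
begin

text \<open>
  In \<open>\<Omega>\<^sub>0\<close> the data are those of a planar simple wave with \<open>S = 0\<close>, \<open>u = (w, 0)\<close> and sound speed
  \<open>c + \<theta> w\<close>, where \<open>c = sqrt (A \<gamma>)\<close> and \<open>\<theta> = (\<gamma> - 1) / 2\<close>; the Euler equations reduce to
  \<open>\<partial>\<^sub>t w + (c + (1 + \<theta>) w) \<partial>\<^sub>1 w = 0\<close>.  The initial profile sits at \<open>x\<^sub>1 = 2 \<eta>\<close>, has width of order \<open>\<eta>\<close> and amplitude
  \<open>a\<close> of order \<open>\<eta> / T\<close>, and is linear with the least slope near its centre, so that this part
  focuses to a jump at time \<open>T\<close>.  The speeds differ from \<open>c\<close> by \<open>O(\<eta> / T)\<close> only, hence the focus stays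
  at a distance of order \<open>\<eta>\<close> from the boundary of the domain of dependence; there the squared \<open>H\<^sup>1\<close> norms
  are at least of order \<open>\<eta>\<^sup>2 / (T (T - t))\<close>.

  Over the support of the wave the height of \<open>\<Omega>\<^sub>0\<close> is of order \<open>h = sqrt (\<eta> T)\<close>, so the data can be cut off at this
  height and their squared Sobolev norm is of order \<open>a\<^sup>2 \<eta>\<^bsup>1-2s\<^esup> h\<^bsup>1-2\<epsilon>\<^esup>\<close>.  For \<open>s = 7/4 - \<epsilon>\<close> and \<open>T = \<eta>\<^bsup>\<epsilon>/2\<^esup>\<close> this is
  \<open>\<eta>\<^bsup>\<epsilon>(1-2\<epsilon>)/4\<^esup>\<close>, which tends to 0.

  A solution that is smooth beyond time \<open>T\<close> coincides with the simple wave in a cone with vertex after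
  the focus, by the energy estimate for the symmetrized system, so it would be discontinuous at the focus.
\<close>

section \<open>Smooth functions\<close>

text \<open>The number 7/4 comes from the shape of \<open>initial_region\<close>. Sound shrinks this
  disc to a neighbourhood of its centre of radius about \<eta> by time T, so a wave of speed about c
  that is to be there at time T must start within order \<eta> of the left edge, where a circle of
  radius of order T is only of order sqrt (\<eta> T) high. Slope 1 / T, width \<eta> and this height
  give a squared norm of order \<eta>^(7/2 - 2 s) T^(-3/2), up to a factor h^(-2 \<epsilon>); part
  of the gain from s < 7/4 pays for T tending to 0.

  The domain of dependence is never computed: it lies in the disc because rest is causal in a
  subsonic flow, and it contains a cone because causal speeds are bounded. But the H1 norms are
  integrals over its exact slices, with value 0 on divergence, so the slices must be shown compact;
  this is why causal curves are perturbed. The simple wave, defined on the whole slab, is its own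
  smooth extension. A competing solution may carry vorticity and entropy, so uniqueness is proved
  against general solutions.\<close>

lemma C_k_on_has_derivative:
  assumes "C_k_on (Suc k) V f" "open V" "p \<in> V"
  shows "(f has_derivative frechet_derivative f (at p)) (at p)"
proof -
  have "f differentiable_on V" using assms(1) by simp
  then have "f differentiable at p"
    using assms(2,3) by (simp add: differentiable_on_eq_differentiable_at)
  then show ?thesis by (simp add: frechet_derivative_works)
qed

lemma C_k_on_cong:
  assumes "open V" "C_k_on k V f" "\<And>p. p \<in> V \<Longrightarrow> f p = g p"
  shows "C_k_on k V g"
  using assms(2,3)
proof (induction k arbitrary: f g)
  case 0
  then show ?case by (metis C_k_on.simps(1) continuous_on_cong)
next
  case (Suc k)
  have g: "(g has_derivative frechet_derivative f (at p)) (at p)" if "p \<in> V" for p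
    using C_k_on_has_derivative[OF Suc.prems(1) \<open>open V\<close> that] Suc.prems(2) \<open>open V\<close> that
    by (metis has_derivative_transform_within_open)
  then have "g differentiable_on V"
    using \<open>open V\<close> by (auto simp: differentiable_on_eq_differentiable_at differentiable_def)
  moreover have "C_k_on k V (\<lambda>p. frechet_derivative g (at p) e)" if "e \<in> Basis" for e
  proof (rule Suc.IH)
    show "C_k_on k V (\<lambda>p. frechet_derivative f (at p) e)" using Suc.prems(1) that by simp
    show "frechet_derivative f (at p) e = frechet_derivative g (at p) e" if "p \<in> V" for p
      using frechet_derivative_at[OF g[OF that]] by simp
  qed
  ultimately show ?case by simp
qed

text \<open>\<open>frechet_derivative\<close> is a choice operator; on an open set the derivative is
  unique, so any explicit derivative may replace it. The inductions below all enter through this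
  rule.\<close>

lemma C_k_onI:
  assumes "open V" "\<And>p. p \<in> V \<Longrightarrow> (f has_derivative f' p) (at p)"
    and "\<And>e. e \<in> Basis \<Longrightarrow> C_k_on k V (\<lambda>p. f' p e)"
  shows "C_k_on (Suc k) V f"
proof -
  have "f differentiable_on V"
    using assms(1,2) by (auto simp: differentiable_on_eq_differentiable_at differentiable_def)
  moreover have "C_k_on k V (\<lambda>p. frechet_derivative f (at p) e)" if "e \<in> Basis" for e
    by (rule C_k_on_cong[OF assms(1) assms(3)[OF that]]) (metis assms(2) frechet_derivative_at)
  ultimately show ?thesis by simp
qed

lemma C_k_on_subset:
  assumes "C_k_on k V f" "W \<subseteq> V"
  shows "C_k_on k W f"
  using assms(1)
proof (induction k arbitrary: f)
  case 0
  then show ?case using assms(2) by (auto intro: continuous_on_subset)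
next
  case (Suc k)
  have "f differentiable_on W"
    using Suc.prems assms(2) differentiable_on_subset by (simp only: C_k_on.simps) blast
  moreover have "C_k_on k W (\<lambda>p. frechet_derivative f (at p) e)" if "e \<in> Basis" for e
    by (rule Suc.IH) (use Suc.prems that in \<open>simp only: C_k_on.simps\<close>)
  ultimately show ?case by (simp only: C_k_on.simps) blast
qed

lemma C_k_on_Suc_imp: "C_k_on (Suc k) V f \<Longrightarrow> C_k_on k V f"
proof (induction k arbitrary: f)
  case 0
  then show ?case by (simp add: differentiable_imp_continuous_on)
next
  case (Suc k)
  have "f differentiable_on V" using Suc.prems by (simp only: C_k_on.simps(2))
  moreover have "C_k_on k V (\<lambda>p. frechet_derivative f (at p) e)" if "e \<in> Basis" for e
    by (rule Suc.IH) (use Suc.prems that in \<open>simp only: C_k_on.simps(2)[of "Suc k"]\<close>)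
  ultimately show ?case by (simp only: C_k_on.simps) blast
qed

lemma C_k_on_imp_continuous_on: "C_k_on k V f \<Longrightarrow> continuous_on V f"
  by (cases k) (auto intro: differentiable_imp_continuous_on)

section \<open>Closure of C^k under algebraic operations and composition\<close>

lemma C_k_on_const [simp]: "C_k_on k V (\<lambda>_. c)"
  by (induction k arbitrary: c) auto

lemma C_k_on_linear:
  assumes "bounded_linear L" "open V" shows "C_k_on k V L"
proof (cases k)
  case 0 then show ?thesis using assms by (simp add: linear_continuous_on)
next
  case (Suc j)
  show ?thesis unfolding Suc
    by (rule C_k_onI[where f'="\<lambda>_. L"])
       (use assms in \<open>auto intro: bounded_linear_imp_has_derivative\<close>)
qed

lemma C_k_on_compose_linear:
  assumes "bounded_linear L" "open V" "C_k_on k V f"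
  shows "C_k_on k V (\<lambda>p. L (f p))"
  using assms(3)
proof (induction k arbitrary: f)
  case 0 then show ?case using assms by (auto intro: bounded_linear.continuous_on)
next
  case (Suc k)
  show ?case
    by (rule C_k_onI[where f'="\<lambda>p v. L (frechet_derivative f (at p) v)"])
       (use assms(2) in \<open>auto intro!: bounded_linear.has_derivative[OF assms(1)] C_k_on_has_derivative[OF Suc.prems] Suc.IH Suc.prems[unfolded C_k_on.simps, THEN conjunct2, rule_format]\<close>)
qed

lemma C_k_on_add:
  assumes "open V" "C_k_on k V f" "C_k_on k V g"
  shows "C_k_on k V (\<lambda>p. f p + g p)"
  using assms(2,3)
proof (induction k arbitrary: f g)
  case 0 then show ?case by (auto intro: continuous_intros)
next
  case (Suc k)
  show ?case
    by (rule C_k_onI[where f'="\<lambda>p v. frechet_derivative f (at p) v + frechet_derivative g (at p) v"])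
       (use assms(1) in \<open>auto intro!: has_derivative_add C_k_on_has_derivative[OF Suc.prems(1)] C_k_on_has_derivative[OF Suc.prems(2)] Suc.IH
         Suc.prems(1)[unfolded C_k_on.simps, THEN conjunct2, rule_format]
         Suc.prems(2)[unfolded C_k_on.simps, THEN conjunct2, rule_format]\<close>)
qed

text \<open>One Leibniz induction serves products and scalar multiples alike. The factor that is not
  differentiated drops from order k + 1 to k by \<open>C_k_on_Suc_imp\<close>.\<close>

lemma C_k_on_bilinear:
  assumes "bounded_bilinear B" "open V" "C_k_on k V f" "C_k_on k V g"
  shows "C_k_on k V (\<lambda>p. B (f p) (g p))"
  using assms(3,4)
proof (induction k arbitrary: f g)
  case 0 then show ?case using assms(1) by (auto intro: bounded_bilinear.continuous_on)
next
  case (Suc k)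
  show ?case
  proof (rule C_k_onI[where f'="\<lambda>p v. B (f p) (frechet_derivative g (at p) v) + B (frechet_derivative f (at p) v) (g p)"])
    show "((\<lambda>p. B (f p) (g p)) has_derivative (\<lambda>v. B (f p) (frechet_derivative g (at p) v) + B (frechet_derivative f (at p) v) (g p))) (at p)"
      if "p \<in> V" for p
      by (rule bounded_bilinear.FDERIV[OF assms(1)])
        (use that assms(2) in \<open>auto intro!: C_k_on_has_derivative[OF Suc.prems(1)] C_k_on_has_derivative[OF Suc.prems(2)]\<close>)
    show "C_k_on k V (\<lambda>p. B (f p) (frechet_derivative g (at p) e) + B (frechet_derivative f (at p) e) (g p))"
      if "e \<in> Basis" for e
      by (intro C_k_on_add[OF assms(2)] Suc.IH C_k_on_Suc_imp[OF Suc.prems(1)] C_k_on_Suc_imp[OF Suc.prems(2)]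
         Suc.prems(1)[unfolded C_k_on.simps, THEN conjunct2, rule_format]
         Suc.prems(2)[unfolded C_k_on.simps, THEN conjunct2, rule_format] that)
  qed (rule assms)
qed

lemmas C_k_on_mult = C_k_on_bilinear[OF bounded_bilinear_mult]
lemmas C_k_on_scaleR = C_k_on_bilinear[OF bounded_bilinear_scaleR]

text \<open>With an outer function of one real variable the chain rule is a scalar multiple of
  g'(f), so the induction hypothesis applies to g' with the same inner function f.\<close>

lemma C_k_on_compose:
  fixes g :: "real \<Rightarrow> 'b::real_normed_vector"
  assumes "open V" "open W" "C_k_on k W g" "C_k_on k V f" "f ` V \<subseteq> W"
  shows "C_k_on k V (\<lambda>p. g (f p))"
  using assms(3,4)
proof (induction k arbitrary: g)
  case 0
  then show ?case using assms(5) continuous_on_compose2[of W g V f] by simp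
next
  case (Suc k)
  show ?case
  proof (rule C_k_onI[where f'="\<lambda>p v. frechet_derivative f (at p) v *\<^sub>R frechet_derivative g (at (f p)) 1"])
    show "((\<lambda>p. g (f p)) has_derivative (\<lambda>v. frechet_derivative f (at p) v *\<^sub>R frechet_derivative g (at (f p)) 1)) (at p)"
      if "p \<in> V" for p
    proof -
      have g: "(g has_derivative frechet_derivative g (at (f p))) (at (f p))"
        by (rule C_k_on_has_derivative[OF Suc.prems(1) assms(2)]) (use assms(5) that in auto)
      have "frechet_derivative g (at (f p)) y = y *\<^sub>R frechet_derivative g (at (f p)) 1" for y
        using linear_scale[OF has_derivative_linear[OF g], of y 1] by simp
      then have "frechet_derivative g (at (f p)) = (\<lambda>y. y *\<^sub>R frechet_derivative g (at (f p)) 1)"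
        by (rule ext)
      with g have "(g has_derivative (\<lambda>y. y *\<^sub>R frechet_derivative g (at (f p)) 1)) (at (f p))"
        by (rule back_subst[where P="\<lambda>d. (g has_derivative d) (at (f p))"])
      from has_derivative_compose[OF C_k_on_has_derivative[OF Suc.prems(2) assms(1) that] this]
      show ?thesis .
    qed
    show "C_k_on k V (\<lambda>p. frechet_derivative f (at p) e *\<^sub>R frechet_derivative g (at (f p)) 1)"
      if "e \<in> Basis" for e
    proof (rule C_k_on_scaleR[OF assms(1)])
      show "C_k_on k V (\<lambda>p. frechet_derivative f (at p) e)" using Suc.prems(2) that by simp
      have "C_k_on k W (\<lambda>p. frechet_derivative g (at p) 1)" using Suc.prems(1) by simp
      then show "C_k_on k V (\<lambda>p. frechet_derivative g (at (f p)) 1)"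
        by (rule Suc.IH[OF _ C_k_on_Suc_imp[OF Suc.prems(2)]])
    qed
  qed (rule assms)
qed

lemma C_k_on_Pair:
  assumes "open V" "C_k_on k V f" "C_k_on k V g"
  shows "C_k_on k V (\<lambda>p. (f p, g p))"
proof -
  have "C_k_on k V (\<lambda>p. (f p, 0) + (0, g p))"
    by (intro C_k_on_add C_k_on_compose_linear[of "\<lambda>x. (x, 0)"] C_k_on_compose_linear[of "\<lambda>x. (0, x)"] assms)
       (auto intro!: bounded_linear_Pair bounded_linear_ident bounded_linear_zero)
  then show ?thesis by simp
qed

lemma C_k_on_real_SucI:
  fixes f :: "real \<Rightarrow> real"
  assumes "open V" "\<And>x. x \<in> V \<Longrightarrow> (f has_real_derivative f' x) (at x)" "C_k_on k V f'"
  shows "C_k_on (Suc k) V f"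
  by (rule C_k_onI[where f'="\<lambda>p. (*) (f' p)"])
     (use assms in \<open>auto simp: has_field_derivative_def\<close>)

lemma C_k_on_real_deriv:
  fixes f :: "real \<Rightarrow> real"
  assumes "open V" "C_k_on (Suc k) V f"
  shows "x \<in> V \<Longrightarrow> (f has_real_derivative deriv f x) (at x)" and "C_k_on k V (deriv f)"
proof -
  have *: "(f has_real_derivative frechet_derivative f (at x) 1) (at x)" if "x \<in> V" for x
  proof -
    have d: "(f has_derivative frechet_derivative f (at x)) (at x)"
      using C_k_on_has_derivative[OF assms(2,1) that] .
    have "frechet_derivative f (at x) y = frechet_derivative f (at x) 1 * y" for y
      using linear_scale[OF has_derivative_linear[OF d], of y 1] by simp
    then have "frechet_derivative f (at x) = (*) (frechet_derivative f (at x) 1)"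
      by (rule ext)
    with d have "(f has_derivative (*) (frechet_derivative f (at x) 1)) (at x)"
      by (rule back_subst[where P="\<lambda>d. (f has_derivative d) (at x)"])
    then show ?thesis unfolding has_field_derivative_def .
  qed
  then have eq: "deriv f x = frechet_derivative f (at x) 1" if "x \<in> V" for x
    using that DERIV_imp_deriv by blast
  show "x \<in> V \<Longrightarrow> (f has_real_derivative deriv f x) (at x)" using * eq by simp
  show "C_k_on k V (deriv f)"
    by (rule C_k_on_cong[where f="\<lambda>x. frechet_derivative f (at x) 1"]) (use assms eq in auto)
qed

lemma C_k_on_inverse: "C_k_on k {x. x \<noteq> (0::real)} inverse"
proof (induction k)
  case 0
  show ?case using continuous_on_inverse[OF continuous_on_id, of "{x. x \<noteq> (0::real)}"] by simp
next
  case (Suc k)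
  have o: "open {x. x \<noteq> (0::real)}" by (simp add: open_Collect_neq)
  show ?case
  proof (rule C_k_on_real_SucI[OF o, where f'="\<lambda>x. - 1 * (inverse x * inverse x)"])
    show "(inverse has_real_derivative - 1 * (inverse x * inverse x)) (at x)" if "x \<in> {x. x \<noteq> 0}" for x :: real
      using DERIV_inverse[of x UNIV] that by (simp add: power2_eq_square)
    show "C_k_on k {x. x \<noteq> 0} (\<lambda>x::real. - 1 * (inverse x * inverse x))"
      by (intro C_k_on_mult o Suc C_k_on_const)
  qed
qed

lemma C_k_on_powr: "C_k_on k {0<..} (\<lambda>x::real. x powr a)"
proof (induction k arbitrary: a)
  case 0
  show ?case using continuous_on_powr[OF continuous_on_id continuous_on_const, of "{0<..}" a] by auto
next
  case (Suc k)
  show ?case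
  proof (rule C_k_on_real_SucI[where f'="\<lambda>x. a * x powr (a - 1)"])
    show "((\<lambda>x. x powr a) has_real_derivative a * x powr (a - 1)) (at x)" if "x \<in> {0<..}" for x :: real
      using that by (intro has_real_derivative_powr) auto
    show "C_k_on k {0<..} (\<lambda>x. a * x powr (a - 1))"
      by (intro C_k_on_mult[OF _ C_k_on_const Suc]) auto
  qed auto
qed

lemma C_k_on_exp: "C_k_on k UNIV (exp :: real \<Rightarrow> real)"
proof (induction k)
  case 0
  show ?case using continuous_on_exp[OF continuous_on_id] by simp
next
  case (Suc k)
  show ?case by (rule C_k_on_real_SucI[OF open_UNIV DERIV_exp Suc])
qed

section \<open>Uniform bounds from compactness\<close>

lemma finite_family_bounded_on_compact:
  fixes \<F> :: "('a::topological_space \<Rightarrow> real) set"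
  assumes "compact K" "finite \<F>" "\<And>f. f \<in> \<F> \<Longrightarrow> continuous_on K f"
  obtains B where "\<And>f p. f \<in> \<F> \<Longrightarrow> p \<in> K \<Longrightarrow> \<bar>f p\<bar> \<le> B"
proof -
  have "\<exists>B. \<forall>f\<in>\<F>. \<forall>p\<in>K. \<bar>f p\<bar> \<le> B"
    using assms(2,3)
  proof (induction \<F>)
    case (insert g \<F>)
    obtain B where B: "\<forall>f\<in>\<F>. \<forall>p\<in>K. \<bar>f p\<bar> \<le> B" using insert by auto
    have "bounded (g ` K)"
      by (intro compact_imp_bounded compact_continuous_image insert.prems assms(1)) simp
    then obtain b where b: "\<forall>p\<in>K. \<bar>g p\<bar> \<le> b" by (auto simp: bounded_iff)
    show ?case by (rule exI[of _ "max B b"]) (use B b in \<open>fastforce simp: le_max_iff_disj\<close>)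
  qed simp
  then show thesis using that by blast
qed

lemma continuous_compact_support_bounded:
  fixes f :: "real \<Rightarrow> real"
  assumes "continuous_on UNIV f" "\<And>x. \<bar>x\<bar> > R \<Longrightarrow> f x = 0"
  obtains B where "\<And>x. \<bar>f x\<bar> \<le> B"
proof -
  have "compact (f ` {- R..R})"
    by (intro compact_continuous_image continuous_on_subset[OF assms(1)]) auto
  from compact_imp_bounded[OF this] obtain B where "\<forall>y\<in>f ` {- R..R}. norm y \<le> B"
    unfolding bounded_iff by blast
  then have B: "\<bar>f x\<bar> \<le> B" if "x \<in> {- R..R}" for x using that by simp
  have "\<bar>f x\<bar> \<le> max B 0" for x
  proof (cases "x \<in> {- R..R}")
    case False
    then have "\<bar>x\<bar> > R" by auto
    then show ?thesis by (simp add: assms(2))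
  qed (simp add: B le_max_iff_disj)
  then show thesis by (rule that)
qed

lemma deriv_eq_0_outside:
  fixes f :: "real \<Rightarrow> real"
  assumes "\<And>x. \<bar>x\<bar> > R \<Longrightarrow> f x = 0" "\<bar>x\<bar> > R"
  shows "deriv f x = 0"
proof -
  have "((\<lambda>_. 0) has_real_derivative 0) (at x)" by simp
  then have "(f has_real_derivative 0) (at x)"
  proof (rule has_field_derivative_transform_within_open)
    show "open {x::real. R < \<bar>x\<bar>}" by (intro open_Collect_less continuous_intros)
  qed (use assms in auto)
  then show ?thesis by (rule DERIV_imp_deriv)
qed

text \<open>Derivatives up to the third order, because \<open>fourier_real_decay\<close> integrates
  by parts three times.\<close>

lemma smooth_compact_support_bounds:
  assumes F: "\<And>k. C_k_on k UNIV F" "\<And>x. \<bar>x\<bar> > R \<Longrightarrow> F x = (0 :: real)"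
  obtains b where "\<And>x. \<bar>F x\<bar> \<le> b" "\<And>x. \<bar>deriv F x\<bar> \<le> b" "\<And>x. \<bar>deriv (deriv F) x\<bar> \<le> b"
    "\<And>x. \<bar>deriv (deriv (deriv F)) x\<bar> \<le> b"
proof -
  have k: "C_k_on k UNIV (deriv F)" "C_k_on k UNIV (deriv (deriv F))" "C_k_on k UNIV (deriv (deriv (deriv F)))" for k
    by (intro C_k_on_real_deriv(2)[OF open_UNIV] F)+
  note z1 = deriv_eq_0_outside[of R F, OF F(2)]
  note z2 = deriv_eq_0_outside[of R "deriv F", OF z1]
  note z3 = deriv_eq_0_outside[of R "deriv (deriv F)", OF z2]
  obtain b0 where b0: "\<And>x. \<bar>F x\<bar> \<le> b0"
    using continuous_compact_support_bounded[of F R, OF C_k_on_imp_continuous_on[OF F(1)] F(2)] by blast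
  obtain b1 where b1: "\<And>x. \<bar>deriv F x\<bar> \<le> b1"
    using continuous_compact_support_bounded[of "deriv F" R, OF C_k_on_imp_continuous_on[OF k(1)] z1] by blast
  obtain b2 where b2: "\<And>x. \<bar>deriv (deriv F) x\<bar> \<le> b2"
    using continuous_compact_support_bounded[of "deriv (deriv F)" R, OF C_k_on_imp_continuous_on[OF k(2)] z2] by blast
  obtain b3 where b3: "\<And>x. \<bar>deriv (deriv (deriv F)) x\<bar> \<le> b3"
    using continuous_compact_support_bounded[of "deriv (deriv (deriv F))" R, OF C_k_on_imp_continuous_on[OF k(3)] z3] by blast
  show thesis
    by (rule that[of "max (max b0 b1) (max b2 b3)"]) (simp_all add: le_max_iff_disj b0 b1 b2 b3)
qed

section \<open>A wave profile\<close>

text \<open>The flat functions x^(-n) e^(-1/x), extended by 0. All n are treated together because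
  differentiation leads from n to n + 1 and n + 2; the family is closed under it, and smoothness
  becomes one induction on the order.\<close>

definition flat_power :: "nat \<Rightarrow> real \<Rightarrow> real" where
  "flat_power n x = (if x > 0 then inverse x ^ n * exp (- inverse x) else 0)"

lemma tendsto_flat_power_at_0: "(flat_power n \<longlongrightarrow> 0) (at 0)"
proof -
  have "((\<lambda>y::real. y ^ n / exp y) \<longlongrightarrow> 0) at_top"
    by (rule tendsto_power_div_exp_0)
  then have "((\<lambda>x::real. inverse x ^ n / exp (inverse x)) \<longlongrightarrow> 0) (at_right 0)"
    by (rule filterlim_compose[OF _ filterlim_inverse_at_top_right])
  then have r: "(flat_power n \<longlongrightarrow> 0) (at_right 0)"
    by (rule Lim_transform_eventually)
       (auto simp: flat_power_def exp_minus field_simps eventually_at_filter)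
  have l: "(flat_power n \<longlongrightarrow> 0) (at_left 0)"
    by (rule Lim_transform_eventually[of "\<lambda>_. 0"])
       (auto simp: flat_power_def eventually_at_filter)
  show ?thesis using l r by (simp add: filterlim_at_split)
qed

lemma flat_power_has_derivative:
  "(flat_power n has_real_derivative flat_power (n + 2) x - real n * flat_power (Suc n) x) (at x)"
proof -
  consider "x > 0" | "x < 0" | "x = 0" by linarith
  then show ?thesis
  proof cases
    case 1
    have "((\<lambda>x. inverse x ^ n * exp (- inverse x)) has_real_derivative
        flat_power (n + 2) x - real n * flat_power (Suc n) x) (at x)"
    proof (rule DERIV_chain2[where f="\<lambda>y. y ^ n * exp (- y)" and g=inverse, THEN DERIV_cong])
      show "((\<lambda>y. y ^ n * exp (- y)) has_real_derivative
          real n * y ^ (n - 1) * exp (- y) - y ^ n * exp (- y)) (at y)" for y :: real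
        by (auto intro!: derivative_eq_intros)
      show "(inverse has_real_derivative - (inverse x)\<^sup>2) (at x)"
        using DERIV_inverse[of x UNIV] 1 by (simp add: power2_eq_square)
      have "(real n * y ^ (n - 1) * e - y ^ n * e) * - y\<^sup>2 = y ^ (n + 2) * e - real n * (y ^ Suc n * e)" for y e :: real
        by (cases n) (simp_all add: algebra_simps power2_eq_square)
      then show "(real n * inverse x ^ (n - 1) * exp (- inverse x) - inverse x ^ n * exp (- inverse x)) * - (inverse x)\<^sup>2
          = flat_power (n + 2) x - real n * flat_power (Suc n) x"
        using 1 unfolding flat_power_def by simp
    qed
    then show ?thesis
      by (rule has_field_derivative_transform_within_open[of _ _ _ "{0<..}"])
         (use 1 in \<open>auto simp: flat_power_def\<close>)
  next
    case 2
    have "((\<lambda>x. 0) has_real_derivative 0) (at x)" by simp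
    then have "(flat_power n has_real_derivative 0) (at x)"
      by (rule has_field_derivative_transform_within_open[of _ _ _ "{..<0}"])
         (use 2 in \<open>auto simp: flat_power_def\<close>)
    then show ?thesis using 2 by (simp add: flat_power_def)
  next
    case 3
    \<comment> \<open>The difference quotient at 0 is the next member
      \<open>flat_power (Suc n)\<close> of the family.\<close>
    have "((\<lambda>y. (flat_power n y - flat_power n 0) / (y - 0)) \<longlongrightarrow> 0) (at 0)"
      by (rule Lim_transform_eventually[OF tendsto_flat_power_at_0[of "Suc n"]])
         (auto simp: flat_power_def eventually_at_filter field_simps)
    then show ?thesis using 3 by (simp add: has_field_derivative_iff flat_power_def)
  qed
qed

lemma C_k_on_flat_power: "C_k_on k UNIV (flat_power n)"
proof (induction k arbitrary: n)
  case 0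
  show ?case
    using DERIV_isCont[OF flat_power_has_derivative] by (simp add: continuous_on_eq_continuous_at)
next
  case (Suc k)
  have "C_k_on k UNIV (\<lambda>x. flat_power (n + 2) x + (- real n) * flat_power (Suc n) x)"
    by (intro C_k_on_add C_k_on_mult[OF _ C_k_on_const] Suc open_UNIV)
  then have "C_k_on k UNIV (\<lambda>x. flat_power (n + 2) x - real n * flat_power (Suc n) x)"
    by simp
  from C_k_on_real_SucI[OF open_UNIV flat_power_has_derivative this] show ?case .
qed

text \<open>The quotient f(x) / (f(x) + f(1 - x)) with f(x) = e^(-1/x) for x > 0; one of x and 1 - x
  is always positive, so the denominator does not vanish. The sign of the derivative is kept because
  the slope of the wave profile depends on it.\<close>

lemma smooth_step_exists:
  obtains s :: "real \<Rightarrow> real" and s' :: "real \<Rightarrow> real" where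
    "\<And>k. C_k_on k UNIV s" "\<And>x. x \<le> 0 \<Longrightarrow> s x = 0" "\<And>x. x \<ge> 1 \<Longrightarrow> s x = 1"
    "\<And>x. 0 \<le> s x" "\<And>x. s x \<le> 1" "\<And>x. (s has_real_derivative s' x) (at x)" "\<And>x. 0 \<le> s' x"
proof
  define f where "f = flat_power 0"
  define g where "g = flat_power 2"
  let ?s = "\<lambda>x. f x * inverse (f x + f (1 - x))"
  let ?s' = "\<lambda>x. (g x * f (1 - x) + f x * g (1 - x)) / (f x + f (1 - x))\<^sup>2"
  have nn: "f x \<ge> 0" "g x \<ge> 0" for x by (auto simp: f_def g_def flat_power_def)
  have "f x > 0 \<or> f (1 - x) > 0" for x by (auto simp: f_def flat_power_def)
  then have pos: "f x + f (1 - x) > 0" for x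
    using nn[of x] nn(1)[of "1 - x"] by (meson add_nonneg_pos add_pos_nonneg)
  have fk: "C_k_on k UNIV f" for k unfolding f_def by (rule C_k_on_flat_power)
  have f1k: "C_k_on k UNIV (\<lambda>x. f (1 - x))" for k
  proof (rule C_k_on_compose[OF open_UNIV open_UNIV fk])
    have "C_k_on k UNIV (\<lambda>x::real. 1 + - x)"
      by (intro C_k_on_add C_k_on_const C_k_on_linear open_UNIV bounded_linear_minus bounded_linear_ident)
    then show "C_k_on k UNIV (\<lambda>x::real. 1 - x)" by simp
  qed simp
  show "C_k_on k UNIV ?s" for k
  proof (rule C_k_on_mult[OF open_UNIV fk])
    show "C_k_on k UNIV (\<lambda>x. inverse (f x + f (1 - x)))"
      by (rule C_k_on_compose[OF open_UNIV _ C_k_on_inverse C_k_on_add[OF open_UNIV fk f1k]])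
         (use pos in \<open>auto simp: open_Collect_neq less_imp_neq[THEN not_sym]\<close>)
  qed
  show "?s x = 0" if "x \<le> 0" for x using that by (simp add: f_def flat_power_def)
  show "?s x = 1" if "x \<ge> 1" for x using that by (simp add: f_def flat_power_def)
  show "0 \<le> ?s x" for x using nn[of x] nn[of "1-x"] by (simp )
  show "?s x \<le> 1" for x using nn(1)[of "1-x"] pos[of x] by (simp add: field_simps)
  have fd: "(f has_real_derivative g x) (at x)" for x
    using flat_power_has_derivative[of 0 x] by (simp add: f_def g_def numeral_2_eq_2)
  have f1d: "((\<lambda>x. f (1 - x)) has_real_derivative - g (1 - x)) (at x)" for x
    by (rule DERIV_chain2[OF fd, where g="\<lambda>x. 1 - x", THEN DERIV_cong]) (auto intro!: derivative_eq_intros)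
  show "(?s has_real_derivative ?s' x) (at x)" for x
  proof -
    have "((\<lambda>x. f x / (f x + f (1 - x))) has_real_derivative
      (g x * (f x + f (1 - x)) - f x * (g x + - g (1 - x))) / ((f x + f (1 - x)) * (f x + f (1 - x)))) (at x)"
      by (intro DERIV_divide fd f1d DERIV_add) (use pos[of x] in simp)
    then show ?thesis by (simp add: field_simps power2_eq_square divide_inverse[symmetric])
  qed
  show "0 \<le> ?s' x" for x using nn by simp
qed

text \<open>The step is composed with (4 - z^2) / 3, which is at least 1 on [-1, 1] and at most 0
  outside (-2, 2). The quadratic is smooth and even, and its derivative has the sign opposite to z,
  whence z B'(z) <= 0.\<close>

lemma bump_exists:
  obtains B :: "real \<Rightarrow> real" and B' :: "real \<Rightarrow> real" where
    "\<And>k. C_k_on k UNIV B" "\<And>z. \<bar>z\<bar> \<le> 1 \<Longrightarrow> B z = 1" "\<And>z. \<bar>z\<bar> \<ge> 2 \<Longrightarrow> B z = 0"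
    "\<And>z. 0 \<le> B z" "\<And>z. B z \<le> 1"
    "\<And>z. (B has_real_derivative B' z) (at z)" "\<And>z. z * B' z \<le> 0"
proof -
  obtain s s' :: "real \<Rightarrow> real" where
    s: "\<And>k. C_k_on k UNIV s" "\<And>x. x \<le> 0 \<Longrightarrow> s x = 0" "\<And>x. x \<ge> 1 \<Longrightarrow> s x = 1"
    "\<And>x. 0 \<le> s x" "\<And>x. s x \<le> 1" "\<And>x. (s has_real_derivative s' x) (at x)" "\<And>x. 0 \<le> s' x"
    using smooth_step_exists by metis
  let ?B = "\<lambda>z. s (4/3 + (- 1/3) * (z * z))"
  show thesis
  proof (rule that[of ?B "\<lambda>z. s' (4/3 + (- 1/3) * (z * z)) * (- 2/3 * z)"])
    show "C_k_on k UNIV ?B" for k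
      by (rule C_k_on_compose[OF open_UNIV open_UNIV s(1)])
         (intro C_k_on_add[OF open_UNIV C_k_on_const] C_k_on_mult[OF open_UNIV C_k_on_const]
            C_k_on_mult[OF open_UNIV] C_k_on_linear bounded_linear_ident open_UNIV subset_UNIV)+
    have sq: "\<bar>z\<bar> \<le> \<bar>w\<bar> \<longleftrightarrow> z * z \<le> w * w" for z w :: real
      by (metis abs_le_square_iff power2_eq_square)
    show "?B z = 1" if "\<bar>z\<bar> \<le> 1" for z
      using sq[of z 1] that by (intro s(3)) auto
    show "?B z = 0" if "\<bar>z\<bar> \<ge> 2" for z
      using sq[of 2 z] that by (intro s(2)) auto
    show "(?B has_real_derivative s' (4/3 + (- 1/3) * (z * z)) * (- 2/3 * z)) (at z)" for z
      by (rule DERIV_chain2[OF s(6)]) (auto intro!: derivative_eq_intros)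
    show "z * (s' (4/3 + (- 1/3) * (z * z)) * (- 2/3 * z)) \<le> 0" for z
    proof -
      have "0 \<le> (2/3) * (z * z) * s' (4/3 + (- 1/3) * (z * z))" by (intro mult_nonneg_nonneg[OF _ s(7)]) simp
      then show ?thesis by (simp add: algebra_simps)
    qed
  qed (use s in auto)
qed

text \<open>The linear part on \<open>[-1, 1]\<close>, which has the least slope, makes the simple wave with this
  profile focus at a single point.\<close>

lemma wave_profile_exists:
  obtains F :: "real \<Rightarrow> real" where
    "\<And>k. C_k_on k UNIV F" "\<And>z. \<bar>z\<bar> \<le> 1 \<Longrightarrow> F z = - z" "\<And>z. \<bar>z\<bar> \<ge> 2 \<Longrightarrow> F z = 0"
    "\<And>z. \<bar>F z\<bar> \<le> 2" "\<And>z. deriv F z \<ge> - 1"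
proof -
  obtain B B' :: "real \<Rightarrow> real" where B: "\<And>k. C_k_on k UNIV B" "\<And>z. \<bar>z\<bar> \<le> 1 \<Longrightarrow> B z = 1" "\<And>z. \<bar>z\<bar> \<ge> 2 \<Longrightarrow> B z = 0"
    "\<And>z. 0 \<le> B z" "\<And>z. B z \<le> 1"
    "\<And>z. (B has_real_derivative B' z) (at z)" "\<And>z. z * B' z \<le> 0"
    using bump_exists by metis
  show thesis
  proof (rule that[of "\<lambda>z. - z * B z"])
    show "C_k_on k UNIV (\<lambda>z. - z * B z)" for k
      by (intro C_k_on_mult open_UNIV B(1) C_k_on_linear bounded_linear_minus bounded_linear_ident)
    show "\<bar>- z * B z\<bar> \<le> 2" for z
    proof (cases "\<bar>z\<bar> \<ge> 2")
      case False
      then have "\<bar>z\<bar> * \<bar>B z\<bar> \<le> 2 * 1" using B(4,5)[of z] by (intro mult_mono) auto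
      then show ?thesis by (simp add: abs_mult)
    qed (simp add: B)
    have "((\<lambda>z. - z * B z) has_real_derivative - B z - z * B' z) (at z)" for z
      by (auto intro!: derivative_eq_intros B(6))
    then have "deriv (\<lambda>z. - z * B z) z = - B z - z * B' z" for z by (rule DERIV_imp_deriv)
    \<comment> \<open>Since B <= 1 and z B' <= 0, the profile -z B(z) is nowhere steeper than on its
      linear part.\<close>
    then show "deriv (\<lambda>z. - z * B z) z \<ge> - 1" for z using B(5)[of z] B(7)[of z] by simp
  qed (use B in auto)
qed

section \<open>Simple waves\<close>

text \<open>Method of characteristics: w is constant along the lines x1 = y + t (c + m w0(y)), and
  the lower bound on m w0' is what keeps them from crossing before T. The foot y of a characteristic
  is only implicit, so w and its x1-derivative \<open>w\<^sub>1\<close> are described along the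
  characteristics. The set V reaches to slightly negative times because smoothness on the slab
  refers to an open neighbourhood.\<close>

lemma burgers_solution:
  fixes w\<^sub>0 :: "real \<Rightarrow> real" and b c m K T :: real
  assumes smooth: "\<And>k. C_k_on k UNIV w\<^sub>0" and "m > 0" "T > 0"
    and bound: "\<And>y. \<bar>w\<^sub>0 y\<bar> \<le> b"
    and slope: "\<And>y. m * deriv w\<^sub>0 y \<ge> - 1 / T" "\<And>y. \<bar>deriv w\<^sub>0 y\<bar> \<le> K"
  obtains V :: "spacetime set" and w w\<^sub>1 :: "spacetime \<Rightarrow> real" where
    "open V" "slab T \<subseteq> V" "\<And>k. C_k_on k V w"
    "\<And>p. p \<in> V \<Longrightarrow> (w has_derivative (\<lambda>v. w\<^sub>1 p * (fst (snd v) - (c + m * w p) * fst v))) (at p)"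
    "\<And>t y x\<^sub>2. 0 \<le> t \<Longrightarrow> t < T \<Longrightarrow> w (t, (y + t * (c + m * w\<^sub>0 y), x\<^sub>2)) = w\<^sub>0 y"
    "\<And>t y x\<^sub>2. 0 \<le> t \<Longrightarrow> t < T \<Longrightarrow>
       w\<^sub>1 (t, (y + t * (c + m * w\<^sub>0 y), x\<^sub>2)) = deriv w\<^sub>0 y / (1 + t * m * deriv w\<^sub>0 y)"
    "\<And>p. \<bar>w p\<bar> \<le> b"
    "\<And>t x. 0 \<le> t \<Longrightarrow> t < T \<Longrightarrow> \<bar>w\<^sub>1 (t, x)\<bar> \<le> K / (1 - t / T)"
    "\<And>t x\<^sub>1 x\<^sub>2 z\<^sub>2. w (t, (x\<^sub>1, x\<^sub>2)) = w (t, (x\<^sub>1, z\<^sub>2))"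
proof -
  define l where "l y = c + m * w\<^sub>0 y" for y
  define l' where "l' y = m * deriv w\<^sub>0 y" for y
  have dw: "(w\<^sub>0 has_real_derivative deriv w\<^sub>0 y) (at y)" for y
    by (rule C_k_on_real_deriv(1)[OF open_UNIV smooth UNIV_I])
  have dl: "(l has_real_derivative l' y) (at y)" for y
    unfolding l_def[abs_def] l'_def by (auto intro!: derivative_eq_intros dw)
  have K0: "K \<ge> 0" using slope(2)[of 0] by linarith
  \<comment> \<open>For negative times it is a large positive slope that could make characteristics
    cross; as m w0' <= m K, none do for t > -\<tau>. The summand 1 covers K = 0.\<close>
  define \<tau> where "\<tau> = 1 / (m * K + 1)"
  have \<tau>: "\<tau> > 0" using K0 \<open>m > 0\<close> by (simp add: \<tau>_def add_nonneg_pos)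
  define V :: "spacetime set" where "V = {-\<tau><..<T} \<times> UNIV"
  have V: "open V" by (simp add: V_def open_Times)
  have pos: "1 + t * l' y > 0" if t: "- \<tau> < t" "t < T" for t y
  proof (cases "t \<ge> 0")
    case True
    have "t * l' y \<ge> t * (- 1 / T)" unfolding l'_def by (rule mult_left_mono[OF slope(1) True])
    moreover have "t * (- 1 / T) > - 1" using t \<open>T > 0\<close> by (simp add: field_simps)
    ultimately show ?thesis by linarith
  next
    case False
    have "l' y \<le> m * K" unfolding l'_def using slope(2)[of y] \<open>m > 0\<close> by (intro mult_left_mono) auto
    then have "t * l' y \<ge> t * (m * K)" using False by (intro mult_left_mono_neg) auto
    also have "t * (m * K) \<ge> - \<tau> * (m * K)" using t K0 \<open>m > 0\<close> by (intro mult_right_mono) auto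
    moreover have "m * K + 1 > 0" using K0 \<open>m > 0\<close> by (simp add: add_nonneg_pos)
    then have "- \<tau> * (m * K) > - 1" by (simp add: \<tau>_def field_simps)
    ultimately show ?thesis by linarith
  qed
  have dX: "((\<lambda>y. y + t * l y) has_real_derivative 1 + t * l' y) (at y)" for t y
    by (auto intro!: derivative_eq_intros dl)
  have inj: "y = z" if t: "- \<tau> < t" "t < T" and eq: "y + t * l y = z + t * l z" for t y z
  proof (rule ccontr)
    assume "y \<noteq> z"
    have "u + t * l u < v + t * l v" if "u < v" for u v
      by (rule DERIV_pos_imp_increasing[OF that]) (use dX pos[OF t] in blast)
    then show False using eq \<open>y \<noteq> z\<close> by (metis less_irrefl linorder_neqE_linordered_idom)
  qed
  have surj: "\<exists>y. y + t * l y = x" for t x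
  proof -
    define L where "L = \<bar>t\<bar> * (\<bar>c\<bar> + m * b)"
    have b: "\<bar>t * l y\<bar> \<le> L" for y
      unfolding L_def l_def abs_mult
      using bound[of y] \<open>m > 0\<close> by (intro mult_left_mono) (auto intro!: order_trans[OF abs_triangle_ineq] simp: abs_mult)
    have "\<exists>y. x - L \<le> y \<and> y \<le> x + L \<and> y + t * l y = x"
    proof (rule IVT')
      show "x - L + t * l (x - L) \<le> x" using b[of "x - L"] by linarith
      show "x \<le> x + L + t * l (x + L)" using b[of "x + L"] by linarith
      show "x - L \<le> x + L" using b[of 0] by linarith
      show "continuous_on {x - L..x + L} (\<lambda>y. y + t * l y)"
        using dX by (meson DERIV_isCont continuous_at_imp_continuous_on)
    qed
    then show ?thesis by blast
  qed
  \<comment> \<open>Y chooses the foot of a characteristic through p. It satisfies its equation at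
    every point, and is the unique foot for times in V.\<close>
  define Y where "Y p = (SOME y. y + fst p * l y = fst (snd p))" for p :: spacetime
  have Y: "Y p + fst p * l (Y p) = fst (snd p)" for p
    unfolding Y_def using someI_ex[OF surj] .
  have Y_eq: "Y (t, (y + t * l y, x\<^sub>2)) = y" if "- \<tau> < t" "t < T" for t y x\<^sub>2
    by (rule inj[OF that]) (use Y[of "(t, (y + t * l y, x\<^sub>2))"] in simp)
  define Y' where "Y' p v = (fst (snd v) + (- l (Y p)) * fst v) * inverse (1 + fst p * l' (Y p))"
    for p v :: spacetime
  have dY: "(Y has_derivative Y' p) (at p)" if p: "p \<in> V" for p
  proof -
    \<comment> \<open>The map from characteristic to spatial coordinates fixes t and x2, hence maps
      the strip V to itself; the inverse function theorem applies and Y is the middle component of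
      the inverse.\<close>
    let ?f = "\<lambda>q::spacetime. (fst q, (fst (snd q) + fst q * l (fst (snd q)), snd (snd q)))"
    let ?g = "\<lambda>q. (fst q, (Y q, snd (snd q)))"
    let ?x = "(fst p, (Y p, snd (snd p)))"
    let ?f' = "\<lambda>v::spacetime. (fst v, ((1 + fst p * l' (Y p)) * fst (snd v) + l (Y p) * fst v, snd (snd v)))"
    have fx: "?f ?x = p" by (simp add: Y prod_eq_iff)
    have tp: "- \<tau> < fst p" "fst p < T" using p by (auto simp: V_def)
    have dl2: "((\<lambda>q::spacetime. l (fst (snd q))) has_derivative (\<lambda>v. l' (Y p) * fst (snd v))) (at ?x)"
      by (rule has_derivative_compose[of "\<lambda>q. fst (snd q)" "\<lambda>q. fst (snd q)" _ _ l "(*) (l' (Y p))"])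
         (use dl[of "Y p"] in \<open>auto intro!: derivative_eq_intros simp: has_field_derivative_def\<close>)
    have "(?g has_derivative (\<lambda>v. (fst v, (Y' p v, snd (snd v))))) (at (?f ?x))"
    proof (rule has_derivative_inverse_strong[where f="?f" and g="?g" and x="?x" and S=V, OF V])
      show "?x \<in> V" using p by (auto simp: V_def)
      have "continuous_on UNIV l" using dl DERIV_isCont continuous_at_imp_continuous_on by blast
      then show "continuous_on V ?f"
        by (auto intro!: continuous_intros continuous_on_compose2[where g=l and t=UNIV])
      show "?g (?f q) = q" if "q \<in> V" for q
        using that Y_eq[of "fst q" "fst (snd q)" "snd (snd q)"] by (auto simp: V_def prod_eq_iff)
      show "(?f has_derivative ?f') (at ?x)"
        by (auto intro!: derivative_eq_intros dl2 simp: algebra_simps)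
      show "?f' \<circ> (\<lambda>v. (fst v, (Y' p v, snd (snd v)))) = id"
      proof -
        have "q * (a * inverse q) + r = a + r" if "q > 0" for q a r :: real using that by simp
        note cancel = this[OF pos[OF tp, of "Y p"]]
        show ?thesis unfolding fun_eq_iff comp_def Y'_def fst_conv snd_conv cancel by simp
      qed
    qed
    then have "(?g has_derivative (\<lambda>v. (fst v, (Y' p v, snd (snd v))))) (at p)" unfolding fx .
    from bounded_linear.has_derivative[OF bounded_linear_fst bounded_linear.has_derivative[OF bounded_linear_snd this]]
    show ?thesis by simp
  qed
  have fstk: "C_k_on k V fst" for k by (intro C_k_on_linear bounded_linear_fst V)
  have l'k: "C_k_on k UNIV l'" and lk: "C_k_on k UNIV l" for k
    unfolding l_def[abs_def] l'_def[abs_def]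
    by (intro C_k_on_add C_k_on_mult C_k_on_const C_k_on_real_deriv(2) smooth open_UNIV)+
  \<comment> \<open>Bootstrap: the derivative of Y is a smooth expression in t and Y, so Y of class
    C^k is of class C^(k+1).\<close>
  have Yk: "C_k_on k V Y" for k
  proof (induction k)
    case 0
    then show ?case using dY has_derivative_continuous
      by (metis C_k_on.simps(1) continuous_at_imp_continuous_on)
  next
    case (Suc k)
    show ?case
    proof (rule C_k_onI[OF V dY])
      fix e
      have "C_k_on k V (\<lambda>p. inverse (1 + fst p * l' (Y p)))"
      proof (rule C_k_on_compose[OF V _ C_k_on_inverse])
        show "C_k_on k V (\<lambda>p. 1 + fst p * l' (Y p))"
          by (intro C_k_on_add[OF V C_k_on_const] C_k_on_mult[OF V fstk] C_k_on_compose[OF V open_UNIV l'k Suc] subset_UNIV)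
        show "(\<lambda>p. 1 + fst p * l' (Y p)) ` V \<subseteq> {x. x \<noteq> 0}"
        proof clarsimp
          fix t x assume "(t, x) \<in> V" "1 + t * l' (Y (t, x)) = 0"
          then show False using pos[of t "Y (t, x)"] by (auto simp: V_def)
        qed
      qed (simp add: open_Collect_neq)
      moreover have "C_k_on k V (\<lambda>p. - 1 * l (Y p))"
        by (intro C_k_on_mult[OF V C_k_on_const] C_k_on_compose[OF V open_UNIV lk Suc] subset_UNIV)
      ultimately show "C_k_on k V (\<lambda>p. Y' p e)"
        unfolding Y'_def by (intro C_k_on_mult[OF V] C_k_on_add[OF V C_k_on_const] C_k_on_const) simp_all
    qed
  qed
  define w where "w p = w\<^sub>0 (Y p)" for p
  define w\<^sub>1 where "w\<^sub>1 p = deriv w\<^sub>0 (Y p) * inverse (1 + fst p * l' (Y p))" for p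
  show thesis
  proof (rule that[of V w w\<^sub>1])
    show "open V" by (rule V)
    show "slab T \<subseteq> V" using \<tau> by (auto simp: V_def)
    show "C_k_on k V w" for k
      unfolding w_def by (rule C_k_on_compose[OF V open_UNIV smooth Yk subset_UNIV])
    show "(w has_derivative (\<lambda>v. w\<^sub>1 p * (fst (snd v) - (c + m * w p) * fst v))) (at p)" if "p \<in> V" for p
    proof -
      have "(w has_derivative (\<lambda>v. deriv w\<^sub>0 (Y p) * Y' p v)) (at p)"
        unfolding w_def[abs_def]
        by (rule has_derivative_compose[OF dY[OF that] dw[of "Y p", unfolded has_field_derivative_def]])
      moreover have "deriv w\<^sub>0 (Y p) * Y' p v = w\<^sub>1 p * (fst (snd v) - (c + m * w p) * fst v)" for v
        by (simp add: Y'_def w\<^sub>1_def w_def l_def algebra_simps)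
      ultimately show ?thesis by simp
    qed
    have t: "- \<tau> < t" if "0 \<le> t" for t using \<tau> that by linarith
    show "w (t, (y + t * (c + m * w\<^sub>0 y), x\<^sub>2)) = w\<^sub>0 y" if "0 \<le> t" "t < T" for t y x\<^sub>2
      using Y_eq[OF t that(2), of y x\<^sub>2] that(1) by (simp add: w_def l_def)
    show "w\<^sub>1 (t, (y + t * (c + m * w\<^sub>0 y), x\<^sub>2)) = deriv w\<^sub>0 y / (1 + t * m * deriv w\<^sub>0 y)"
      if "0 \<le> t" "t < T" for t y x\<^sub>2
      using Y_eq[OF t that(2), of y x\<^sub>2] that(1) by (simp add: w\<^sub>1_def l_def l'_def divide_inverse mult.assoc)
    show "\<bar>w p\<bar> \<le> b" for p by (simp add: w_def bound)
    show "\<bar>w\<^sub>1 (t, x)\<bar> \<le> K / (1 - t / T)" if "0 \<le> t" "t < T" for t x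
    proof -
      have "t * l' (Y (t, x)) \<ge> t * (- 1 / T)" unfolding l'_def by (rule mult_left_mono[OF slope(1) that(1)])
      then have "1 + t * l' (Y (t, x)) \<ge> 1 - t / T" by simp
      moreover have "1 - t / T > 0" using that \<open>T > 0\<close> by simp
      ultimately have "\<bar>deriv w\<^sub>0 (Y (t, x))\<bar> / (1 + t * l' (Y (t, x))) \<le> K / (1 - t / T)"
        using slope(2) K0 by (intro frac_le) auto
      then show ?thesis using pos[OF t[OF that(1)] that(2), of "Y (t, x)"]
        by (simp add: w\<^sub>1_def abs_mult divide_inverse)
    qed
    show "w (t, (x\<^sub>1, x\<^sub>2)) = w (t, (x\<^sub>1, z\<^sub>2))" for t x\<^sub>1 x\<^sub>2 z\<^sub>2 by (simp add: w_def Y_def)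
  qed
qed

text \<open>In a simple wave d\<rho>/dw is \<rho> divided by the sound speed, here c + \<theta> w;
  the power (1 + \<theta> w / c)^(1/\<theta>) solves this equation with value 1 at w = 0.\<close>

lemma wave_density_has_derivative:
  fixes w :: "'a::real_normed_vector \<Rightarrow> real"
  assumes "\<theta> > 0" "c > 0" "1 + \<theta> * w p / c > 0"
    and "(w has_derivative W) (at p)"
  shows "((\<lambda>q. (1 + \<theta> * w q / c) powr (1 / \<theta>)) has_derivative
    (\<lambda>v. (1 + \<theta> * w p / c) powr (1 / \<theta>) / (c + \<theta> * w p) * W v)) (at p)"
proof -
  have *: "((\<lambda>z. (1 + \<theta> * z / c) powr (1 / \<theta>)) has_real_derivative
      (1 + \<theta> * z / c) powr (1 / \<theta>) / (c + \<theta> * z)) (at z)" if "1 + \<theta> * z / c > 0" for z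
  proof -
    have "((\<lambda>z. (1 + \<theta> * z / c) powr (1 / \<theta>)) has_real_derivative
        (1 / \<theta>) * (1 + \<theta> * z / c) powr (1 / \<theta> - 1) * (\<theta> / c)) (at z)"
      by (rule DERIV_chain2[where f="\<lambda>y. y powr (1 / \<theta>)" and g="\<lambda>z. 1 + \<theta> * z / c" and x=z, OF has_real_derivative_powr[OF that, where r="1 / \<theta>"]])
         (use assms in \<open>auto intro!: derivative_eq_intros\<close>)
    moreover have "(1 / \<theta>) * (1 + \<theta> * z / c) powr (1 / \<theta> - 1) * (\<theta> / c) =
        (1 + \<theta> * z / c) powr (1 / \<theta>) / (c + \<theta> * z)"
    proof -
      have "c + \<theta> * z = c * (1 + \<theta> * z / c)" using assms(2) by (simp add: field_simps)
      then show ?thesis using that assms by (simp add: powr_diff)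
    qed
    ultimately show ?thesis by simp
  qed
  show ?thesis
    by (rule has_derivative_compose[OF assms(4) *[OF assms(3), unfolded has_field_derivative_def]])
qed

text \<open>With d\<rho> = r dw, r = \<rho> / (c + \<theta> w), and dp/d\<rho> = (c + \<theta> w)^2,
  the continuity equation is r times and the first momentum equation \<rho> times the transport
  equation of w, which is encoded in the shape of its derivative \<open>dw\<close>.\<close>

lemma simple_wave_euler:
  fixes w w\<^sub>1 :: "spacetime \<Rightarrow> real" and A \<gamma> :: real
  defines "c \<equiv> sqrt (A * \<gamma>)" and "\<theta> \<equiv> (\<gamma> - 1) / 2"
  assumes "A > 0" "\<gamma> > 1"
    and dw: "\<And>p. p \<in> V \<Longrightarrow>
      (w has_derivative (\<lambda>v. w\<^sub>1 p * (fst (snd v) - (c + (1 + \<theta>) * w p) * fst v))) (at p)"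
    and pos: "\<And>p. p \<in> V \<Longrightarrow> 1 + \<theta> * w p / c > 0"
  shows "euler_on A \<gamma> V (\<lambda>p. (1 + \<theta> * w p / c) powr (1 / \<theta>)) (\<lambda>p. (w p, 0)) (\<lambda>_. 0)"
  unfolding euler_on_def
proof
  fix p assume p: "p \<in> V"
  have \<theta>: "\<theta> > 0" and c: "c > 0" using assms by (auto simp: \<theta>_def c_def)
  define W where "W v = w\<^sub>1 p * (fst (snd v) - (c + (1 + \<theta>) * w p) * fst v)" for v :: spacetime
  define \<rho> where "\<rho> q = (1 + \<theta> * w q / c) powr (1 / \<theta>)" for q
  define r where "r = \<rho> p / (c + \<theta> * w p)"
  have dW: "(w has_derivative W) (at p)" using dw[OF p] by (simp add: W_def[abs_def])
  have d\<rho>: "(\<rho> has_derivative (\<lambda>v. r * W v)) (at p)"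
    unfolding r_def \<rho>_def[abs_def] by (rule wave_density_has_derivative[OF \<theta> c pos[OF p] dW])
  have \<rho>pos: "\<rho> p > 0" using pos[OF p] by (simp add: \<rho>_def)
  have cw: "c + \<theta> * w p > 0" using pos[OF p] c by (simp add: field_simps)
  have du: "((\<lambda>q. (w q, 0::real)) has_derivative (\<lambda>v. (W v, 0))) (at p)"
    by (auto intro!: derivative_eq_intros dW)
  have d\<rho>w: "((\<lambda>q. \<rho> q * fst (w q, 0::real)) has_derivative (\<lambda>v. \<rho> p * W v + r * W v * w p)) (at p)"
    by (auto intro!: derivative_eq_intros dW d\<rho>)
  have d0: "((\<lambda>q. \<rho> q * snd (w q, 0::real)) has_derivative (\<lambda>v. 0)) (at p)"
    by (auto intro!: derivative_eq_intros)
  have dp: "((\<lambda>q. pressure A \<gamma> (\<rho> q) 0) has_derivative (\<lambda>v. A * (\<gamma> * \<rho> p powr (\<gamma> - 1) * (r * W v)))) (at p)"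
    unfolding pressure_def using \<rho>pos
    by (auto intro!: derivative_eq_intros d\<rho> has_derivative_powr simp: powr_diff field_simps)
  have \<theta>2: "\<gamma> - 1 = 2 * \<theta>" by (simp add: \<theta>_def)
  \<comment> \<open>This is dp/d\<rho> at zero entropy: as \<gamma> - 1 = 2 \<theta>, the exponents
    1/\<theta> and \<gamma> - 1 multiply to 2.\<close>
  have key: "A * \<gamma> * \<rho> p powr (\<gamma> - 1) = (c + \<theta> * w p)\<^sup>2"
  proof -
    have "\<rho> p powr (\<gamma> - 1) = (1 + \<theta> * w p / c) powr 2"
      using \<theta> arg_cong[OF \<theta>2, of "\<lambda>y. y / \<theta>"] by (simp add: \<rho>_def powr_powr)
    also have "\<dots> = (1 + \<theta> * w p / c)\<^sup>2" using pos[OF p] by (simp add: powr_numeral)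
    finally have "\<rho> p powr (\<gamma> - 1) = (1 + \<theta> * w p / c)\<^sup>2" .
    moreover have "A * \<gamma> = c\<^sup>2" using assms by (simp add: c_def)
    ultimately show ?thesis using c by (simp add: power_mult_distrib[symmetric] field_simps)
  qed
  have fr: "frechet_derivative \<rho> (at p) = (\<lambda>v. r * W v)"
    "frechet_derivative (\<lambda>q. (w q, 0::real)) (at p) = (\<lambda>v. (W v, 0))"
    "frechet_derivative (\<lambda>q. \<rho> q * fst (w q, 0::real)) (at p) = (\<lambda>v. \<rho> p * W v + r * W v * w p)"
    "frechet_derivative (\<lambda>q. \<rho> q * snd (w q, 0::real)) (at p) = (\<lambda>v. 0)"
    "frechet_derivative (\<lambda>q. pressure A \<gamma> (\<rho> q) 0) (at p) = (\<lambda>v. A * (\<gamma> * \<rho> p powr (\<gamma> - 1) * (r * W v)))"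
    using frechet_derivative_at[OF d\<rho>] frechet_derivative_at[OF du] frechet_derivative_at[OF d\<rho>w]
      frechet_derivative_at[OF d0] frechet_derivative_at[OF dp] by simp_all
  have rc: "r * (c + \<theta> * w p) = \<rho> p" using cw by (simp add: r_def)
  have 1: "r * W (1, 0, 0) + (\<rho> p * W (0, 1, 0) + r * W (0, 1, 0) * w p) = 0"
    unfolding rc[symmetric] by (simp add: W_def algebra_simps)
  have "A * (\<gamma> * \<rho> p powr (\<gamma> - 1) * (r * W (0, 1, 0))) = (A * \<gamma> * \<rho> p powr (\<gamma> - 1)) * (r * W (0, 1, 0))"
    by simp
  also have "\<dots> = (c + \<theta> * w p) * (r * (c + \<theta> * w p)) * W (0, 1, 0)"
    unfolding key by (simp add: power2_eq_square)
  finally have 2: "\<rho> p * (W (1, 0, 0) + w p * W (0, 1, 0)) + A * (\<gamma> * \<rho> p powr (\<gamma> - 1) * (r * W (0, 1, 0))) = 0"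
    unfolding rc by (simp add: W_def algebra_simps)
  have 3: "W (0, 0, 1) = 0" by (simp add: W_def)
  show "D\<^sub>t (\<lambda>p. (1 + \<theta> * w p / c) powr (1 / \<theta>)) p +
        D\<^sub>1 (\<lambda>q. (1 + \<theta> * w q / c) powr (1 / \<theta>) * fst (w q, 0::real)) p +
        D\<^sub>2 (\<lambda>q. (1 + \<theta> * w q / c) powr (1 / \<theta>) * snd (w q, 0::real)) p = 0 \<and>
        (1 + \<theta> * w p / c) powr (1 / \<theta>) *\<^sub>R
        convective_derivative (\<lambda>p. (w p, 0)) (\<lambda>p. (w p, 0)) p +
        (D\<^sub>1 (\<lambda>q. pressure A \<gamma> ((1 + \<theta> * w q / c) powr (1 / \<theta>)) 0) p,
         D\<^sub>2 (\<lambda>q. pressure A \<gamma> ((1 + \<theta> * w q / c) powr (1 / \<theta>)) 0) p) = 0 \<and>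
        convective_derivative (\<lambda>p. (w p, 0)) (\<lambda>_. 0::real) p = 0"
    unfolding \<rho>_def[symmetric] convective_derivative_def D\<^sub>t_def D\<^sub>1_def D\<^sub>2_def fr
    using 1 2 3 by (simp add: frechet_derivative_const zero_prod_def)
qed

lemma sound_speed_simple_wave:
  fixes A \<gamma> w :: real
  defines "c \<equiv> sqrt (A * \<gamma>)" and "\<theta> \<equiv> (\<gamma> - 1) / 2"
  assumes "A > 0" "\<gamma> > 1" "1 + \<theta> * w / c > 0"
  shows "sound_speed A \<gamma> ((1 + \<theta> * w / c) powr (1 / \<theta>)) 0 = c + \<theta> * w"
proof -
  have c: "c > 0" using assms by (simp add: c_def)
  have \<theta>: "\<theta> > 0" "\<gamma> - 1 = 2 * \<theta>" using assms(4) by (simp_all add: \<theta>_def)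
  have "((1 + \<theta> * w / c) powr (1 / \<theta>)) powr (\<gamma> - 1) = (1 + \<theta> * w / c) powr 2"
    using \<theta> by (simp add: powr_powr)
  also have "\<dots> = (1 + \<theta> * w / c)\<^sup>2" using assms by (simp add: powr_numeral)
  finally have "sound_speed A \<gamma> ((1 + \<theta> * w / c) powr (1 / \<theta>)) 0 = c * (1 + \<theta> * w / c)"
    using assms(5) by (simp add: sound_speed_def real_sqrt_mult c_def)
  also have "\<dots> = c + \<theta> * w" using c by (simp add: field_simps)
  finally show ?thesis .
qed

section \<open>Causal curves\<close>

text \<open>The velocity of the curve is bounded by fluid speed plus sound speed off a finite set,
  and integrates to the displacement. This yields a cone inside the domain of dependence.\<close>

lemma causal_curve_displacement:
  assumes z: "causal_curve u c t z" and "0 \<le> t" "0 \<le> M"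
    and M: "\<And>s x. s \<in> {0..t} \<Longrightarrow> norm (u (s, x)) + c (s, x) \<le> M"
  shows "dist (z 0) (z t) \<le> M * t"
proof -
  obtain F where F: "finite F"
    "\<forall>s\<in>{0..t} - F. \<exists>v. (z has_vector_derivative v) (at s) \<and> norm (v - u (s, z s)) \<le> c (s, z s)"
    using z unfolding causal_curve_def by blast
  then obtain v where v: "\<And>s. s \<in> {0..t} - F \<Longrightarrow> (z has_vector_derivative v s) (at s)"
    "\<And>s. s \<in> {0..t} - F \<Longrightarrow> norm (v s - u (s, z s)) \<le> c (s, z s)" by metis
  define w where "w s = (if s \<in> F then 0 else v s)" for s
  have cont: "continuous_on {0..t} z"
    using z unfolding causal_curve_def piecewise_C1_differentiable_on_def by blast
  have "(w has_integral (z t - z 0)) {0..t}"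
    by (rule fundamental_theorem_of_calculus_interior_strong[OF F(1) \<open>0 \<le> t\<close> _ cont])
       (use v(1) in \<open>auto simp: w_def\<close>)
  then have "norm (z t - z 0) \<le> M * measure lborel (cbox 0 t)"
  proof (intro has_integral_bound[OF \<open>0 \<le> M\<close>])
    show "norm (w s) \<le> M" if "s \<in> cbox 0 t" for s
    proof (cases "s \<in> F")
      case False
      have "norm (v s) \<le> norm (u (s, z s)) + norm (v s - u (s, z s))" by norm
      also have "\<dots> \<le> norm (u (s, z s)) + c (s, z s)" using v(2)[of s] False that by simp
      also have "\<dots> \<le> M" using M that by simp
      finally show ?thesis using False by (simp add: w_def)
    qed (simp add: w_def \<open>0 \<le> M\<close>)
  qed simp
  then show ?thesis using \<open>0 \<le> t\<close> by (simp add: dist_norm norm_minus_commute)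
qed

text \<open>Where the flow is subsonic, staying at rest is causal; hence the slices of the domain of
  dependence lie in the initial region.\<close>

lemma causal_curve_const:
  assumes "\<And>s. s \<in> {0..t} \<Longrightarrow> norm (u (s, x)) \<le> c (s, x)"
  shows "causal_curve u c t (\<lambda>_. x)"
  unfolding causal_curve_def
proof (intro conjI exI[of _ "{}"] ballI)
  show "(\<lambda>_. x) piecewise_C1_differentiable_on {0..t}"
    by (rule C1_differentiable_imp_piecewise) simp
  show "\<exists>v. ((\<lambda>_. x) has_vector_derivative v) (at s) \<and> norm (v - u (s, x)) \<le> c (s, x)" if "s \<in> {0..t} - {}" for s
    using assms that by (intro exI[of _ 0]) auto
qed simp

text \<open>The derivative of a piecewise C1 curve may lack one-sided limits at the exceptional
  points. The direction of a causal curve is therefore only bounded and continuous off a finite set,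
  which measurability turns into integrability.\<close>

lemma integrable_bounded_continuous_off_finite:
  fixes f :: "real \<Rightarrow> 'b::euclidean_space"
  assumes "finite F" "continuous_on ({a..b} - F) f" "\<And>x. x \<in> {a..b} \<Longrightarrow> norm (f x) \<le> B"
  shows "f integrable_on {a..b}"
proof -
  have m: "{a..b} - F \<in> lmeasurable"
    using assms(1) by (intro fmeasurable_Diff lmeasurable_interval) (use assms(1) in \<open>auto intro: negligible_imp_sets negligible_finite\<close>)
  have "f integrable_on ({a..b} - F)"
  proof (rule measurable_bounded_by_integrable_imp_integrable)
    show "f \<in> borel_measurable (lebesgue_on ({a..b} - F))"
      using assms(2) m by (intro continuous_imp_measurable_on_sets_lebesgue) auto
    show "(\<lambda>_. B) integrable_on ({a..b} - F)" using m by (rule integrable_on_const)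
  qed (use assms(3) m in auto)
  then show ?thesis
    by (rule integrable_spike_set)
       (auto intro: negligible_subset[OF negligible_finite[OF assms(1)]])
qed

text \<open>
  The end point of a causal curve \<open>z\<close> can be moved by any small \<open>h\<close>: with \<open>z' = u + c k\<close>, \<open>|k| \<le> 1\<close>, the
  curve \<open>z + h + \<integral>\<^sub>s\<^sup>t K |h| e\<^bsup>K (t - \<sigma>)\<^esup> k(\<sigma>) d\<sigma>\<close> is again causal if \<open>K\<close> is twice the Lipschitz constant of
  \<open>u\<close> and \<open>c\<close>, since the speed that it loses exceeds the variation of \<open>u\<close> and \<open>c\<close>.
\<close>

lemma causal_curve_perturb_end:
  fixes u :: "spacetime \<Rightarrow> plane" and c :: "spacetime \<Rightarrow> real"
  assumes z: "causal_curve u c t z" and t: "0 \<le> t" and L: "0 \<le> L"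
    and cont: "continuous_on ({0..t} \<times> UNIV) u" "continuous_on ({0..t} \<times> UNIV) c"
    and lip: "\<And>s x y. s \<in> {0..t} \<Longrightarrow> norm (u (s, x) - u (s, y)) \<le> L * dist x y"
      "\<And>s x y. s \<in> {0..t} \<Longrightarrow> \<bar>c (s, x) - c (s, y)\<bar> \<le> L * dist x y"
    and l: "0 < l" "\<And>s x. s \<in> {0..t} \<Longrightarrow> l \<le> c (s, x)"
    and h: "2 * L * (norm h * exp (2 * L * t)) \<le> l"
  obtains y where "causal_curve u c t y" "y t = z t + h" "dist (y 0) (z 0) \<le> norm h * exp (2 * L * t)"
proof -
  define K where "K = 2 * L"
  have K: "K \<ge> 0" using L by (simp add: K_def)
  obtain F1 where F1: "finite F1" "z C1_differentiable_on ({0..t} - F1)" and zc: "continuous_on {0..t} z"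
    using z unfolding causal_curve_def piecewise_C1_differentiable_on_def by blast
  obtain D where D: "\<And>s. s \<in> {0..t} - F1 \<Longrightarrow> (z has_vector_derivative D s) (at s)" "continuous_on ({0..t} - F1) D"
    using F1(2) unfolding C1_differentiable_on_def by blast
  obtain F2 where F2: "finite F2"
    "\<forall>s\<in>{0..t} - F2. \<exists>v. (z has_vector_derivative v) (at s) \<and> norm (v - u (s, z s)) \<le> c (s, z s)"
    using z unfolding causal_curve_def by blast
  \<comment> \<open>The end points are added so that the remaining set is open and derivatives
    within it are two-sided.\<close>
  define F where "F = F1 \<union> F2 \<union> {0, t}"
  have F: "finite F" "F1 \<subseteq> F" "F2 \<subseteq> F" "0 \<in> F" "t \<in> F" using F1(1) F2(1) by (auto simp: F_def)
  have Dc: "norm (D s - u (s, z s)) \<le> c (s, z s)" if "s \<in> {0..t} - F" for s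
  proof -
    have s: "s \<in> {0..t} - F2" "s \<in> {0..t} - F1" using that F(2,3) by blast+
    obtain v where v: "(z has_vector_derivative v) (at s)" "norm (v - u (s, z s)) \<le> c (s, z s)"
      using bspec[OF F2(2) s(1)] by auto
    show ?thesis using v vector_derivative_unique_at[OF v(1) D(1)[OF s(2)]] by simp
  qed
  have cpos: "c (s, x) > 0" if "s \<in> {0..t}" for s x using l that by (meson less_le_trans)
  \<comment> \<open>Velocity relative to the fluid in units of the sound speed; the value 0 on F
    keeps the bound by 1 everywhere.\<close>
  define k where "k s = (if s \<in> F then 0 else inverse (c (s, z s)) *\<^sub>R (D s - u (s, z s)))" for s
  have k1: "norm (k s) \<le> 1" if "s \<in> {0..t}" for s
  proof (cases "s \<in> F")
    case False
    have "norm (k s) = norm (D s - u (s, z s)) / c (s, z s)"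
      using False cpos[OF that, of "z s"] by (simp add: k_def divide_inverse mult.commute)
    then show ?thesis using Dc[of s] that False cpos[OF that, of "z s"] by simp
  qed (simp add: k_def)
  \<comment> \<open>Bound for the distance of the two curves. It solves \<beta>' = -K \<beta> with
    \<beta>(t) = |h|, so that |h| plus the integral of K \<beta> over [s, t] is again
    \<beta>(s).\<close>
  define \<beta> where "\<beta> s = norm h * exp (K * (t - s))" for s
  have \<beta>t: "\<beta> t = norm h" by (simp add: \<beta>_def)
  have \<beta>0: "\<beta> s \<ge> 0" for s by (simp add: \<beta>_def)
  have \<beta>max: "\<beta> s \<le> norm h * exp (K * t)" if "s \<in> {0..t}" for s
    unfolding \<beta>_def using that K by (intro mult_left_mono) (auto simp: mult_left_mono)
  \<comment> \<open>The smallness of h keeps the lost speed below the sound speed, so the reduced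
    relative speed c - K \<beta> stays nonnegative.\<close>
  have K\<beta>: "K * \<beta> s \<le> c (s, x)" if "s \<in> {0..t}" for s x
    using mult_left_mono[OF \<beta>max[OF that] K] h l(2)[OF that, of x] by (simp add: K_def)
  define g where "g s = (K * \<beta> s) *\<^sub>R k s" for s
  have \<beta>c: "continuous_on S \<beta>" for S unfolding \<beta>_def[abs_def] by (intro continuous_intros)
  have gc: "continuous_on ({0..t} - F) g"
  proof -
    have "continuous_on ({0..t} - F) (\<lambda>s. inverse (c (s, z s)) *\<^sub>R (D s - u (s, z s)))"
    proof (intro continuous_intros)
      have zc': "continuous_on ({0..t} - F) z" by (rule continuous_on_subset[OF zc]) auto
      show "continuous_on ({0..t} - F) (\<lambda>s. c (s, z s))"
        by (rule continuous_on_compose2[OF cont(2)]) (auto intro!: continuous_intros zc')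
      show "continuous_on ({0..t} - F) (\<lambda>s. u (s, z s))"
        by (rule continuous_on_compose2[OF cont(1)]) (auto intro!: continuous_intros zc')
      show "continuous_on ({0..t} - F) D" by (rule continuous_on_subset[OF D(2)]) (use F in auto)
      show "\<forall>s\<in>{0..t} - F. c (s, z s) \<noteq> 0" using cpos by (metis DiffD1 less_irrefl)
    qed
    then have "continuous_on ({0..t} - F) k"
      by (rule continuous_on_eq) (auto simp: k_def)
    then show ?thesis unfolding g_def[abs_def] by (intro continuous_intros \<beta>c)
  qed
  have gb: "norm (g s) \<le> K * \<beta> s" if "s \<in> {0..t}" for s
    using mult_left_mono[OF k1[OF that], of "K * \<beta> s"] K \<beta>0[of s] by (simp add: g_def abs_mult)
  have gint: "g integrable_on {0..t}"
  proof (rule integrable_bounded_continuous_off_finite[OF F(1) gc])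
    show "norm (g s) \<le> K * (norm h * exp (K * t))" if "s \<in> {0..t}" for s
      using gb[OF that] mult_left_mono[OF \<beta>max[OF that] K] by linarith
  qed
  define I where "I s = integral {0..s} g" for s
  define y where "y s = z s + h + (I t - I s)" for s
  have op: "open ({0..t} - F)"
  proof -
    have "{0..t} - F = {0<..<t} - F" using F(4,5) by (auto simp: less_eq_real_def)
    then show ?thesis using F(1) by (simp add: open_Diff finite_imp_closed)
  qed
  have dI: "(I has_vector_derivative g s) (at s)" if "s \<in> {0..t} - F" for s
  proof -
    have "(I has_vector_derivative g s) (at s within ({0..t} - F))"
      unfolding I_def[abs_def]
      by (rule integral_has_vector_derivative_continuous_at[OF gint that F(1)])
         (use gc that in \<open>auto simp: continuous_on_eq_continuous_within\<close>)
    then show ?thesis by (simp only: at_within_open[OF that op])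
  qed
  have dy: "(y has_vector_derivative D s - g s) (at s)" if "s \<in> {0..t} - F" for s
  proof -
    have "(z has_vector_derivative D s) (at s)" by (rule D(1)) (use that F(2) in blast)
    then show ?thesis
      unfolding y_def[abs_def] using dI[OF that] by (auto intro!: derivative_eq_intros)
  qed
  have Iy: "norm (h + (I t - I s)) \<le> \<beta> s" if s: "s \<in> {0..t}" for s
  proof -
    have gi: "g integrable_on {s..t}" by (rule integrable_on_subinterval[OF gint]) (use s in auto)
    have "I t - I s = integral {s..t} g"
      using Henstock_Kurzweil_Integration.integral_combine[of 0 s t g] s gint by (simp add: I_def algebra_simps)
    moreover have "norm (integral {s..t} g) \<le> integral {s..t} (\<lambda>\<sigma>. K * \<beta> \<sigma>)"
      by (rule Henstock_Kurzweil_Integration.integral_norm_bound_integral[OF gi])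
         (use gb s in \<open>auto intro!: integrable_continuous_interval continuous_intros \<beta>c\<close>)
    moreover have "((\<lambda>\<sigma>. K * \<beta> \<sigma>) has_integral - \<beta> t - - \<beta> s) {s..t}"
      by (rule fundamental_theorem_of_calculus)
         (use s in \<open>auto simp: \<beta>_def[abs_def] has_real_derivative_iff_has_vector_derivative[symmetric] intro!: derivative_eq_intros\<close>)
    then have "integral {s..t} (\<lambda>\<sigma>. K * \<beta> \<sigma>) = \<beta> s - norm h"
      using integral_unique[of "\<lambda>\<sigma>. K * \<beta> \<sigma>" "- \<beta> t - - \<beta> s" "{s..t}"] \<beta>t by linarith
    ultimately show ?thesis using norm_triangle_ineq[of h "I t - I s"] by simp
  qed
  have yz: "dist (y s) (z s) \<le> \<beta> s" if "s \<in> {0..t}" for s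
    using Iy[OF that] by (simp add: dist_norm y_def add.assoc)
  show thesis
  proof (rule that)
    have "continuous_on {0..t} I" unfolding I_def[abs_def] by (rule indefinite_integral_continuous_1[OF gint])
    then have yc: "continuous_on {0..t} y" unfolding y_def[abs_def] by (intro continuous_intros zc)
    have "y C1_differentiable_on ({0..t} - F)"
      unfolding C1_differentiable_on_def
    proof (intro exI[of _ "\<lambda>s. D s - g s"] conjI ballI)
      show "continuous_on ({0..t} - F) (\<lambda>s. D s - g s)"
        by (intro continuous_intros gc continuous_on_subset[OF D(2)]) (use F in auto)
    qed (rule dy)
    then have "y piecewise_C1_differentiable_on {0..t}"
      unfolding piecewise_C1_differentiable_on_def using yc F(1) by blast
    moreover have "\<exists>v. (y has_vector_derivative v) (at s) \<and> norm (v - u (s, y s)) \<le> c (s, y s)"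
      if s: "s \<in> {0..t} - F" for s
    proof (intro exI conjI)
      show "(y has_vector_derivative D s - g s) (at s)" by (rule dy[OF s])
      have s': "s \<in> {0..t}" using s by simp
      have "D s = u (s, z s) + c (s, z s) *\<^sub>R k s" using s cpos[OF s', of "z s"] by (simp add: k_def)
      then have "D s - g s - u (s, y s) = (c (s, z s) - K * \<beta> s) *\<^sub>R k s + (u (s, z s) - u (s, y s))"
        by (simp add: g_def algebra_simps)
      then have "norm (D s - g s - u (s, y s)) \<le> norm ((c (s, z s) - K * \<beta> s) *\<^sub>R k s) + norm (u (s, z s) - u (s, y s))"
        using norm_triangle_ineq by metis
      also have "norm ((c (s, z s) - K * \<beta> s) *\<^sub>R k s) \<le> c (s, z s) - K * \<beta> s"
        using mult_left_mono[OF k1[OF s'], of "c (s, z s) - K * \<beta> s"] K\<beta>[OF s', of "z s"] by simp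
      also have "norm (u (s, z s) - u (s, y s)) \<le> L * \<beta> s"
        using order_trans[OF lip(1)[OF s', of "z s" "y s"] mult_left_mono[OF yz[OF s'] L, unfolded dist_commute[of "y s"]]] .
      \<comment> \<open>One half of K = 2 L pays for the variation of the fluid velocity, the other
        half for that of the sound speed.\<close>
      also have "c (s, z s) - K * \<beta> s + L * \<beta> s = c (s, z s) - L * \<beta> s" by (simp add: K_def)
      also have "\<dots> \<le> c (s, y s)"
        using order_trans[OF lip(2)[OF s', of "z s" "y s"] mult_left_mono[OF yz[OF s'] L, unfolded dist_commute[of "y s"]]]
        by linarith
      finally show "norm (D s - g s - u (s, y s)) \<le> c (s, y s)" by simp
    qed
    ultimately show "causal_curve u c t y" unfolding causal_curve_def using F(1) by blast
    show "y t = z t + h" by (simp add: y_def)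
    show "dist (y 0) (z 0) \<le> norm h * exp (2 * L * t)"
      using yz[of 0] t by (simp add: \<beta>_def K_def)
  qed
qed

text \<open>A causal curve from outside \<Omega> to x can be moved to end at any point near x; its
  starting point moves little and stays outside the closed set \<Omega>. So the complement of the
  slice is open. Closed slices are measurable, and once bounded they are compact, which gives finite
  H1 norms.\<close>

lemma closed_slice_domain_of_dependence:
  assumes t: "0 \<le> t" "t < T" and L: "0 \<le> L" and "closed \<Omega>"
    and c: "\<And>p. c p = sound_speed A \<gamma> (\<rho> p) (S p)"
    and cont: "continuous_on ({0..t} \<times> UNIV) u" "continuous_on ({0..t} \<times> UNIV) c"
    and lip: "\<And>s x y. s \<in> {0..t} \<Longrightarrow> norm (u (s, x) - u (s, y)) \<le> L * dist x y"
      "\<And>s x y. s \<in> {0..t} \<Longrightarrow> \<bar>c (s, x) - c (s, y)\<bar> \<le> L * dist x y"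
    and l: "0 < l" "\<And>s x. s \<in> {0..t} \<Longrightarrow> l \<le> c (s, x)"
  shows "closed (slice (domain_of_dependence A \<gamma> \<Omega> T \<rho> u S) t)"
proof -
  have slice: "slice (domain_of_dependence A \<gamma> \<Omega> T \<rho> u S) t = {x. \<forall>z. causal_curve u c t z \<and> z t = x \<longrightarrow> z 0 \<in> \<Omega>}"
    using t by (auto simp: slice_def domain_of_dependence_def c[abs_def])
  have "open (- {x. \<forall>z. causal_curve u c t z \<and> z t = x \<longrightarrow> z 0 \<in> \<Omega>})"
    unfolding open_dist
  proof
    fix x assume "x \<in> - {x. \<forall>z. causal_curve u c t z \<and> z t = x \<longrightarrow> z 0 \<in> \<Omega>}"
    then obtain z where z: "causal_curve u c t z" "z t = x" "z 0 \<in> - \<Omega>" by auto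
    obtain r where r: "r > 0" "\<And>y. dist y (z 0) < r \<Longrightarrow> y \<in> - \<Omega>"
      using z(3) \<open>closed \<Omega>\<close> by (metis open_dist open_Compl)
    \<comment> \<open>The perturbation of the end point grows by at most exp (2 L t) backwards in
      time; the result must be below r to miss \<Omega> and below l / (2 L) for causality, where 2 L
      + 1 also covers L = 0.\<close>
    define \<delta> where "\<delta> = min (l / (2 * L + 1)) r / exp (2 * L * t)"
    have "\<delta> > 0" using r l(1) L by (simp add: \<delta>_def)
    moreover have "y \<in> - {x. \<forall>z. causal_curve u c t z \<and> z t = x \<longrightarrow> z 0 \<in> \<Omega>}" if "dist y x < \<delta>" for y
    proof -
      have "norm (y - x) * exp (2 * L * t) < min (l / (2 * L + 1)) r"
        using that by (simp add: \<delta>_def dist_norm pos_less_divide_eq)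
      then have h: "norm (y - x) * exp (2 * L * t) \<le> l / (2 * L + 1)" "norm (y - x) * exp (2 * L * t) < r" by auto
      have "2 * L * (norm (y - x) * exp (2 * L * t)) \<le> 2 * L * (l / (2 * L + 1))"
        using L by (intro mult_left_mono h) auto
      also have "\<dots> \<le> l" using L l(1) by (simp add: divide_simps mult_left_mono)
      finally obtain w where "causal_curve u c t w" "w t = z t + (y - x)"
          "dist (w 0) (z 0) \<le> norm (y - x) * exp (2 * L * t)"
        using causal_curve_perturb_end[OF z(1) t(1) L cont lip l] by metis
      then show ?thesis using r(2)[of "w 0"] h(2) z(2) by auto
    qed
    ultimately show "\<exists>e>0. \<forall>y. dist y x < e \<longrightarrow> y \<in> - {x. \<forall>z. causal_curve u c t z \<and> z t = x \<longrightarrow> z 0 \<in> \<Omega>}"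
      by blast
  qed
  then show ?thesis unfolding slice closed_def .
qed

section \<open>Energy estimates in cones\<close>

lemma integral_fst_FTC:
  fixes G g :: "real \<times> 'b::euclidean_space \<Rightarrow> real"
  assumes "l \<le> r" and cont: "continuous_on (cbox (l, a) (r, b)) g"
    and der: "\<And>t x. t \<in> {l..r} \<Longrightarrow> x \<in> cbox a b \<Longrightarrow>
      ((\<lambda>t. G (t, x)) has_real_derivative g (t, x)) (at t)"
  shows "integral (cbox (l, a) (r, b)) g = integral (cbox a b) (\<lambda>x. G (r, x) - G (l, x))"
proof -
  have "integral (cbox (l, a) (r, b)) g = integral (cbox l r) (\<lambda>t. integral (cbox a b) (\<lambda>x. g (t, x)))"
    by (rule integral_prod_continuous[OF cont])
  also have "\<dots> = integral (cbox a b) (\<lambda>x. integral (cbox l r) (\<lambda>t. g (t, x)))"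
    by (rule integral_swap_continuous) (use cont in \<open>simp add: split_def\<close>)
  also have "\<dots> = integral (cbox a b) (\<lambda>x. G (r, x) - G (l, x))"
  proof (rule integral_cong)
    fix x assume x: "x \<in> cbox a b"
    have "((\<lambda>t. g (t, x)) has_integral G (r, x) - G (l, x)) {l..r}"
      by (rule fundamental_theorem_of_calculus[OF \<open>l \<le> r\<close>])
         (use der x in \<open>auto intro: has_vector_derivative_at_within simp: has_real_derivative_iff_has_vector_derivative\<close>)
    then show "integral (cbox l r) (\<lambda>t. g (t, x)) = G (r, x) - G (l, x)"
      by (simp add: integral_unique)
  qed
  finally show ?thesis .
qed

lemma integral_snd_FTC:
  fixes G g :: "'b::euclidean_space \<times> real \<Rightarrow> real"
  assumes "l \<le> r" and cont: "continuous_on (cbox (a, l) (b, r)) g"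
    and der: "\<And>t x. t \<in> {l..r} \<Longrightarrow> x \<in> cbox a b \<Longrightarrow>
      ((\<lambda>t. G (x, t)) has_real_derivative g (x, t)) (at t)"
  shows "integral (cbox (a, l) (b, r)) g = integral (cbox a b) (\<lambda>x. G (x, r) - G (x, l))"
proof -
  have "integral (cbox (a, l) (b, r)) g = integral (cbox a b) (\<lambda>x. integral (cbox l r) (\<lambda>t. g (x, t)))"
    by (rule integral_prod_continuous[OF cont])
  also have "\<dots> = integral (cbox a b) (\<lambda>x. G (x, r) - G (x, l))"
  proof (rule integral_cong)
    fix x assume x: "x \<in> cbox a b"
    have "((\<lambda>t. g (x, t)) has_integral G (x, r) - G (x, l)) {l..r}"
      by (rule fundamental_theorem_of_calculus[OF \<open>l \<le> r\<close>])
         (use der x in \<open>auto intro: has_vector_derivative_at_within simp: has_real_derivative_iff_has_vector_derivative\<close>)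
    then show "integral (cbox l r) (\<lambda>t. g (x, t)) = G (x, r) - G (x, l)"
      by (simp add: integral_unique)
  qed
  finally show ?thesis .
qed

lemma has_derivative_along_line:
  fixes f :: "'a::real_normed_vector \<Rightarrow> real"
  assumes "(f has_derivative f') (at (g t))" "(g has_vector_derivative e) (at t)"
  shows "((\<lambda>s. f (g s)) has_real_derivative f' e) (at t)"
proof -
  have "((\<lambda>s. f (g s)) has_derivative (\<lambda>h. f' (h *\<^sub>R e))) (at t)"
    using has_derivative_compose[OF assms(2)[unfolded has_vector_derivative_def] assms(1)] .
  moreover have "f' (h *\<^sub>R e) = f' e * h" for h
    using linear_scale[OF has_derivative_linear[OF assms(1)]] by simp
  ultimately show ?thesis by (simp add: has_field_derivative_def)
qed

text \<open>Fubini and the fundamental theorem in each variable. A weight that vanishes outside a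
  cone will make the lateral terms vanish, so a box can take the place of the cone.\<close>

lemma divergence_theorem_slab_box:
  fixes P Q R :: "spacetime \<Rightarrow> real"
  assumes "0 \<le> t\<^sub>1" "a\<^sub>1 \<le> b\<^sub>1" "a\<^sub>2 \<le> b\<^sub>2"
    and D: "D = cbox (0, (a\<^sub>1, a\<^sub>2)) (t\<^sub>1, (b\<^sub>1, b\<^sub>2))"
    and dP: "\<And>p. p \<in> D \<Longrightarrow> (P has_derivative P' p) (at p)"
    and dQ: "\<And>p. p \<in> D \<Longrightarrow> (Q has_derivative Q' p) (at p)"
    and dR: "\<And>p. p \<in> D \<Longrightarrow> (R has_derivative R' p) (at p)"
    and cP: "continuous_on D (\<lambda>p. P' p (1, 0, 0))"
    and cQ: "continuous_on D (\<lambda>p. Q' p (0, 1, 0))"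
    and cR: "continuous_on D (\<lambda>p. R' p (0, 0, 1))"
    and Q0: "\<And>t y. t \<in> {0..t\<^sub>1} \<Longrightarrow> Q (t, (a\<^sub>1, y)) = 0" "\<And>t y. t \<in> {0..t\<^sub>1} \<Longrightarrow> Q (t, (b\<^sub>1, y)) = 0"
    and R0: "\<And>t y. t \<in> {0..t\<^sub>1} \<Longrightarrow> R (t, (y, a\<^sub>2)) = 0" "\<And>t y. t \<in> {0..t\<^sub>1} \<Longrightarrow> R (t, (y, b\<^sub>2)) = 0"
  shows "integral D (\<lambda>p. P' p (1, 0, 0) + Q' p (0, 1, 0) + R' p (0, 0, 1)) =
    integral (cbox (a\<^sub>1, a\<^sub>2) (b\<^sub>1, b\<^sub>2)) (\<lambda>x. P (t\<^sub>1, x) - P (0, x))"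
proof -
  have mem: "(t, (x, y)) \<in> D \<longleftrightarrow> t \<in> {0..t\<^sub>1} \<and> x \<in> {a\<^sub>1..b\<^sub>1} \<and> y \<in> {a\<^sub>2..b\<^sub>2}" for t x y
    by (auto simp: D cbox_Pair_eq)
  have i: "(\<lambda>p. P' p (1, 0, 0)) integrable_on D" "(\<lambda>p. Q' p (0, 1, 0)) integrable_on D"
    "(\<lambda>p. R' p (0, 0, 1)) integrable_on D"
    using cP cQ cR by (auto simp: D intro!: integrable_continuous)
  have "integral D (\<lambda>p. P' p (1, 0, 0)) = integral (cbox (a\<^sub>1, a\<^sub>2) (b\<^sub>1, b\<^sub>2)) (\<lambda>x. P (t\<^sub>1, x) - P (0, x))"
    unfolding D
  proof (rule integral_fst_FTC)
    fix t and x :: plane assume "t \<in> {0..t\<^sub>1}" "x \<in> cbox (a\<^sub>1, a\<^sub>2) (b\<^sub>1, b\<^sub>2)"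
    then have "(P has_derivative P' (t, x)) (at (t, x))" by (intro dP) (auto simp: D cbox_Pair_eq)
    then show "((\<lambda>t. P (t, x)) has_real_derivative P' (t, x) (1, 0, 0)) (at t)"
      by (rule has_derivative_along_line[where g="\<lambda>t. (t, x)"])
         (auto simp: zero_prod_def[symmetric] intro!: derivative_eq_intros)
  qed (use cP assms in \<open>auto simp: D\<close>)
  moreover have "integral D (\<lambda>p. Q' p (0, 1, 0)) = 0"
  proof -
    have "integral D (\<lambda>p. Q' p (0, 1, 0)) =
        integral (cbox 0 t\<^sub>1) (\<lambda>t. integral (cbox (a\<^sub>1, a\<^sub>2) (b\<^sub>1, b\<^sub>2)) (\<lambda>x. Q' (t, x) (0, 1, 0)))"
      unfolding D by (rule integral_prod_continuous) (use cQ D in auto)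
    also have "\<dots> = integral (cbox 0 t\<^sub>1) (\<lambda>t. 0)"
    proof (rule integral_cong)
      fix t assume t: "t \<in> cbox 0 t\<^sub>1"
      have "integral (cbox (a\<^sub>1, a\<^sub>2) (b\<^sub>1, b\<^sub>2)) (\<lambda>x. Q' (t, x) (0, 1, 0)) =
          integral (cbox a\<^sub>2 b\<^sub>2) (\<lambda>y. Q (t, (b\<^sub>1, y)) - Q (t, (a\<^sub>1, y)))"
      proof (rule integral_fst_FTC[where G="\<lambda>x. Q (t, x)"])
        show "continuous_on (cbox (a\<^sub>1, a\<^sub>2) (b\<^sub>1, b\<^sub>2)) (\<lambda>x. Q' (t, x) (0, 1, 0))"
          by (rule continuous_on_compose2[OF cQ, where f="\<lambda>x. (t, x)"])
             (use t in \<open>auto intro!: continuous_intros simp: D cbox_Pair_eq\<close>)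
        fix x y assume "x \<in> {a\<^sub>1..b\<^sub>1}" "y \<in> cbox a\<^sub>2 b\<^sub>2"
        then have "(Q has_derivative Q' (t, (x, y))) (at (t, (x, y)))" using t by (intro dQ) (auto simp: mem)
        then show "((\<lambda>x. Q (t, (x, y))) has_real_derivative Q' (t, (x, y)) (0, 1, 0)) (at x)"
          by (rule has_derivative_along_line[where g="\<lambda>x. (t, (x, y))"]) (auto intro!: derivative_eq_intros)
      qed (use assms in auto)
      also have "\<dots> = 0" using Q0 t by simp
      finally show "integral (cbox (a\<^sub>1, a\<^sub>2) (b\<^sub>1, b\<^sub>2)) (\<lambda>x. Q' (t, x) (0, 1, 0)) = 0" .
    qed
    finally show ?thesis by simp
  qed
  moreover have "integral D (\<lambda>p. R' p (0, 0, 1)) = 0"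
  proof -
    have "integral D (\<lambda>p. R' p (0, 0, 1)) =
        integral (cbox 0 t\<^sub>1) (\<lambda>t. integral (cbox (a\<^sub>1, a\<^sub>2) (b\<^sub>1, b\<^sub>2)) (\<lambda>x. R' (t, x) (0, 0, 1)))"
      unfolding D by (rule integral_prod_continuous) (use cR D in auto)
    also have "\<dots> = integral (cbox 0 t\<^sub>1) (\<lambda>t. 0)"
    proof (rule integral_cong)
      fix t assume t: "t \<in> cbox 0 t\<^sub>1"
      have "integral (cbox (a\<^sub>1, a\<^sub>2) (b\<^sub>1, b\<^sub>2)) (\<lambda>x. R' (t, x) (0, 0, 1)) =
          integral (cbox a\<^sub>1 b\<^sub>1) (\<lambda>y. R (t, (y, b\<^sub>2)) - R (t, (y, a\<^sub>2)))"
      proof (rule integral_snd_FTC[where G="\<lambda>x. R (t, x)"])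
        show "continuous_on (cbox (a\<^sub>1, a\<^sub>2) (b\<^sub>1, b\<^sub>2)) (\<lambda>x. R' (t, x) (0, 0, 1))"
          by (rule continuous_on_compose2[OF cR, where f="\<lambda>x. (t, x)"])
             (use t in \<open>auto intro!: continuous_intros simp: D cbox_Pair_eq\<close>)
        fix y x assume "y \<in> {a\<^sub>2..b\<^sub>2}" "x \<in> cbox a\<^sub>1 b\<^sub>1"
        then have "(R has_derivative R' (t, (x, y))) (at (t, (x, y)))" using t by (intro dR) (auto simp: mem)
        then show "((\<lambda>y. R (t, (x, y))) has_real_derivative R' (t, (x, y)) (0, 0, 1)) (at y)"
          by (rule has_derivative_along_line[where g="\<lambda>y. (t, (x, y))"]) (auto intro!: derivative_eq_intros)
      qed (use assms in auto)
      also have "\<dots> = 0" using R0 t by simp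
      finally show "integral (cbox (a\<^sub>1, a\<^sub>2) (b\<^sub>1, b\<^sub>2)) (\<lambda>x. R' (t, x) (0, 0, 1)) = 0" .
    qed
    finally show ?thesis by simp
  qed
  ultimately show ?thesis using i by (simp add: integral_add integrable_add)
qed

text \<open>Squaring makes the positive part continuously differentiable, which is the regularity
  that the weight of the energy estimate needs.\<close>

lemma max_0_square_has_derivative:
  "((\<lambda>x. (max 0 x)\<^sup>2) has_real_derivative 2 * max 0 x) (at (x::real))"
proof -
  consider "x > 0" | "x < 0" | "x = 0" by linarith
  then show ?thesis
  proof cases
    case 1
    have "((\<lambda>x. x\<^sup>2) has_real_derivative 2 * x) (at x)" by (auto intro!: derivative_eq_intros)
    then have "((\<lambda>x. (max 0 x)\<^sup>2) has_real_derivative 2 * x) (at x)"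
      by (rule has_field_derivative_transform_within_open[of _ _ _ "{0<..}"]) (use 1 in auto)
    then show ?thesis using 1 by simp
  next
    case 2
    have "((\<lambda>x. 0) has_real_derivative 0) (at x)" by simp
    then have "((\<lambda>x. (max 0 x)\<^sup>2) has_real_derivative 0) (at x)"
      by (rule has_field_derivative_transform_within_open[of _ _ _ "{..<0}"]) (use 2 in auto)
    then show ?thesis using 2 by simp
  next
    case 3
    have "((\<lambda>y::real. max 0 y) \<longlongrightarrow> max 0 0) (at 0)" by (intro tendsto_intros)
    then have "((\<lambda>y::real. ((max 0 y)\<^sup>2 - (max 0 0)\<^sup>2) / (y - 0)) \<longlongrightarrow> 0) (at 0)"
      by (rule Lim_transform_eventually[OF _ always_eventually, THEN tendsto_eq_rhs])
         (auto simp: max_def power2_eq_square)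
    then show ?thesis using 3 by (simp add: has_field_derivative_iff)
  qed
qed

text \<open>The divergence identity is integrated against the weight e^(-K t) max(0, q)^2, where q =
  (r - M t)^2 - |x - x0|^2 is positive inside the cone. The flux bound says that energy travels at
  speed at most M, so the derivatives of q contribute with a favourable sign, and the exponential
  absorbs the right-hand side. The integrand H is then nonpositive, while its integral is the final
  weighted energy minus a vanishing initial one, hence nonnegative. So H = 0, and with it the
  weighted energy.\<close>

lemma energy_vanishes_in_cone:
  fixes E F G :: "spacetime \<Rightarrow> real" and x\<^sub>0 :: plane
  assumes "t\<^sub>1 > 0" "M \<ge> 0" "r - M * t\<^sub>1 > 0"
    and V: "open V" "{0..t\<^sub>1} \<times> UNIV \<subseteq> V"
    and dE: "\<And>p. p \<in> V \<Longrightarrow> (E has_derivative E' p) (at p)"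
    and dF: "\<And>p. p \<in> V \<Longrightarrow> (F has_derivative F' p) (at p)"
    and dG: "\<And>p. p \<in> V \<Longrightarrow> (G has_derivative G' p) (at p)"
    and cE: "continuous_on V (\<lambda>p. E' p (1, 0, 0))"
    and cF: "continuous_on V (\<lambda>p. F' p (0, 1, 0))"
    and cG: "continuous_on V (\<lambda>p. G' p (0, 0, 1))"
    and nonneg: "\<And>p. E p \<ge> 0"
    and flux: "\<And>t x a b. t \<in> {0..t\<^sub>1} \<Longrightarrow> dist x x\<^sub>0 \<le> r - M * t \<Longrightarrow>
      \<bar>a * F (t, x) + b * G (t, x)\<bar> \<le> M * norm (a, b) * E (t, x)"
    and ineq: "\<And>t x. t \<in> {0..t\<^sub>1} \<Longrightarrow> dist x x\<^sub>0 \<le> r - M * t \<Longrightarrow>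
      E' (t, x) (1, 0, 0) + F' (t, x) (0, 1, 0) + G' (t, x) (0, 0, 1) \<le> C * E (t, x)"
    and initial: "\<And>x. dist x x\<^sub>0 \<le> r \<Longrightarrow> E (0, x) = 0"
    and tx: "t \<in> {0..t\<^sub>1}" "dist x x\<^sub>0 < r - M * t"
  shows "E (t, x) = 0"
proof -
  obtain a\<^sub>1 a\<^sub>2 where x0: "x\<^sub>0 = (a\<^sub>1, a\<^sub>2)" by (cases x\<^sub>0)
  have "M * t\<^sub>1 \<ge> 0" using assms(1,2) by simp
  then have r: "r > 0" using assms(3) by linarith
  have rt: "r - M * s > 0" "r - M * s \<le> r" if "s \<in> {0..t\<^sub>1}" for s
  proof -
    have "M * s \<le> M * t\<^sub>1" using that assms(2) by (intro mult_left_mono) auto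
    then show "r - M * s > 0" using assms(3) by linarith
    show "r - M * s \<le> r" using that assms(2) by simp
  qed
  \<comment> \<open>The excess over C sharpens H <= 0 to H <= -\<phi> E, so that H = 0 gives \<phi>
    E = 0 pointwise.\<close>
  define K where "K = C + 1"
  define q where "q p = (r - M * fst p)\<^sup>2 - ((fst (snd p) - a\<^sub>1)\<^sup>2 + (snd (snd p) - a\<^sub>2)\<^sup>2)" for p :: spacetime
  define q' where "q' p v = - 2 * M * (r - M * fst p) * fst v
      - 2 * ((fst (snd p) - a\<^sub>1) * fst (snd v) + (snd (snd p) - a\<^sub>2) * snd (snd v))" for p v :: spacetime
  define \<phi> where "\<phi> p = exp (- K * fst p) * (max 0 (q p))\<^sup>2" for p
  define \<phi>' where "\<phi>' p v = - K * \<phi> p * fst v + exp (- K * fst p) * (2 * max 0 (q p)) * q' p v" for p v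
  have dq: "(q has_derivative q' p) (at p)" for p
    unfolding q_def[abs_def] q'_def[abs_def] by (auto intro!: derivative_eq_intros simp: algebra_simps)
  have dm: "((\<lambda>p. (max 0 (q p))\<^sup>2) has_derivative (\<lambda>v. 2 * max 0 (q p) * q' p v)) (at p)" for p
    by (rule has_derivative_compose[OF dq max_0_square_has_derivative[unfolded has_field_derivative_def]])
  have de: "((\<lambda>p. exp (- K * fst p)) has_derivative (\<lambda>v. - K * fst v * exp (- K * fst p))) (at p)" for p :: spacetime
    by (auto intro!: derivative_eq_intros)
  have d\<phi>: "(\<phi> has_derivative \<phi>' p) (at p)" for p
    unfolding \<phi>_def[abs_def] \<phi>'_def[abs_def]
    by (rule has_derivative_eq_rhs[OF has_derivative_mult[OF de dm]])
       (simp add: fun_eq_iff \<phi>_def algebra_simps)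
  have c\<phi>: "continuous_on S \<phi>" for S
    using d\<phi> has_derivative_continuous by (metis continuous_at_imp_continuous_on)
  have cq: "continuous_on S q" for S
    using dq has_derivative_continuous by (metis continuous_at_imp_continuous_on)
  have c\<phi>': "continuous_on S (\<lambda>p. \<phi>' p e)" for S e
    unfolding \<phi>'_def q'_def by (intro continuous_intros c\<phi> cq)
  let ?box = "cbox (0, (a\<^sub>1 - r, a\<^sub>2 - r)) (t\<^sub>1, (a\<^sub>1 + r, a\<^sub>2 + r))"
  have boxV: "?box \<subseteq> V" using V(2) by (auto simp: cbox_Pair_eq)
  \<comment> \<open>The cone is widest at time 0, with radius r, so the box of half width r encloses
    it and the weight vanishes on the lateral faces.\<close>
  have side: "\<phi> (s, (y, z)) = 0" if "s \<in> {0..t\<^sub>1}" "\<bar>y - a\<^sub>1\<bar> \<ge> r \<or> \<bar>z - a\<^sub>2\<bar> \<ge> r" for s y z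
  proof -
    have "(r - M * s)\<^sup>2 \<le> r\<^sup>2" using rt[OF that(1)] by (intro power_mono) auto
    moreover have "r\<^sup>2 \<le> (y - a\<^sub>1)\<^sup>2 + (z - a\<^sub>2)\<^sup>2"
      using that(2)
    proof
      assume "\<bar>y - a\<^sub>1\<bar> \<ge> r"
      then have "r\<^sup>2 \<le> (y - a\<^sub>1)\<^sup>2" using r by (metis abs_le_square_iff abs_of_pos)
      then show ?thesis by (simp add: add_increasing2)
    next
      assume "\<bar>z - a\<^sub>2\<bar> \<ge> r"
      then have "r\<^sup>2 \<le> (z - a\<^sub>2)\<^sup>2" using r by (metis abs_le_square_iff abs_of_pos)
      then show ?thesis by (simp add: add_increasing)
    qed
    ultimately have "q (s, (y, z)) \<le> 0" by (simp add: q_def)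
    then show ?thesis by (simp add: \<phi>_def)
  qed
  have distq: "q (s, y) = (r - M * s)\<^sup>2 - (dist y x\<^sub>0)\<^sup>2" for s y
    by (cases y) (simp add: q_def x0 dist_Pair_Pair dist_real_def)
  have cone: "dist y x\<^sub>0 < r - M * s" if "s \<in> {0..t\<^sub>1}" "q (s, y) > 0" for s y
    using that rt[OF that(1)] by (simp add: distq power_less_imp_less_base)
  define H where "H p = (\<phi> p * E' p (1, 0, 0) + \<phi>' p (1, 0, 0) * E p) + (\<phi> p * F' p (0, 1, 0) + \<phi>' p (0, 1, 0) * F p)
     + (\<phi> p * G' p (0, 0, 1) + \<phi>' p (0, 0, 1) * G p)" for p
  have cV: "continuous_on V E" "continuous_on V F" "continuous_on V G"
    using dE dF dG has_derivative_continuous by (metis continuous_at_imp_continuous_on)+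
  have "integral ?box H = integral (cbox (a\<^sub>1 - r, a\<^sub>2 - r) (a\<^sub>1 + r, a\<^sub>2 + r))
      (\<lambda>x. \<phi> (t\<^sub>1, x) * E (t\<^sub>1, x) - \<phi> (0, x) * E (0, x))"
    unfolding H_def
  proof (rule divergence_theorem_slab_box[where P="\<lambda>p. \<phi> p * E p" and Q="\<lambda>p. \<phi> p * F p" and R="\<lambda>p. \<phi> p * G p"
        and P'="\<lambda>p v. \<phi> p * E' p v + \<phi>' p v * E p" and Q'="\<lambda>p v. \<phi> p * F' p v + \<phi>' p v * F p"
        and R'="\<lambda>p v. \<phi> p * G' p v + \<phi>' p v * G p", OF _ _ _ refl])
    show "((\<lambda>p. \<phi> p * E p) has_derivative (\<lambda>v. \<phi> p * E' p v + \<phi>' p v * E p)) (at p)" if "p \<in> ?box" for p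
      using that boxV by (intro has_derivative_mult d\<phi> dE) auto
    show "((\<lambda>p. \<phi> p * F p) has_derivative (\<lambda>v. \<phi> p * F' p v + \<phi>' p v * F p)) (at p)" if "p \<in> ?box" for p
      using that boxV by (intro has_derivative_mult d\<phi> dF) auto
    show "((\<lambda>p. \<phi> p * G p) has_derivative (\<lambda>v. \<phi> p * G' p v + \<phi>' p v * G p)) (at p)" if "p \<in> ?box" for p
      using that boxV by (intro has_derivative_mult d\<phi> dG) auto
  qed (use assms(1) r side in \<open>auto intro!: continuous_intros c\<phi> c\<phi>' continuous_on_subset[OF _ boxV] cE cF cG cV\<close>)
  also have "\<dots> \<ge> 0"
  proof (rule integral_nonneg)
    have *: "continuous_on (cbox (a\<^sub>1 - r, a\<^sub>2 - r) (a\<^sub>1 + r, a\<^sub>2 + r)) (\<lambda>x. \<phi> (s, x) * E (s, x))" if "s \<in> {0..t\<^sub>1}" for s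
    proof -
      have "continuous_on V (\<lambda>p. \<phi> p * E p)" by (intro continuous_intros c\<phi> cV)
      then show ?thesis
        by (rule continuous_on_compose2[where f="\<lambda>x. (s, x)"]) (use V(2) that in \<open>auto intro!: continuous_intros\<close>)
    qed
    show "(\<lambda>x. \<phi> (t\<^sub>1, x) * E (t\<^sub>1, x) - \<phi> (0, x) * E (0, x)) integrable_on cbox (a\<^sub>1 - r, a\<^sub>2 - r) (a\<^sub>1 + r, a\<^sub>2 + r)"
      using *[of 0] *[of t\<^sub>1] assms(1) by (intro integrable_diff integrable_continuous) auto
    fix y
    have "\<phi> (0, y) * E (0, y) = 0"
    proof (cases "q (0, y) > 0")
      case True
      have "0 \<in> {0..t\<^sub>1}" using assms(1) by simp
      from cone[OF this True] show ?thesis by (simp add: initial)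
    qed (simp add: \<phi>_def)
    moreover have "\<phi> (t\<^sub>1, y) \<ge> 0" by (simp add: \<phi>_def)
    ultimately show "\<phi> (t\<^sub>1, y) * E (t\<^sub>1, y) - \<phi> (0, y) * E (0, y) \<ge> 0"
      using mult_nonneg_nonneg[OF _ nonneg, of "\<phi> (t\<^sub>1, y)" "(t\<^sub>1, y)"] by linarith
  qed
  finally have int: "integral ?box H \<ge> 0" .
  have H: "H (s, y) \<le> - (\<phi> (s, y) * E (s, y))" if s: "s \<in> {0..t\<^sub>1}" for s y
  proof (cases "q (s, y) > 0")
    case False
    then have "max 0 (q (s, y)) = 0" by simp
    then show ?thesis by (simp add: H_def \<phi>_def \<phi>'_def)
  next
    case True
    note d = less_imp_le[OF cone[OF s True]]
    define e where "e = exp (- K * s) * (2 * max 0 (q (s, y)))"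
    have e: "e \<ge> 0" by (simp add: e_def)
    \<comment> \<open>The gradient of q is -2 (x - x0) in space and -2 M (r - M t) in time; the flux
      along x - x0 is thus outweighed by the time derivative.\<close>
    have "\<bar>(fst y - a\<^sub>1) * F (s, y) + (snd y - a\<^sub>2) * G (s, y)\<bar> \<le> M * norm (fst y - a\<^sub>1, snd y - a\<^sub>2) * E (s, y)"
      by (rule flux[OF s d])
    also have "norm (fst y - a\<^sub>1, snd y - a\<^sub>2) = dist y x\<^sub>0"
      by (simp add: x0 dist_prod_def norm_prod_def dist_real_def)
    also have "M * dist y x\<^sub>0 * E (s, y) \<le> M * (r - M * s) * E (s, y)"
      using d assms(2) nonneg by (intro mult_right_mono mult_left_mono) auto
    finally have fl: "- 2 * M * (r - M * s) * E (s, y) - 2 * ((fst y - a\<^sub>1) * F (s, y) + (snd y - a\<^sub>2) * G (s, y)) \<le> 0"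
      by (simp add: abs_le_iff)
    have "H (s, y) = \<phi> (s, y) * (E' (s, y) (1, 0, 0) + F' (s, y) (0, 1, 0) + G' (s, y) (0, 0, 1))
        - K * \<phi> (s, y) * E (s, y)
        + e * (- 2 * M * (r - M * s) * E (s, y) - 2 * ((fst y - a\<^sub>1) * F (s, y) + (snd y - a\<^sub>2) * G (s, y)))"
      by (simp add: H_def \<phi>'_def q'_def e_def algebra_simps)
    also have "\<dots> \<le> \<phi> (s, y) * (C * E (s, y)) - K * \<phi> (s, y) * E (s, y) + 0"
      using ineq[OF s d] mult_nonneg_nonpos[OF e fl]
      by (intro add_mono diff_right_mono mult_left_mono) (auto simp: \<phi>_def)
    also have "\<dots> = - (\<phi> (s, y) * E (s, y))" by (simp add: K_def algebra_simps)
    finally show ?thesis .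
  qed
  have \<phi>E: "\<phi> p * E p \<ge> 0" for p by (simp add: \<phi>_def nonneg)
  have Hnp: "- H p \<ge> 0" if "p \<in> ?box" for p
    using H[of "fst p" "snd p"] \<phi>E[of p] that by (auto simp: cbox_Pair_eq)
  have cH: "continuous_on ?box (\<lambda>p. - H p)"
    unfolding H_def by (intro continuous_intros c\<phi> c\<phi>' continuous_on_subset[OF _ boxV] cE cF cG cV)
  have "integral ?box (\<lambda>p. - H p) \<ge> 0"
    by (rule integral_nonneg[OF integrable_continuous[OF cH] Hnp])
  then have "integral ?box (\<lambda>p. - H p) = 0" using int by simp
  moreover have "box (0, (a\<^sub>1 - r, a\<^sub>2 - r)) (t\<^sub>1, (a\<^sub>1 + r, a\<^sub>2 + r)) \<noteq> {}"
    using assms(1) r by (auto simp: box_ne_empty Basis_prod_def)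
  ultimately have H0: "H p = 0" if "p \<in> ?box" for p
    using integral_cbox_eq_0_iff[OF cH] Hnp that by auto
  have qtx: "q (t, x) > 0" using tx rt[OF tx(1)] by (simp add: distq power_strict_mono)
  have "(t, x) \<in> ?box"
  proof -
    have "dist x x\<^sub>0 \<le> r" using tx rt[OF tx(1)] by linarith
    then have "\<bar>fst x - a\<^sub>1\<bar> \<le> r" "\<bar>snd x - a\<^sub>2\<bar> \<le> r"
      using dist_fst_le[of x x\<^sub>0] dist_snd_le[of x x\<^sub>0] by (auto simp: x0 dist_real_def)
    then show ?thesis using tx by (cases x) (auto simp: cbox_Pair_eq abs_le_iff)
  qed
  from H0[OF this] H[OF tx(1), of x] \<phi>E[of "(t, x)"] have "\<phi> (t, x) * E (t, x) = 0" by linarith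
  then show ?thesis using qtx by (simp add: \<phi>_def)
qed

section \<open>Local uniqueness\<close>

lemma C_1_on_derivatives:
  fixes f :: "spacetime \<Rightarrow> real"
  assumes "C_k_on 1 V f" "open V"
  shows "p \<in> V \<Longrightarrow> (f has_derivative frechet_derivative f (at p)) (at p)"
    and "continuous_on V (D\<^sub>t f)" "continuous_on V (D\<^sub>1 f)" "continuous_on V (D\<^sub>2 f)" "continuous_on V f"
proof -
  have 1: "C_k_on (Suc 0) V f" using assms(1) by simp
  show "p \<in> V \<Longrightarrow> (f has_derivative frechet_derivative f (at p)) (at p)"
    by (rule C_k_on_has_derivative[OF 1 assms(2)])
  have "(1, 0, 0) \<in> (Basis :: spacetime set)" "(0, 1, 0) \<in> (Basis :: spacetime set)" "(0, 0, 1) \<in> (Basis :: spacetime set)"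
    by (auto simp: Basis_prod_def zero_prod_def)
  then show "continuous_on V (D\<^sub>t f)" "continuous_on V (D\<^sub>1 f)" "continuous_on V (D\<^sub>2 f)"
    using 1 unfolding D\<^sub>t_def[abs_def] D\<^sub>1_def[abs_def] D\<^sub>2_def[abs_def] by auto
  show "continuous_on V f" by (rule C_k_on_imp_continuous_on[OF assms(1)])
qed

text \<open>The entropy of the second solution enters its momentum equation through exp (s /
  \<gamma>) - 1, which has to be dominated by |s| for the energy estimate to close.\<close>

lemma abs_exp_minus_one_le: "\<bar>exp y - 1\<bar> \<le> \<bar>y\<bar> * exp \<bar>y\<bar>" for y :: real
proof (cases "y \<ge> 0")
  case True
  have "1 - y \<le> exp (- y)" using exp_ge_add_one_self[of "- y"] by simp
  then have "(1 - y) * exp y \<le> exp (- y) * exp y" by (rule mult_right_mono) simp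
  then show ?thesis using True by (simp add: algebra_simps flip: exp_add)
next
  case False
  then have "exp y \<le> 1" "1 + y \<le> exp y" using exp_ge_add_one_self[of y] by auto
  then have "\<bar>exp y - 1\<bar> \<le> \<bar>y\<bar> * 1" using False by linarith
  also have "\<dots> \<le> \<bar>y\<bar> * exp \<bar>y\<bar>" by (intro mult_left_mono) auto
  finally show ?thesis .
qed

text \<open>The flux of the energy of the difference involves only the first solution, so that only its
  speeds limit the cone; the derivatives of the second solution enter the constant of the
  energy inequality.\<close>

lemma symmetric_euler_uniqueness:
  fixes \<sigma> u\<^sub>1 u\<^sub>2 \<sigma>' v\<^sub>1 v\<^sub>2 s :: "spacetime \<Rightarrow> real" and x\<^sub>0 :: plane
  assumes "\<theta> > 0" "\<gamma> > 0" "t\<^sub>1 > 0" "M \<ge> 0" "r - M * t\<^sub>1 > 0"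
    and V: "open V" "{0..t\<^sub>1} \<times> UNIV \<subseteq> V"
    and smooth: "C_k_on 1 V \<sigma>" "C_k_on 1 V u\<^sub>1" "C_k_on 1 V u\<^sub>2"
      "C_k_on 1 V \<sigma>'" "C_k_on 1 V v\<^sub>1" "C_k_on 1 V v\<^sub>2" "C_k_on 1 V s"
    and eq: "\<And>p. p \<in> {0..t\<^sub>1} \<times> UNIV \<Longrightarrow>
        D\<^sub>t \<sigma> p + u\<^sub>1 p * D\<^sub>1 \<sigma> p + u\<^sub>2 p * D\<^sub>2 \<sigma> p + \<theta> * \<sigma> p * (D\<^sub>1 u\<^sub>1 p + D\<^sub>2 u\<^sub>2 p) = 0"
      "\<And>p. p \<in> {0..t\<^sub>1} \<times> UNIV \<Longrightarrow>
        D\<^sub>t u\<^sub>1 p + u\<^sub>1 p * D\<^sub>1 u\<^sub>1 p + u\<^sub>2 p * D\<^sub>2 u\<^sub>1 p + \<theta> * \<sigma> p * D\<^sub>1 \<sigma> p = 0"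
      "\<And>p. p \<in> {0..t\<^sub>1} \<times> UNIV \<Longrightarrow>
        D\<^sub>t u\<^sub>2 p + u\<^sub>1 p * D\<^sub>1 u\<^sub>2 p + u\<^sub>2 p * D\<^sub>2 u\<^sub>2 p + \<theta> * \<sigma> p * D\<^sub>2 \<sigma> p = 0"
    and eq': "\<And>p. p \<in> {0..t\<^sub>1} \<times> UNIV \<Longrightarrow>
        D\<^sub>t \<sigma>' p + v\<^sub>1 p * D\<^sub>1 \<sigma>' p + v\<^sub>2 p * D\<^sub>2 \<sigma>' p + \<theta> * \<sigma>' p * (D\<^sub>1 v\<^sub>1 p + D\<^sub>2 v\<^sub>2 p) = 0"
      "\<And>p. p \<in> {0..t\<^sub>1} \<times> UNIV \<Longrightarrow>
        D\<^sub>t v\<^sub>1 p + v\<^sub>1 p * D\<^sub>1 v\<^sub>1 p + v\<^sub>2 p * D\<^sub>2 v\<^sub>1 p + exp (s p / \<gamma>) * (\<theta> * \<sigma>' p * D\<^sub>1 \<sigma>' p) = 0"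
      "\<And>p. p \<in> {0..t\<^sub>1} \<times> UNIV \<Longrightarrow>
        D\<^sub>t v\<^sub>2 p + v\<^sub>1 p * D\<^sub>1 v\<^sub>2 p + v\<^sub>2 p * D\<^sub>2 v\<^sub>2 p + exp (s p / \<gamma>) * (\<theta> * \<sigma>' p * D\<^sub>2 \<sigma>' p) = 0"
      "\<And>p. p \<in> {0..t\<^sub>1} \<times> UNIV \<Longrightarrow> D\<^sub>t s p + v\<^sub>1 p * D\<^sub>1 s p + v\<^sub>2 p * D\<^sub>2 s p = 0"
    and speed: "\<And>p. p \<in> {0..t\<^sub>1} \<times> UNIV \<Longrightarrow> \<sigma> p \<ge> 0"
      "\<And>p. p \<in> {0..t\<^sub>1} \<times> UNIV \<Longrightarrow> norm (u\<^sub>1 p, u\<^sub>2 p) + \<theta> * \<sigma> p \<le> M"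
    and initial: "\<And>x. dist x x\<^sub>0 \<le> r \<Longrightarrow>
      \<sigma>' (0, x) = \<sigma> (0, x) \<and> v\<^sub>1 (0, x) = u\<^sub>1 (0, x) \<and> v\<^sub>2 (0, x) = u\<^sub>2 (0, x) \<and> s (0, x) = 0"
    and tx: "t \<in> {0..t\<^sub>1}" "dist x x\<^sub>0 < r - M * t"
  shows "v\<^sub>1 (t, x) = u\<^sub>1 (t, x)"
proof -
  let ?S = "{0..t\<^sub>1} \<times> (UNIV :: plane set)"
  note d = smooth[THEN C_1_on_derivatives(1), OF V(1)]
  note c = smooth[THEN C_1_on_derivatives(2), OF V(1)] smooth[THEN C_1_on_derivatives(3), OF V(1)]
    smooth[THEN C_1_on_derivatives(4), OF V(1)] smooth[THEN C_1_on_derivatives(5), OF V(1)]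
  define D where "D f p = frechet_derivative f (at p)" for f :: "spacetime \<Rightarrow> real" and p
  note d = d[folded D_def]
  have D: "D f p (1, 0, 0) = D\<^sub>t f p" "D f p (0, 1, 0) = D\<^sub>1 f p" "D f p (0, 0, 1) = D\<^sub>2 f p" for f p
    by (simp_all add: D_def D\<^sub>t_def D\<^sub>1_def D\<^sub>2_def)
  define \<tau> where "\<tau> p = \<sigma>' p - \<sigma> p" for p
  define a where "a p = v\<^sub>1 p - u\<^sub>1 p" for p
  define b where "b p = v\<^sub>2 p - u\<^sub>2 p" for p
  \<comment> \<open>Energy of the difference; s is itself a difference, as the first solution has
    zero entropy. The fluxes \<open>F\<close> and \<open>G\<close> consist of transport by the first
    velocity and of the symmetric coupling between \<open>\<tau>\<close> and the velocity
    difference.\<close>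
  define E where "E p = (\<tau> p)\<^sup>2 + (a p)\<^sup>2 + (b p)\<^sup>2 + (s p)\<^sup>2" for p
  define F where "F p = u\<^sub>1 p * E p + 2 * (\<theta> * \<sigma> p) * (\<tau> p * a p)" for p
  define G where "G p = u\<^sub>2 p * E p + 2 * (\<theta> * \<sigma> p) * (\<tau> p * b p)" for p
  define \<tau>' where "\<tau>' p v = D \<sigma>' p v - D \<sigma> p v" for p v
  define a' where "a' p v = D v\<^sub>1 p v - D u\<^sub>1 p v" for p v
  define b' where "b' p v = D v\<^sub>2 p v - D u\<^sub>2 p v" for p v
  define E' where "E' p v = 2 * \<tau> p * \<tau>' p v + 2 * a p * a' p v + 2 * b p * b' p v + 2 * s p * D s p v" for p v
  define F' where "F' p v = D u\<^sub>1 p v * E p + u\<^sub>1 p * E' p v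
    + 2 * (\<theta> * D \<sigma> p v) * (\<tau> p * a p) + 2 * (\<theta> * \<sigma> p) * (\<tau>' p v * a p + \<tau> p * a' p v)" for p v
  define G' where "G' p v = D u\<^sub>2 p v * E p + u\<^sub>2 p * E' p v
    + 2 * (\<theta> * D \<sigma> p v) * (\<tau> p * b p) + 2 * (\<theta> * \<sigma> p) * (\<tau>' p v * b p + \<tau> p * b' p v)" for p v
  have d\<tau>: "(\<tau> has_derivative \<tau>' p) (at p)" and da: "(a has_derivative a' p) (at p)"
    and db: "(b has_derivative b' p) (at p)" if "p \<in> V" for p
    unfolding \<tau>_def[abs_def] \<tau>'_def[abs_def] a_def[abs_def] a'_def[abs_def] b_def[abs_def] b'_def[abs_def]
    by (intro has_derivative_diff d that)+
  have dE: "(E has_derivative E' p) (at p)" if "p \<in> V" for p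
    unfolding E_def[abs_def] E'_def[abs_def]
    by (auto intro!: derivative_eq_intros d\<tau> da db d that simp: algebra_simps)
  have dF: "(F has_derivative F' p) (at p)" if "p \<in> V" for p
    unfolding F_def[abs_def] F'_def[abs_def]
    by (auto intro!: derivative_eq_intros d\<tau> da db d dE that simp: algebra_simps)
  have dG: "(G has_derivative G' p) (at p)" if "p \<in> V" for p
    unfolding G_def[abs_def] G'_def[abs_def]
    by (auto intro!: derivative_eq_intros d\<tau> da db d dE that simp: algebra_simps)
  have cE: "continuous_on V (\<lambda>p. E' p (1, 0, 0))" and cF: "continuous_on V (\<lambda>p. F' p (0, 1, 0))"
    and cG: "continuous_on V (\<lambda>p. G' p (0, 0, 1))"
    unfolding G'_def F'_def E'_def \<tau>'_def a'_def b'_def D E_def \<tau>_def a_def b_def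
    by (intro continuous_intros c)+
  define k\<^sub>1 where "k\<^sub>1 p = \<bar>\<sigma>' p * D\<^sub>1 \<sigma>' p\<bar> * (exp \<bar>s p / \<gamma>\<bar> / \<gamma>)" for p
  define k\<^sub>2 where "k\<^sub>2 p = \<bar>\<sigma>' p * D\<^sub>2 \<sigma>' p\<bar> * (exp \<bar>s p / \<gamma>\<bar> / \<gamma>)" for p
  let ?K = "{0..t\<^sub>1} \<times> cball x\<^sub>0 r"
  have KV: "?K \<subseteq> V" using V(2) by auto
  \<comment> \<open>Bounds for all coefficients of the energy identity below;
    \<open>k\<^sub>1\<close> and \<open>k\<^sub>2\<close> dominate those that come from exp (s /
    \<gamma>) - 1. The cone lies in the compact cylinder \<open>?K\<close>.\<close>
  let ?\<F> = "{D\<^sub>1 \<sigma>, D\<^sub>2 \<sigma>, D\<^sub>1 \<sigma>', D\<^sub>2 \<sigma>', D\<^sub>1 v\<^sub>1, D\<^sub>2 v\<^sub>1, D\<^sub>1 v\<^sub>2, D\<^sub>2 v\<^sub>2, D\<^sub>1 s, D\<^sub>2 s, k\<^sub>1, k\<^sub>2,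
    \<lambda>p. D\<^sub>1 u\<^sub>1 p + D\<^sub>2 u\<^sub>2 p, \<lambda>p. D\<^sub>1 v\<^sub>1 p + D\<^sub>2 v\<^sub>2 p}"
  have ck: "continuous_on V k\<^sub>1" "continuous_on V k\<^sub>2"
    unfolding k\<^sub>1_def[abs_def] k\<^sub>2_def[abs_def] using \<open>\<gamma> > 0\<close> by (intro continuous_intros c; simp)+
  have cK: "continuous_on ?K f" if "f \<in> ?\<F>" for f
    using that by (elim insertE emptyE; simp only:)
      (intro continuous_on_subset[OF _ KV] continuous_on_add c ck)+
  have "compact ?K" "finite ?\<F>" by (simp_all add: compact_Times)
  from finite_family_bounded_on_compact[OF this cK]
  obtain B where B: "\<And>f p. f \<in> ?\<F> \<Longrightarrow> p \<in> ?K \<Longrightarrow> \<bar>f p\<bar> \<le> B" by blast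
  have E_nonneg: "E p \<ge> 0" for p by (simp add: E_def)
  have "E (t, x) = 0"
  proof (rule energy_vanishes_in_cone[OF \<open>t\<^sub>1 > 0\<close> \<open>M \<ge> 0\<close> \<open>r - M * t\<^sub>1 > 0\<close> V dE dF dG cE cF cG E_nonneg _ _ _ tx])
    show "E (0, x) = 0" if "dist x x\<^sub>0 \<le> r" for x
      using initial[OF that] by (simp add: E_def \<tau>_def a_def b_def)
  next
    fix t x k l assume "t \<in> {0..t\<^sub>1}"
    then have p: "(t, x) \<in> ?S" by simp
    let ?p = "(t, x)"
    have "\<bar>k * u\<^sub>1 ?p + l * u\<^sub>2 ?p\<bar> \<le> norm (k, l) * norm (u\<^sub>1 ?p, u\<^sub>2 ?p)"
      using Cauchy_Schwarz_ineq2[of "(k, l)" "(u\<^sub>1 ?p, u\<^sub>2 ?p)"] by simp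
    then have 1: "\<bar>k * u\<^sub>1 ?p + l * u\<^sub>2 ?p\<bar> * E ?p \<le> norm (k, l) * norm (u\<^sub>1 ?p, u\<^sub>2 ?p) * E ?p"
      by (rule mult_right_mono[OF _ E_nonneg])
    have "2 * \<bar>\<tau> ?p\<bar> * \<bar>k * a ?p + l * b ?p\<bar> \<le> 2 * \<bar>\<tau> ?p\<bar> * (norm (k, l) * norm (a ?p, b ?p))"
      using Cauchy_Schwarz_ineq2[of "(k, l)" "(a ?p, b ?p)"] by (intro mult_left_mono) auto
    also have "\<dots> = norm (k, l) * (2 * \<bar>\<tau> ?p\<bar> * norm (a ?p, b ?p))" by simp
    \<comment> \<open>The factor 2 is absorbed exactly, so that the resulting signal speed is |u| +
      \<theta> \<sigma> and no larger.\<close>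
    also have "2 * \<bar>\<tau> ?p\<bar> * norm (a ?p, b ?p) \<le> (\<tau> ?p)\<^sup>2 + (norm (a ?p, b ?p))\<^sup>2"
      using sum_squares_bound[of "\<bar>\<tau> ?p\<bar>" "norm (a ?p, b ?p)"] by simp
    also have "\<dots> \<le> E ?p" by (simp add: norm_Pair E_def)
    finally have "2 * \<bar>\<tau> ?p\<bar> * \<bar>k * a ?p + l * b ?p\<bar> \<le> norm (k, l) * E ?p" by (simp add: mult_left_mono)
    then have "(\<theta> * \<sigma> ?p) * (2 * \<bar>\<tau> ?p\<bar> * \<bar>k * a ?p + l * b ?p\<bar>) \<le> (\<theta> * \<sigma> ?p) * (norm (k, l) * E ?p)"
      using speed(1)[OF p] \<open>\<theta> > 0\<close> by (intro mult_left_mono) auto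
    moreover have "\<bar>(\<theta> * \<sigma> ?p) * (2 * \<tau> ?p * (k * a ?p + l * b ?p))\<bar> = (\<theta> * \<sigma> ?p) * (2 * \<bar>\<tau> ?p\<bar> * \<bar>k * a ?p + l * b ?p\<bar>)"
      using speed(1)[OF p] \<open>\<theta> > 0\<close> by (simp add: abs_mult)
    moreover have "\<bar>(k * u\<^sub>1 ?p + l * u\<^sub>2 ?p) * E ?p\<bar> = \<bar>k * u\<^sub>1 ?p + l * u\<^sub>2 ?p\<bar> * E ?p"
      using E_nonneg by (simp add: abs_mult)
    moreover have "k * F ?p + l * G ?p = (k * u\<^sub>1 ?p + l * u\<^sub>2 ?p) * E ?p + (\<theta> * \<sigma> ?p) * (2 * \<tau> ?p * (k * a ?p + l * b ?p))"
      by (simp add: F_def G_def algebra_simps)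
    ultimately have "\<bar>k * F ?p + l * G ?p\<bar> \<le> norm (k, l) * norm (u\<^sub>1 ?p, u\<^sub>2 ?p) * E ?p + (\<theta> * \<sigma> ?p) * (norm (k, l) * E ?p)"
      using 1 by linarith
    also have "\<dots> = (norm (u\<^sub>1 ?p, u\<^sub>2 ?p) + \<theta> * \<sigma> ?p) * (norm (k, l) * E ?p)" by (simp add: algebra_simps)
    also have "\<dots> \<le> M * (norm (k, l) * E ?p)"
      by (intro mult_right_mono speed(2)[OF p] mult_nonneg_nonneg E_nonneg) simp
    finally show "\<bar>k * F ?p + l * G ?p\<bar> \<le> M * norm (k, l) * E ?p" by (simp add: mult.assoc)
  next
    fix t x assume t: "t \<in> {0..t\<^sub>1}" and x: "dist x x\<^sub>0 \<le> r - M * t"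
    let ?p = "(t, x)"
    have p: "?p \<in> ?S" using t by simp
    have "M * t \<ge> 0" using t \<open>M \<ge> 0\<close> by simp
    then have pK: "?p \<in> ?K" using t x by (simp add: dist_commute)
    define e where "e = sqrt (E ?p)"
    have ee: "e * e = E ?p" using E_nonneg[of ?p] by (simp add: e_def)
    have e: "\<bar>\<tau> ?p\<bar> \<le> e" "\<bar>a ?p\<bar> \<le> e" "\<bar>b ?p\<bar> \<le> e" "\<bar>s ?p\<bar> \<le> e"
      unfolding e_def by (rule real_le_rsqrt; simp add: E_def)+
    have *: "k * (y * z) \<le> B * E ?p" "- (k * (y * z)) \<le> B * E ?p" if "\<bar>k\<bar> \<le> B" "\<bar>y\<bar> \<le> e" "\<bar>z\<bar> \<le> e" for k y z
    proof -
      have "\<bar>k\<bar> * (\<bar>y\<bar> * \<bar>z\<bar>) \<le> B * (e * e)" using that by (intro mult_mono) auto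
      then have "\<bar>k * (y * z)\<bar> \<le> B * E ?p" by (simp add: abs_mult ee)
      then show "k * (y * z) \<le> B * E ?p" "- (k * (y * z)) \<le> B * E ?p" by linarith+
    qed
    \<comment> \<open>Difference quotient of exp (s / \<gamma>); the value at s = 0 is arbitrary
      since \<epsilon> occurs only multiplied by s.\<close>
    define \<epsilon> where "\<epsilon> = (if s ?p = 0 then 0 else (exp (s ?p / \<gamma>) - 1) / s ?p)"
    have \<epsilon>: "exp (s ?p / \<gamma>) - 1 = \<epsilon> * s ?p" by (simp add: \<epsilon>_def)
    have \<epsilon>le: "\<bar>\<epsilon>\<bar> \<le> exp \<bar>s ?p / \<gamma>\<bar> / \<gamma>"
      using abs_exp_minus_one_le[of "s ?p / \<gamma>"] \<open>\<gamma> > 0\<close> by (simp add: \<epsilon>_def field_simps abs_mult)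
    have k1: "\<bar>\<sigma>' ?p * D\<^sub>1 \<sigma>' ?p * \<epsilon>\<bar> \<le> \<bar>\<sigma>' ?p * D\<^sub>1 \<sigma>' ?p\<bar> * (exp \<bar>s ?p / \<gamma>\<bar> / \<gamma>)"
      unfolding abs_mult[of _ \<epsilon>] by (rule mult_left_mono[OF \<epsilon>le abs_ge_zero])
    have k2: "\<bar>\<sigma>' ?p * D\<^sub>2 \<sigma>' ?p * \<epsilon>\<bar> \<le> \<bar>\<sigma>' ?p * D\<^sub>2 \<sigma>' ?p\<bar> * (exp \<bar>s ?p / \<gamma>\<bar> / \<gamma>)"
      unfolding abs_mult[of _ \<epsilon>] by (rule mult_left_mono[OF \<epsilon>le abs_ge_zero])
    have bd: "\<bar>D\<^sub>1 \<sigma> ?p\<bar> \<le> B" "\<bar>D\<^sub>2 \<sigma> ?p\<bar> \<le> B" "\<bar>D\<^sub>1 \<sigma>' ?p\<bar> \<le> B" "\<bar>D\<^sub>2 \<sigma>' ?p\<bar> \<le> B"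
      "\<bar>D\<^sub>1 v\<^sub>1 ?p\<bar> \<le> B" "\<bar>D\<^sub>2 v\<^sub>1 ?p\<bar> \<le> B" "\<bar>D\<^sub>1 v\<^sub>2 ?p\<bar> \<le> B" "\<bar>D\<^sub>2 v\<^sub>2 ?p\<bar> \<le> B" "\<bar>D\<^sub>1 s ?p\<bar> \<le> B" "\<bar>D\<^sub>2 s ?p\<bar> \<le> B"
      by (intro B[OF _ pK]; simp)+
    have bk: "\<bar>\<sigma>' ?p * D\<^sub>1 \<sigma>' ?p * \<epsilon>\<bar> \<le> B" "\<bar>\<sigma>' ?p * D\<^sub>2 \<sigma>' ?p * \<epsilon>\<bar> \<le> B"
      by (rule order_trans[OF k1[folded k\<^sub>1_def] order_trans[OF abs_ge_self B[OF _ pK, of k\<^sub>1]]], simp,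
          rule order_trans[OF k2[folded k\<^sub>2_def] order_trans[OF abs_ge_self B[OF _ pK, of k\<^sub>2]]], simp)
    have bdiv: "\<bar>D\<^sub>1 u\<^sub>1 ?p + D\<^sub>2 u\<^sub>2 ?p\<bar> \<le> B" "\<bar>D\<^sub>1 v\<^sub>1 ?p + D\<^sub>2 v\<^sub>2 ?p\<bar> \<le> B"
      using B[OF _ pK, of "\<lambda>p. D\<^sub>1 u\<^sub>1 p + D\<^sub>2 u\<^sub>2 p"] B[OF _ pK, of "\<lambda>p. D\<^sub>1 v\<^sub>1 p + D\<^sub>2 v\<^sub>2 p"] by simp_all
    have eqs: "D\<^sub>t \<sigma> ?p = - (u\<^sub>1 ?p * D\<^sub>1 \<sigma> ?p + u\<^sub>2 ?p * D\<^sub>2 \<sigma> ?p + \<theta> * \<sigma> ?p * (D\<^sub>1 u\<^sub>1 ?p + D\<^sub>2 u\<^sub>2 ?p))"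
      "D\<^sub>t u\<^sub>1 ?p = - (u\<^sub>1 ?p * D\<^sub>1 u\<^sub>1 ?p + u\<^sub>2 ?p * D\<^sub>2 u\<^sub>1 ?p + \<theta> * \<sigma> ?p * D\<^sub>1 \<sigma> ?p)"
      "D\<^sub>t u\<^sub>2 ?p = - (u\<^sub>1 ?p * D\<^sub>1 u\<^sub>2 ?p + u\<^sub>2 ?p * D\<^sub>2 u\<^sub>2 ?p + \<theta> * \<sigma> ?p * D\<^sub>2 \<sigma> ?p)"
      "D\<^sub>t \<sigma>' ?p = - (v\<^sub>1 ?p * D\<^sub>1 \<sigma>' ?p + v\<^sub>2 ?p * D\<^sub>2 \<sigma>' ?p + \<theta> * \<sigma>' ?p * (D\<^sub>1 v\<^sub>1 ?p + D\<^sub>2 v\<^sub>2 ?p))"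
      "D\<^sub>t v\<^sub>1 ?p = - (v\<^sub>1 ?p * D\<^sub>1 v\<^sub>1 ?p + v\<^sub>2 ?p * D\<^sub>2 v\<^sub>1 ?p + (1 + \<epsilon> * s ?p) * (\<theta> * \<sigma>' ?p * D\<^sub>1 \<sigma>' ?p))"
      "D\<^sub>t v\<^sub>2 ?p = - (v\<^sub>1 ?p * D\<^sub>1 v\<^sub>2 ?p + v\<^sub>2 ?p * D\<^sub>2 v\<^sub>2 ?p + (1 + \<epsilon> * s ?p) * (\<theta> * \<sigma>' ?p * D\<^sub>2 \<sigma>' ?p))"
      "D\<^sub>t s ?p = - (v\<^sub>1 ?p * D\<^sub>1 s ?p + v\<^sub>2 ?p * D\<^sub>2 s ?p)"
      using eq(1)[OF p] eq(2)[OF p] eq(3)[OF p] eq'(1)[OF p] eq'(2)[OF p] eq'(3)[OF p] eq'(4)[OF p] \<epsilon>[symmetric]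
      by (simp_all add: algebra_simps)
    have vs: "v\<^sub>1 ?p = u\<^sub>1 ?p + a ?p" "v\<^sub>2 ?p = u\<^sub>2 ?p + b ?p" "\<sigma>' ?p = \<sigma> ?p + \<tau> ?p"
      by (simp_all add: a_def b_def \<tau>_def)
    \<comment> \<open>By symmetry of the system all terms with a derivative of a difference cancel.
      What is left is quadratic in the differences, with coefficients from \<open>?\<F>\<close> or
      bounded by its members.\<close>
    have "E' ?p (1, 0, 0) + F' ?p (0, 1, 0) + G' ?p (0, 0, 1) =
        (D\<^sub>1 u\<^sub>1 ?p + D\<^sub>2 u\<^sub>2 ?p) * E ?p
        + 2 * \<theta> * (D\<^sub>1 \<sigma> ?p * (\<tau> ?p * a ?p)) + 2 * \<theta> * (D\<^sub>2 \<sigma> ?p * (\<tau> ?p * b ?p))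
        + 2 * - (D\<^sub>1 \<sigma>' ?p * (\<tau> ?p * a ?p)) + 2 * - (D\<^sub>2 \<sigma>' ?p * (\<tau> ?p * b ?p))
        + 2 * \<theta> * - ((D\<^sub>1 v\<^sub>1 ?p + D\<^sub>2 v\<^sub>2 ?p) * (\<tau> ?p * \<tau> ?p))
        + 2 * - (D\<^sub>1 v\<^sub>1 ?p * (a ?p * a ?p)) + 2 * - (D\<^sub>2 v\<^sub>1 ?p * (a ?p * b ?p))
        + 2 * - (D\<^sub>1 v\<^sub>2 ?p * (b ?p * a ?p)) + 2 * - (D\<^sub>2 v\<^sub>2 ?p * (b ?p * b ?p))
        + 2 * \<theta> * - (\<sigma>' ?p * D\<^sub>1 \<sigma>' ?p * \<epsilon> * (a ?p * s ?p)) + 2 * \<theta> * - (\<sigma>' ?p * D\<^sub>2 \<sigma>' ?p * \<epsilon> * (b ?p * s ?p))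
        + 2 * \<theta> * - (D\<^sub>1 \<sigma>' ?p * (\<tau> ?p * a ?p)) + 2 * \<theta> * - (D\<^sub>2 \<sigma>' ?p * (\<tau> ?p * b ?p))
        + 2 * - (D\<^sub>1 s ?p * (s ?p * a ?p)) + 2 * - (D\<^sub>2 s ?p * (s ?p * b ?p))"
      unfolding E'_def F'_def G'_def \<tau>'_def a'_def b'_def D eqs
      unfolding vs by (simp add: algebra_simps)
    also have "\<dots> \<le> B * E ?p
        + 2 * \<theta> * (B * E ?p) + 2 * \<theta> * (B * E ?p)
        + 2 * (B * E ?p) + 2 * (B * E ?p)
        + 2 * \<theta> * (B * E ?p)
        + 2 * (B * E ?p) + 2 * (B * E ?p) + 2 * (B * E ?p) + 2 * (B * E ?p)
        + 2 * \<theta> * (B * E ?p) + 2 * \<theta> * (B * E ?p) + 2 * \<theta> * (B * E ?p) + 2 * \<theta> * (B * E ?p)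
        + 2 * (B * E ?p) + 2 * (B * E ?p)"
      using \<open>\<theta> > 0\<close> bdiv(1) E_nonneg[of ?p]
      by (intro add_mono mult_left_mono * bd bk bdiv e mult_right_mono) auto
    also have "\<dots> = (17 + 14 * \<theta>) * B * E ?p" by (simp add: algebra_simps)
    finally show "E' ?p (1, 0, 0) + F' ?p (0, 1, 0) + G' ?p (0, 0, 1) \<le> (17 + 14 * \<theta>) * B * E ?p" .
  qed
  then have "(a (t, x))\<^sup>2 = 0"
    unfolding E_def by (smt (verit) zero_le_power2)
  then show ?thesis by (simp add: a_def)
qed

text \<open>The variable \<open>\<sigma>\<close> is a power of the pressure; in terms of it the momentum equation contains no
  derivative of the entropy.\<close>

lemma euler_symmetric_form:
  fixes \<rho> S \<sigma> :: "spacetime \<Rightarrow> real" and u :: "spacetime \<Rightarrow> plane" and A \<gamma> \<theta> :: real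
  assumes "A > 0" "\<gamma> > 1" and \<theta>: "\<theta> = (\<gamma> - 1) / 2"
    and \<sigma>: "\<And>q. \<sigma> q = sqrt (A * \<gamma>) / \<theta> * (\<rho> q powr \<theta> * exp (\<theta> * S q / \<gamma>))"
    and d: "(\<rho> has_derivative R) (at p)" "(u has_derivative U) (at p)" "(S has_derivative Z) (at p)"
    and pos: "\<rho> p > 0" and "p \<in> G" "euler_on A \<gamma> G \<rho> u S"
  shows "D\<^sub>t \<sigma> p + fst (u p) * D\<^sub>1 \<sigma> p + snd (u p) * D\<^sub>2 \<sigma> p
      + \<theta> * \<sigma> p * (D\<^sub>1 (\<lambda>q. fst (u q)) p + D\<^sub>2 (\<lambda>q. snd (u q)) p) = 0"
    and "D\<^sub>t (\<lambda>q. fst (u q)) p + fst (u p) * D\<^sub>1 (\<lambda>q. fst (u q)) p + snd (u p) * D\<^sub>2 (\<lambda>q. fst (u q)) p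
      + exp (S p / \<gamma>) * (\<theta> * \<sigma> p * D\<^sub>1 \<sigma> p) = 0"
    and "D\<^sub>t (\<lambda>q. snd (u q)) p + fst (u p) * D\<^sub>1 (\<lambda>q. snd (u q)) p + snd (u p) * D\<^sub>2 (\<lambda>q. snd (u q)) p
      + exp (S p / \<gamma>) * (\<theta> * \<sigma> p * D\<^sub>2 \<sigma> p) = 0"
    and "D\<^sub>t S p + fst (u p) * D\<^sub>1 S p + snd (u p) * D\<^sub>2 S p = 0"
proof -
  have \<theta>pos: "\<theta> > 0" and \<gamma>pos: "\<gamma> > 0" using assms(2) by (simp_all add: \<theta>)
  define c where "c = sqrt (A * \<gamma>)"
  have c2: "c * c = A * \<gamma>" using assms by (simp add: c_def)
  have d\<sigma>: "(\<sigma> has_derivative (\<lambda>v. \<sigma> p * (\<theta> * R v / \<rho> p + \<theta> * Z v / \<gamma>))) (at p)"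
  proof -
    have "((\<lambda>q. \<rho> q powr \<theta>) has_derivative (\<lambda>v. \<theta> * \<rho> p powr (\<theta> - 1) * R v)) (at p)"
      by (rule has_derivative_compose[OF d(1) has_real_derivative_powr[OF pos, unfolded has_field_derivative_def]])
    moreover have "((\<lambda>q. exp (\<theta> * S q / \<gamma>)) has_derivative (\<lambda>v. exp (\<theta> * S p / \<gamma>) * (\<theta> * Z v / \<gamma>))) (at p)"
      using \<gamma>pos by (auto intro!: derivative_eq_intros d(3))
    ultimately have "((\<lambda>q. \<rho> q powr \<theta> * exp (\<theta> * S q / \<gamma>)) has_derivative
        (\<lambda>v. \<rho> p powr \<theta> * (exp (\<theta> * S p / \<gamma>) * (\<theta> * Z v / \<gamma>)) + \<theta> * \<rho> p powr (\<theta> - 1) * R v * exp (\<theta> * S p / \<gamma>))) (at p)"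
      by (rule has_derivative_mult)
    from has_derivative_mult_right[OF this, of "sqrt (A * \<gamma>) / \<theta>"] show ?thesis
      unfolding \<sigma>[abs_def, symmetric]
      by (rule has_derivative_eq_rhs) (use pos in \<open>auto simp: fun_eq_iff \<sigma> powr_diff algebra_simps add_divide_distrib\<close>)
  qed
  have dp: "((\<lambda>q. pressure A \<gamma> (\<rho> q) (S q)) has_derivative
      (\<lambda>v. pressure A \<gamma> (\<rho> p) (S p) * (\<gamma> * R v / \<rho> p + Z v))) (at p)"
  proof -
    have "((\<lambda>q. \<rho> q powr \<gamma>) has_derivative (\<lambda>v. \<gamma> * \<rho> p powr (\<gamma> - 1) * R v)) (at p)"
      by (rule has_derivative_compose[OF d(1) has_real_derivative_powr[OF pos, unfolded has_field_derivative_def]])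
    moreover have "((\<lambda>q. A * exp (S q)) has_derivative (\<lambda>v. A * (exp (S p) * Z v))) (at p)"
      by (auto intro!: derivative_eq_intros d(3))
    ultimately have "((\<lambda>q. A * exp (S q) * \<rho> q powr \<gamma>) has_derivative
        (\<lambda>v. A * exp (S p) * (\<gamma> * \<rho> p powr (\<gamma> - 1) * R v) + A * (exp (S p) * Z v) * \<rho> p powr \<gamma>)) (at p)"
      by (rule has_derivative_mult[rotated])
    then show ?thesis
      unfolding pressure_def
      by (rule has_derivative_eq_rhs) (use pos in \<open>auto simp: fun_eq_iff powr_diff algebra_simps\<close>)
  qed
  have du1: "((\<lambda>q. fst (u q)) has_derivative (\<lambda>v. fst (U v))) (at p)"
    and du2: "((\<lambda>q. snd (u q)) has_derivative (\<lambda>v. snd (U v))) (at p)"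
    using d(2) by (auto intro!: derivative_eq_intros)
  have dm1: "((\<lambda>q. \<rho> q * fst (u q)) has_derivative (\<lambda>v. \<rho> p * fst (U v) + R v * fst (u p))) (at p)"
    and dm2: "((\<lambda>q. \<rho> q * snd (u q)) has_derivative (\<lambda>v. \<rho> p * snd (U v) + R v * snd (u p))) (at p)"
    by (auto intro!: derivative_eq_intros d)
  note fr = frechet_derivative_at[OF d(1), symmetric] frechet_derivative_at[OF d(2), symmetric]
    frechet_derivative_at[OF d(3), symmetric] frechet_derivative_at[OF d\<sigma>, symmetric]
    frechet_derivative_at[OF dp, symmetric] frechet_derivative_at[OF du1, symmetric]
    frechet_derivative_at[OF du2, symmetric] frechet_derivative_at[OF dm1, symmetric]
    frechet_derivative_at[OF dm2, symmetric]
  note defs = convective_derivative_def D\<^sub>t_def D\<^sub>1_def D\<^sub>2_def fr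
  let ?P = "pressure A \<gamma> (\<rho> p) (S p)"
  have eqs: "R (1, 0, 0) + (\<rho> p * fst (U (0, 1, 0)) + R (0, 1, 0) * fst (u p))
        + (\<rho> p * snd (U (0, 0, 1)) + R (0, 0, 1) * snd (u p)) = 0"
    "\<rho> p * (fst (U (1, 0, 0)) + fst (u p) * fst (U (0, 1, 0)) + snd (u p) * fst (U (0, 0, 1)))
        + ?P * (\<gamma> * R (0, 1, 0) / \<rho> p + Z (0, 1, 0)) = 0"
    "\<rho> p * (snd (U (1, 0, 0)) + fst (u p) * snd (U (0, 1, 0)) + snd (u p) * snd (U (0, 0, 1)))
        + ?P * (\<gamma> * R (0, 0, 1) / \<rho> p + Z (0, 0, 1)) = 0"
    "Z (1, 0, 0) + fst (u p) * Z (0, 1, 0) + snd (u p) * Z (0, 0, 1) = 0"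
    using bspec[OF assms(10)[unfolded euler_on_def] assms(9)] unfolding defs
    by (simp_all add: prod_eq_iff)
  \<comment> \<open>This says exp (S / \<gamma>) \<theta> \<sigma> d\<sigma> = dp / \<rho>, with r
    and z the derivatives of \<rho> and S. It rests on exp (S / \<gamma>) (\<theta> \<sigma>)^2 =
    \<gamma> p / \<rho>, the square of the sound speed.\<close>
  have sq: "exp (S p / \<gamma>) * (\<theta> * \<sigma> p * (\<sigma> p * (\<theta> * r / \<rho> p + \<theta> * z / \<gamma>))) = ?P * (\<gamma> * r / \<rho> p + z) / \<rho> p" for r z
  proof -
    have "exp (S p / \<gamma>) * (\<theta> * \<sigma> p) * (\<theta> * \<sigma> p) = (c * c) * (\<rho> p powr \<theta> * \<rho> p powr \<theta>)
        * (exp (S p / \<gamma>) * exp (\<theta> * S p / \<gamma>) * exp (\<theta> * S p / \<gamma>))"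
      using \<theta>pos by (simp add: \<sigma> c_def)
    also have "\<rho> p powr \<theta> * \<rho> p powr \<theta> = \<rho> p powr \<gamma> / \<rho> p"
    proof -
      have "\<theta> + \<theta> = \<gamma> - 1" by (simp add: \<theta>)
      then show ?thesis using pos by (simp add: powr_diff flip: powr_add)
    qed
    also have "exp (S p / \<gamma>) * exp (\<theta> * S p / \<gamma>) * exp (\<theta> * S p / \<gamma>) = exp (S p)"
    proof -
      have "S p / \<gamma> + \<theta> * S p / \<gamma> + \<theta> * S p / \<gamma> = S p" using \<gamma>pos by (simp add: \<theta> field_simps)
      then show ?thesis by (simp flip: exp_add)
    qed
    finally have "exp (S p / \<gamma>) * (\<theta> * \<sigma> p) * (\<theta> * \<sigma> p) = ?P * \<gamma> / \<rho> p"
      by (simp add: c2 pressure_def)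
    moreover have "exp (S p / \<gamma>) * (\<theta> * \<sigma> p * (\<sigma> p * (\<theta> * r / \<rho> p + \<theta> * z / \<gamma>)))
        = exp (S p / \<gamma>) * (\<theta> * \<sigma> p) * (\<theta> * \<sigma> p) * (r / \<rho> p + z / \<gamma>)"
      by (simp add: algebra_simps add_divide_distrib)
    ultimately have "exp (S p / \<gamma>) * (\<theta> * \<sigma> p * (\<sigma> p * (\<theta> * r / \<rho> p + \<theta> * z / \<gamma>))) = ?P * \<gamma> / \<rho> p * (r / \<rho> p + z / \<gamma>)"
      by simp
    also have "\<dots> = ?P * (\<gamma> * r / \<rho> p + z) / \<rho> p" using \<gamma>pos by (simp add: algebra_simps add_divide_distrib)
    finally show ?thesis .
  qed
  have cancel: "X + Q / \<rho> p = 0" if "\<rho> p * X + Q = 0" for X Q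
  proof -
    have "X + Q / \<rho> p = (\<rho> p * X + Q) / \<rho> p" using pos by (simp add: add_divide_distrib)
    then show ?thesis using that by simp
  qed
  show "D\<^sub>t \<sigma> p + fst (u p) * D\<^sub>1 \<sigma> p + snd (u p) * D\<^sub>2 \<sigma> p
      + \<theta> * \<sigma> p * (D\<^sub>1 (\<lambda>q. fst (u q)) p + D\<^sub>2 (\<lambda>q. snd (u q)) p) = 0"
  proof -
    \<comment> \<open>As d\<sigma> / \<sigma> = \<theta> (d\<rho> / \<rho> + dS / \<gamma>), this is
      a combination of the continuity equation, divided by \<rho>, and the transport of
      entropy.\<close>
    have "D\<^sub>t \<sigma> p + fst (u p) * D\<^sub>1 \<sigma> p + snd (u p) * D\<^sub>2 \<sigma> p
        + \<theta> * \<sigma> p * (D\<^sub>1 (\<lambda>q. fst (u q)) p + D\<^sub>2 (\<lambda>q. snd (u q)) p)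
      = \<theta> * \<sigma> p * (fst (U (0, 1, 0)) + snd (U (0, 0, 1))
        + (R (1, 0, 0) + R (0, 1, 0) * fst (u p) + R (0, 0, 1) * snd (u p)) / \<rho> p)
      + \<theta> * \<sigma> p / \<gamma> * (Z (1, 0, 0) + fst (u p) * Z (0, 1, 0) + snd (u p) * Z (0, 0, 1))"
      unfolding defs by (simp add: algebra_simps add_divide_distrib)
    also have "fst (U (0, 1, 0)) + snd (U (0, 0, 1))
        + (R (1, 0, 0) + R (0, 1, 0) * fst (u p) + R (0, 0, 1) * snd (u p)) / \<rho> p = 0"
      by (rule cancel) (use eqs(1) in \<open>simp add: algebra_simps\<close>)
    finally show ?thesis unfolding eqs(4) by simp
  qed
  show "D\<^sub>t (\<lambda>q. fst (u q)) p + fst (u p) * D\<^sub>1 (\<lambda>q. fst (u q)) p + snd (u p) * D\<^sub>2 (\<lambda>q. fst (u q)) p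
      + exp (S p / \<gamma>) * (\<theta> * \<sigma> p * D\<^sub>1 \<sigma> p) = 0"
    unfolding defs sq by (rule cancel[OF eqs(2)])
  show "D\<^sub>t (\<lambda>q. snd (u q)) p + fst (u p) * D\<^sub>1 (\<lambda>q. snd (u q)) p + snd (u p) * D\<^sub>2 (\<lambda>q. snd (u q)) p
      + exp (S p / \<gamma>) * (\<theta> * \<sigma> p * D\<^sub>2 \<sigma> p) = 0"
    unfolding defs sq by (rule cancel[OF eqs(3)])
  show "D\<^sub>t S p + fst (u p) * D\<^sub>1 S p + snd (u p) * D\<^sub>2 S p = 0"
    unfolding defs by (rule eqs(4))
qed

lemma C_k_on_symmetric_variable:
  fixes \<rho> S :: "'a::euclidean_space \<Rightarrow> real"
  assumes "open V" "C_k_on k V \<rho>" "C_k_on k V S" "\<And>p. p \<in> V \<Longrightarrow> \<rho> p > 0"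
  shows "C_k_on k V (\<lambda>q. a * (\<rho> q powr \<theta> * exp (\<theta> * S q / \<gamma>)))"
proof -
  have "C_k_on k V (\<lambda>q. \<rho> q powr \<theta>)"
    by (rule C_k_on_compose[OF assms(1) _ C_k_on_powr assms(2)]) (use assms(4) in auto)
  moreover have "C_k_on k V (\<lambda>q. exp (\<theta> / \<gamma> * S q))"
    by (rule C_k_on_compose[OF assms(1) open_UNIV C_k_on_exp C_k_on_mult[OF assms(1) C_k_on_const assms(3)]]) simp
  ultimately show ?thesis
    using C_k_on_mult[OF assms(1) C_k_on_const C_k_on_mult[OF assms(1)]] by simp
qed

text \<open>At zero entropy \<open>\<theta> * \<sigma>\<close> is the sound speed, so the cone is
  governed by the signal speeds of the known solution. The other solution is a general one: its
  entropy is known to vanish only on the base of the cone and is an unknown of the estimate.\<close>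

lemma euler_local_uniqueness:
  fixes \<rho> \<rho>' S' :: "spacetime \<Rightarrow> real" and u u' :: "spacetime \<Rightarrow> plane" and x\<^sub>0 :: plane
  defines "G t\<^sub>1 \<equiv> {0..t\<^sub>1} \<times> (UNIV :: plane set)"
  assumes "A > 0" "\<gamma> > 1" "t\<^sub>1 > 0" "M \<ge> 0" "r - M * t\<^sub>1 > 0"
    and V: "open V" "G t\<^sub>1 \<subseteq> V"
    and smooth: "C_k_on 1 V \<rho>" "C_k_on 1 V u" "C_k_on 1 V \<rho>'" "C_k_on 1 V u'" "C_k_on 1 V S'"
    and pos: "\<And>p. p \<in> V \<Longrightarrow> \<rho> p > 0" "\<And>p. p \<in> V \<Longrightarrow> \<rho>' p > 0"
    and euler: "euler_on A \<gamma> (G t\<^sub>1) \<rho> u (\<lambda>_. 0)" "euler_on A \<gamma> (G t\<^sub>1) \<rho>' u' S'"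
    and speed: "\<And>p. p \<in> G t\<^sub>1 \<Longrightarrow> norm (u p) + sound_speed A \<gamma> (\<rho> p) 0 \<le> M"
    and initial: "\<And>x. dist x x\<^sub>0 \<le> r \<Longrightarrow> \<rho>' (0, x) = \<rho> (0, x) \<and> u' (0, x) = u (0, x) \<and> S' (0, x) = 0"
    and tx: "t \<in> {0..t\<^sub>1}" "dist x x\<^sub>0 < r - M * t"
  shows "fst (u' (t, x)) = fst (u (t, x))"
proof -
  define \<theta> where "\<theta> = (\<gamma> - 1) / 2"
  have \<theta>: "\<theta> > 0" using assms by (simp add: \<theta>_def)
  define \<sigma> where "\<sigma> q = sqrt (A * \<gamma>) / \<theta> * (\<rho> q powr \<theta> * exp (\<theta> * (0::real) / \<gamma>))" for q
  define \<sigma>' where "\<sigma>' q = sqrt (A * \<gamma>) / \<theta> * (\<rho>' q powr \<theta> * exp (\<theta> * S' q / \<gamma>))" for q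
  have smooth0: "C_k_on 1 V (\<lambda>_. 0::real)" by (rule C_k_on_const)
  have d: "(f has_derivative frechet_derivative f (at p)) (at p)" if "C_k_on 1 V f" "p \<in> G t\<^sub>1"
    for f :: "spacetime \<Rightarrow> 'c::real_normed_vector" and p
    by (rule C_k_on_has_derivative[of 0 V]) (use that V in \<open>auto simp del: C_k_on.simps\<close>)
  have sym: "D\<^sub>t \<sigma> p + fst (u p) * D\<^sub>1 \<sigma> p + snd (u p) * D\<^sub>2 \<sigma> p
        + \<theta> * \<sigma> p * (D\<^sub>1 (\<lambda>q. fst (u q)) p + D\<^sub>2 (\<lambda>q. snd (u q)) p) = 0"
    "D\<^sub>t (\<lambda>q. fst (u q)) p + fst (u p) * D\<^sub>1 (\<lambda>q. fst (u q)) p + snd (u p) * D\<^sub>2 (\<lambda>q. fst (u q)) p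
        + \<theta> * \<sigma> p * D\<^sub>1 \<sigma> p = 0"
    "D\<^sub>t (\<lambda>q. snd (u q)) p + fst (u p) * D\<^sub>1 (\<lambda>q. snd (u q)) p + snd (u p) * D\<^sub>2 (\<lambda>q. snd (u q)) p
        + \<theta> * \<sigma> p * D\<^sub>2 \<sigma> p = 0" if p: "p \<in> G t\<^sub>1" for p
    using euler_symmetric_form(1-3)[OF assms(2,3) \<theta>_def \<sigma>_def d[OF smooth(1) p] d[OF smooth(2) p] d[OF smooth0 p]
        pos(1)[OF subsetD[OF V(2) p]] p euler(1)] by simp_all
  have pos': "\<rho>' p > 0" if "p \<in> G t\<^sub>1" for p using pos(2) V(2) that by blast
  note sym' = euler_symmetric_form[OF assms(2,3) \<theta>_def \<sigma>'_def d[OF smooth(3)] d[OF smooth(4)] d[OF smooth(5)]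
        pos' _ euler(2), unfolded G_def]
  have G: "{0..t\<^sub>1} \<times> UNIV \<subseteq> V" using V(2) by (simp add: G_def)
  show ?thesis
  proof (rule symmetric_euler_uniqueness[where \<sigma>=\<sigma> and \<sigma>'=\<sigma>' and s=S' and V=V and r=r and M=M
        and \<theta>=\<theta> and \<gamma>=\<gamma> and v\<^sub>1="\<lambda>q. fst (u' q)" and u\<^sub>1="\<lambda>q. fst (u q)"
        and v\<^sub>2="\<lambda>q. snd (u' q)" and u\<^sub>2="\<lambda>q. snd (u q)" and t=t and x=x])
    show "C_k_on 1 V \<sigma>" unfolding \<sigma>_def[abs_def]
      by (rule C_k_on_symmetric_variable[OF V(1) smooth(1) smooth0 pos(1)])
    show "C_k_on 1 V \<sigma>'" unfolding \<sigma>'_def[abs_def]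
      by (rule C_k_on_symmetric_variable[OF V(1) smooth(3,5) pos(2)])
    show "C_k_on 1 V (\<lambda>q. fst (u q))" "C_k_on 1 V (\<lambda>q. snd (u q))" "C_k_on 1 V (\<lambda>q. fst (u' q))" "C_k_on 1 V (\<lambda>q. snd (u' q))"
      by (rule C_k_on_compose_linear[OF bounded_linear_fst V(1)] C_k_on_compose_linear[OF bounded_linear_snd V(1)], rule smooth)+
    fix p assume p: "p \<in> {0..t\<^sub>1} \<times> (UNIV::plane set)"
    show "\<sigma> p \<ge> 0" using \<theta> assms(2,3) by (simp add: \<sigma>_def)
    have "\<rho> p > 0" using pos(1) G p by blast
    then have "\<theta> * \<sigma> p = sound_speed A \<gamma> (\<rho> p) 0"
    proof -
      have "(\<rho> p powr \<theta>)\<^sup>2 = \<rho> p powr (\<gamma> - 1)"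
        using \<open>\<rho> p > 0\<close> by (simp add: \<theta>_def power2_eq_square flip: powr_add)
      then have "sqrt (\<rho> p powr (\<gamma> - 1)) = \<rho> p powr \<theta>" by (intro real_sqrt_unique) auto
      then show ?thesis using \<theta> by (simp add: sound_speed_def \<sigma>_def real_sqrt_mult)
    qed
    then show "norm (fst (u p), snd (u p)) + \<theta> * \<sigma> p \<le> M"
      using speed[unfolded G_def, OF p] by simp
  next
    fix y assume "dist y x\<^sub>0 \<le> r"
    from initial[OF this]
    show "\<sigma>' (0, y) = \<sigma> (0, y) \<and> fst (u' (0, y)) = fst (u (0, y)) \<and> snd (u' (0, y)) = snd (u (0, y)) \<and> S' (0, y) = 0"
      by (simp add: \<sigma>_def \<sigma>'_def)
  next
    fix p assume p: "p \<in> {0..t\<^sub>1} \<times> (UNIV::plane set)"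
    note s = sym[unfolded G_def, OF p] and s' = sym'[OF p p p p p]
    show "D\<^sub>t \<sigma> p + fst (u p) * D\<^sub>1 \<sigma> p + snd (u p) * D\<^sub>2 \<sigma> p
        + \<theta> * \<sigma> p * (D\<^sub>1 (\<lambda>q. fst (u q)) p + D\<^sub>2 (\<lambda>q. snd (u q)) p) = 0" by (rule s)
    show "D\<^sub>t (\<lambda>q. fst (u q)) p + fst (u p) * D\<^sub>1 (\<lambda>q. fst (u q)) p + snd (u p) * D\<^sub>2 (\<lambda>q. fst (u q)) p
        + \<theta> * \<sigma> p * D\<^sub>1 \<sigma> p = 0" by (rule s)
    show "D\<^sub>t (\<lambda>q. snd (u q)) p + fst (u p) * D\<^sub>1 (\<lambda>q. snd (u q)) p + snd (u p) * D\<^sub>2 (\<lambda>q. snd (u q)) p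
        + \<theta> * \<sigma> p * D\<^sub>2 \<sigma> p = 0" by (rule s)
    show "D\<^sub>t \<sigma>' p + fst (u' p) * D\<^sub>1 \<sigma>' p + snd (u' p) * D\<^sub>2 \<sigma>' p
        + \<theta> * \<sigma>' p * (D\<^sub>1 (\<lambda>q. fst (u' q)) p + D\<^sub>2 (\<lambda>q. snd (u' q)) p) = 0" by (rule s')
    show "D\<^sub>t (\<lambda>q. fst (u' q)) p + fst (u' p) * D\<^sub>1 (\<lambda>q. fst (u' q)) p + snd (u' p) * D\<^sub>2 (\<lambda>q. fst (u' q)) p
        + exp (S' p / \<gamma>) * (\<theta> * \<sigma>' p * D\<^sub>1 \<sigma>' p) = 0" by (rule s')
    show "D\<^sub>t (\<lambda>q. snd (u' q)) p + fst (u' p) * D\<^sub>1 (\<lambda>q. snd (u' q)) p + snd (u' p) * D\<^sub>2 (\<lambda>q. snd (u' q)) p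
        + exp (S' p / \<gamma>) * (\<theta> * \<sigma>' p * D\<^sub>2 \<sigma>' p) = 0" by (rule s')
    show "D\<^sub>t S' p + fst (u' p) * D\<^sub>1 S' p + snd (u' p) * D\<^sub>2 S' p = 0" by (rule s')
  next
    show "0 < \<gamma>" using assms(3) by simp
  qed (fact assms(4-6) \<theta> V(1) G smooth(5) tx)+
qed

section \<open>Sobolev norms of tensor products\<close>

definition fourier_real :: "(real \<Rightarrow> real) \<Rightarrow> real \<Rightarrow> complex" where
  "fourier_real f \<xi> = (LINT x|lborel. cis (- (x * \<xi>)) * complex_of_real (f x))"

lemma integrable_continuous_compact_support:
  fixes f :: "'a::euclidean_space \<Rightarrow> 'b::euclidean_space"
  assumes "continuous_on UNIV f" "compact K" "\<And>x. x \<notin> K \<Longrightarrow> f x = 0"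
  shows "integrable lborel f"
proof -
  have "integrable lborel (\<lambda>x. indicator K x *\<^sub>R f x)"
    by (rule borel_integrable_compact[OF assms(2) continuous_on_subset[OF assms(1) subset_UNIV]])
  moreover have "indicator K x *\<^sub>R f x = f x" for x
    using assms(3)[of x] by (simp add: indicator_def)
  ultimately show ?thesis by simp
qed

lemma integrable_cis_mult:
  fixes f :: "real \<Rightarrow> real"
  assumes "continuous_on UNIV f" "\<And>x. \<bar>x\<bar> > R \<Longrightarrow> f x = 0"
  shows "integrable lborel (\<lambda>x. cis (- (x * \<xi>)) * complex_of_real (f x))"
  by (rule integrable_continuous_compact_support[where K="{-R..R}"])
     (use assms in \<open>auto intro!: continuous_intros simp: not_le\<close>)

text \<open>Integration by parts: the product of f with the exponential has compact support, so its
  derivative integrates to 0.\<close>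

lemma fourier_real_deriv:
  fixes f :: "real \<Rightarrow> real"
  assumes d: "\<And>x. (f has_real_derivative f' x) (at x)" and c: "continuous_on UNIV f'"
    and supp: "\<And>x. \<bar>x\<bar> > R \<Longrightarrow> f x = 0" and "R \<ge> 0"
  shows "fourier_real f' \<xi> = \<i> * \<xi> * fourier_real f \<xi>"
proof -
  have f': "f' x = 0" if "\<bar>x\<bar> > R" for x
    using deriv_eq_0_outside[of R f, OF supp that] DERIV_imp_deriv[OF d] by simp
  have cf: "continuous_on UNIV f" using DERIV_isCont[OF d] by (simp add: continuous_on_eq_continuous_at)
  define g where "g x = cis (- (x * \<xi>)) * complex_of_real (f x)" for x
  define g' where "g' x = cis (- (x * \<xi>)) * complex_of_real (f' x) - \<i> * \<xi> * g x" for x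
  have dg: "(g has_vector_derivative g' x) (at x)" for x
  proof -
    have 1: "((\<lambda>x. complex_of_real (f x)) has_vector_derivative complex_of_real (f' x)) (at x)"
      using d[of x] by (simp add: has_real_derivative_iff_has_vector_derivative has_vector_derivative_of_real)
    have "(cis has_vector_derivative \<i> * cis y) (at y)" for y
      using has_derivative_cis[OF has_derivative_ident, of y UNIV] by (simp add: has_vector_derivative_def)
    moreover have "((\<lambda>x. - (x * \<xi>)) has_vector_derivative - \<xi>) (at x)" by (auto intro!: derivative_eq_intros)
    ultimately have "(cis \<circ> (\<lambda>x. - (x * \<xi>)) has_vector_derivative (- \<xi>) *\<^sub>R (\<i> * cis (- (x * \<xi>)))) (at x)"
      by (intro vector_diff_chain_at)
    then have 2: "((\<lambda>x. cis (- (x * \<xi>))) has_vector_derivative (- \<xi>) *\<^sub>R (\<i> * cis (- (x * \<xi>)))) (at x)"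
      by (simp add: o_def)
    show ?thesis
      unfolding g_def[abs_def] g'_def using has_vector_derivative_mult[OF 2 1]
      by (simp add: scaleR_conv_of_real algebra_simps)
  qed
  have cg: "continuous_on UNIV g" unfolding g_def[abs_def] by (intro continuous_intros cf)
  have cg': "continuous_on UNIV g'" unfolding g'_def[abs_def] by (intro continuous_intros c cg)
  \<comment> \<open>f is known to vanish only for |x| > R, hence the end points are taken at
    distance 1 beyond R.\<close>
  let ?I = "{- (R + 1)..R + 1}"
  have "has_bochner_integral lborel (\<lambda>x. indicator ?I x *\<^sub>R g' x) (g (R + 1) - g (- (R + 1)))"
    by (rule has_bochner_integral_FTC_Icc)
       (use dg cg' \<open>R \<ge> 0\<close> in \<open>auto intro: has_vector_derivative_at_within continuous_on_subset\<close>)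
  moreover have "g (R + 1) = 0" "g (- (R + 1)) = 0" using supp \<open>R \<ge> 0\<close> by (auto simp: g_def)
  moreover have "indicator ?I x *\<^sub>R g' x = g' x" for x
  proof (cases "x \<in> ?I")
    case False
    then have "\<bar>x\<bar> > R" by auto
    then show ?thesis using f'[of x] supp[of x] by (simp add: g'_def g_def)
  qed simp
  ultimately have "(LINT x|lborel. g' x) = 0" by (simp add: has_bochner_integral_integral_eq)
  moreover have "(LINT x|lborel. g' x) = fourier_real f' \<xi> - \<i> * \<xi> * fourier_real f \<xi>"
  proof -
    have "integrable lborel (\<lambda>x. cis (- (x * \<xi>)) * complex_of_real (f' x))"
      by (rule integrable_cis_mult[OF c f'])
    moreover have "integrable lborel g"
      unfolding g_def[abs_def] by (rule integrable_cis_mult[OF cf supp])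
    ultimately show ?thesis unfolding g'_def fourier_real_def g_def by simp
  qed
  ultimately show ?thesis by simp
qed

lemma norm_fourier_real_le:
  fixes f :: "real \<Rightarrow> real"
  assumes "continuous_on UNIV f" "\<And>x. \<bar>x\<bar> > R \<Longrightarrow> f x = 0" "\<And>x. \<bar>f x\<bar> \<le> B" "R \<ge> 0"
  shows "cmod (fourier_real f \<xi>) \<le> 2 * R * B"
proof -
  have "cmod (fourier_real f \<xi>) \<le> (LINT x|lborel. B * indicator {-R..R} x)"
    unfolding fourier_real_def
  proof (rule Bochner_Integration.integral_norm_bound_integral)
    show "norm (cis (- (x * \<xi>)) * complex_of_real (f x)) \<le> B * indicator {- R..R} x" for x
      using assms(2)[of x] assms(3)[of x] by (auto simp: norm_mult indicator_def)
    show "integrable lborel (\<lambda>x. B * indicator {-R..R} x :: real)"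
      by (intro integrable_mult_right integrable_real_indicator) (use \<open>R \<ge> 0\<close> in auto)
  qed (rule integrable_cis_mult[OF assms(1,2)])
  also have "\<dots> = 2 * R * B" using \<open>R \<ge> 0\<close> by simp
  finally show ?thesis .
qed

text \<open>For |\<xi>| <= 1 the trivial bound 4 B suffices, for larger \<xi> three integrations by
  parts; in both cases the cube costs a factor 8, whence 128 = 8 * 16. The power 3 exceeds by one
  the power 2 in the weight bound, which leaves an integrable factor.\<close>

lemma fourier_real_decay:
  fixes f :: "real \<Rightarrow> real"
  assumes smooth: "\<And>k. C_k_on k UNIV f" and supp: "\<And>x. \<bar>x\<bar> > 2 \<Longrightarrow> f x = 0"
    and B: "\<And>x. \<bar>f x\<bar> \<le> B" "\<And>x. \<bar>deriv (deriv (deriv f)) x\<bar> \<le> B"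
  shows "(cmod (fourier_real f \<xi>))\<^sup>2 \<le> 128 * B\<^sup>2 / (1 + \<xi>\<^sup>2) ^ 3"
proof -
  have s: "C_k_on k UNIV (deriv f)" "C_k_on k UNIV (deriv (deriv f))" "C_k_on k UNIV (deriv (deriv (deriv f)))" for k
    by (intro C_k_on_real_deriv(2)[OF open_UNIV] smooth)+
  note d = C_k_on_real_deriv(1)[OF open_UNIV _ UNIV_I]
  note z1 = deriv_eq_0_outside[of 2 f, OF supp]
  note z2 = deriv_eq_0_outside[of 2 "deriv f", OF z1]
  note z3 = deriv_eq_0_outside[of 2 "deriv (deriv f)", OF z2]
  have eq: "fourier_real (deriv (deriv (deriv f))) \<xi> = (\<i> * \<xi>) ^ 3 * fourier_real f \<xi>"
    using fourier_real_deriv[OF d[OF smooth] C_k_on_imp_continuous_on[OF s(1)] supp, of 2 \<xi>]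
      fourier_real_deriv[OF d[OF s(1)] C_k_on_imp_continuous_on[OF s(2)] z1, of 2 \<xi>]
      fourier_real_deriv[OF d[OF s(2)] C_k_on_imp_continuous_on[OF s(3)] z2, of 2 \<xi>]
    by (simp add: power3_eq_cube mult.assoc)
  define m where "m = cmod (fourier_real f \<xi>)"
  have m0: "m \<ge> 0" by (simp add: m_def)
  have B0: "B \<ge> 0" using B(1)[of 0] by linarith
  have 1: "m \<le> 4 * B"
    unfolding m_def using norm_fourier_real_le[OF C_k_on_imp_continuous_on[OF smooth[of 0]], of 2 B \<xi>] supp B(1) by auto
  have "cmod (fourier_real (deriv (deriv (deriv f))) \<xi>) \<le> 2 * 2 * B"
    by (rule norm_fourier_real_le[OF C_k_on_imp_continuous_on[OF s(3)[of 0]]]) (use z3 B(2) in auto)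
  then have 3: "\<bar>\<xi>\<bar> ^ 3 * m \<le> 4 * B" unfolding eq by (simp add: norm_mult norm_power m_def)
  have "m\<^sup>2 * (1 + \<xi>\<^sup>2) ^ 3 \<le> 128 * B\<^sup>2"
  proof (cases "\<bar>\<xi>\<bar> \<le> 1")
    case True
    then have "\<xi>\<^sup>2 \<le> 1" by (simp add: abs_square_le_1)
    then have "m\<^sup>2 * (1 + \<xi>\<^sup>2) ^ 3 \<le> (4 * B)\<^sup>2 * 2 ^ 3"
      using 1 m0 B0 by (intro mult_mono power_mono) auto
    then show ?thesis by (simp add: power_mult_distrib)
  next
    case False
    then have "1 \<le> \<xi>\<^sup>2" using abs_square_le_1[of \<xi>] by linarith
    then have "m\<^sup>2 * (1 + \<xi>\<^sup>2) ^ 3 \<le> m\<^sup>2 * (2 * \<xi>\<^sup>2) ^ 3" by (intro mult_left_mono power_mono) auto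
    also have "\<dots> = 8 * (\<bar>\<xi>\<bar> ^ 3 * m)\<^sup>2"
      by (simp add: power_mult_distrib power_mult[symmetric] power_even_abs)
    also have "\<dots> \<le> 8 * (4 * B)\<^sup>2" using 3 m0 by (intro mult_left_mono power_mono) auto
    finally show ?thesis by (simp add: power_mult_distrib)
  qed
  moreover have "(1 + \<xi>\<^sup>2) ^ 3 > 0" by (intro zero_less_power add_pos_nonneg) auto
  ultimately show ?thesis by (simp add: m_def pos_le_divide_eq)
qed

lemma fourier_real_affine:
  assumes "\<mu> > 0"
  shows "cmod (fourier_real (\<lambda>x. f ((x - p) / \<mu>)) \<xi>) = \<mu> * cmod (fourier_real f (\<mu> * \<xi>))"
proof -
  have "fourier_real (\<lambda>x. f ((x - p) / \<mu>)) \<xi> =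
      \<bar>\<mu>\<bar> *\<^sub>R (LINT x|lborel. cis (- ((p + \<mu> * x) * \<xi>)) * complex_of_real (f (((p + \<mu> * x) - p) / \<mu>)))"
    unfolding fourier_real_def by (rule lborel_integral_real_affine) (use assms in simp)
  also have "(\<lambda>x. cis (- ((p + \<mu> * x) * \<xi>)) * complex_of_real (f (((p + \<mu> * x) - p) / \<mu>))) =
      (\<lambda>x. cis (- (p * \<xi>)) * (cis (- (x * (\<mu> * \<xi>))) * complex_of_real (f x)))"
    using assms by (auto simp: fun_eq_iff cis_mult[symmetric] algebra_simps simp del: cis_mult simp flip: cis_mult)
       (simp_all add: cis_mult algebra_simps)
  also have "(LINT x|lborel. cis (- (p * \<xi>)) * (cis (- (x * (\<mu> * \<xi>))) * complex_of_real (f x))) =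
      cis (- (p * \<xi>)) * fourier_real f (\<mu> * \<xi>)"
    unfolding fourier_real_def by simp
  finally show ?thesis using assms by (simp add: norm_mult)
qed

lemma integrable_inverse_1_plus_square_lborel: "integrable lborel (\<lambda>x::real. 1 / (1 + x\<^sup>2))"
proof -
  let ?f = "\<lambda>x::real. 1 / (1 + x\<^sup>2)"
  have "(\<integral>\<^sup>+x. ennreal (?f x) * indicator {0..} x \<partial>lborel) = pi / 2 - arctan 0"
    by (rule nn_integral_FTC_atLeast)
       (auto intro!: derivative_eq_intros tendsto_arctan_at_top simp: inverse_eq_divide)
  moreover have "(\<integral>\<^sup>+x. ennreal (?f x) * indicator {0..} x \<partial>lborel) = (\<integral>\<^sup>+x. ennreal (norm (?f x * indicator {0..} x)) \<partial>lborel)"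
    by (intro nn_integral_cong) (auto simp: indicator_def)
  ultimately have i: "integrable lborel (\<lambda>x. ?f x * indicator {0..} x)"
    by (intro integrableI_bounded) auto
  have j: "integrable lborel (\<lambda>x. ?f x * indicator {0..} (- x))"
    using lborel_integrable_real_affine[OF i, of "-1" 0] by simp
  show ?thesis
    by (rule Bochner_Integration.integrable_bound[OF Bochner_Integration.integrable_add[OF i j]])
       (auto simp: indicator_def)
qed

lemma integrable_product_lborel:
  fixes f g :: "real \<Rightarrow> 'a::{real_normed_field, banach, second_countable_topology}"
  assumes f: "integrable lborel f" and g: "integrable lborel g"
  shows "integrable lborel (\<lambda>x::plane. f (fst x) * g (snd x))"
    and "(LINT x|(lborel :: plane measure). f (fst x) * g (snd x)) = (LINT x|lborel. f x) * (LINT x|lborel. g x)"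
proof -
  have [measurable]: "f \<in> borel_measurable lborel" "g \<in> borel_measurable lborel" using f g by auto
  have i: "integrable (lborel \<Otimes>\<^sub>M lborel) (\<lambda>x::plane. f (fst x) * g (snd x))"
  proof (rule lborel_pair.Fubini_integrable)
    show "(\<lambda>x. f (fst x) * g (snd x)) \<in> borel_measurable (lborel \<Otimes>\<^sub>M lborel)" by measurable
    show "integrable lborel (\<lambda>x. LINT y|lborel. norm (f (fst (x, y)) * g (snd (x, y))))"
      using f by (simp add: norm_mult)
    show "AE x in lborel. integrable lborel (\<lambda>y. f (fst (x, y)) * g (snd (x, y)))"
      using g by simp
  qed
  then show "integrable lborel (\<lambda>x::plane. f (fst x) * g (snd x))" by (simp add: lborel_prod)
  show "(LINT x|(lborel :: plane measure). f (fst x) * g (snd x)) = (LINT x|lborel. f x) * (LINT x|lborel. g x)"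
    using lborel_pair.integral_fst'[OF i] by (simp add: lborel_prod)
qed

lemma fourier_tensor_product:
  fixes f g :: "real \<Rightarrow> real"
  assumes "continuous_on UNIV f" "\<And>x. \<bar>x\<bar> > R \<Longrightarrow> f x = 0" "continuous_on UNIV g" "\<And>x. \<bar>x\<bar> > R \<Longrightarrow> g x = 0"
  shows "fourier (\<lambda>x. f (fst x) * g (snd x)) \<xi> = fourier_real f (fst \<xi>) * fourier_real g (snd \<xi>)"
proof -
  have "cis (- (x \<bullet> \<xi>)) * complex_of_real (f (fst x) * g (snd x)) =
     (cis (- (fst x * fst \<xi>)) * complex_of_real (f (fst x))) * (cis (- (snd x * snd \<xi>)) * complex_of_real (g (snd x)))" for x
  proof -
    have "cis (- (x \<bullet> \<xi>)) = cis (- (fst x * fst \<xi>)) * cis (- (snd x * snd \<xi>))"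
      by (simp add: cis_mult inner_prod_def)
    then show ?thesis by simp
  qed
  then show ?thesis
    unfolding fourier_def fourier_real_def
    by (simp only: integrable_product_lborel(2)[OF integrable_cis_mult[OF assms(1,2)] integrable_cis_mult[OF assms(3,4)]])
qed

lemma borel_measurable_fourier_real:
  assumes "continuous_on UNIV f"
  shows "fourier_real f \<in> borel_measurable borel"
proof -
  have [measurable]: "f \<in> borel_measurable borel" by (rule borel_measurable_continuous_onI[OF assms])
  have [measurable]: "cis \<in> borel_measurable borel" by (intro borel_measurable_continuous_onI continuous_intros)
  show ?thesis unfolding fourier_real_def[abs_def] by measurable
qed

text \<open>The bound on \<open>W\<close> is one that the isotropic and the anisotropic weight both satisfy.\<close>

lemma sobolev_tensor_product:
  fixes f g :: "real \<Rightarrow> real" and W :: "plane \<Rightarrow> real" and p q :: real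
  defines "J \<equiv> LINT x|lborel. 1 / (1 + (x::real)\<^sup>2)"
  assumes f: "\<And>k. C_k_on k UNIV f" "\<And>x. \<bar>x\<bar> \<ge> 2 \<Longrightarrow> f x = 0" "\<And>x. \<bar>f x\<bar> \<le> B" "\<And>x. \<bar>deriv (deriv (deriv f)) x\<bar> \<le> B"
    and g: "\<And>k. C_k_on k UNIV g" "\<And>x. \<bar>x\<bar> \<ge> 2 \<Longrightarrow> g x = 0" "\<And>x. \<bar>g x\<bar> \<le> C" "\<And>x. \<bar>deriv (deriv (deriv g)) x\<bar> \<le> C"
    and \<mu>: "\<mu> > 0" "h > 0"
    and W: "W \<in> borel_measurable borel" "\<And>\<xi>. 0 \<le> W \<xi>"
      "\<And>\<xi>. W \<xi> \<le> N * ((1 + (\<mu> * fst \<xi>)\<^sup>2)\<^sup>2 * (1 + (h * snd \<xi>)\<^sup>2)\<^sup>2)"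
  defines "\<phi> \<equiv> \<lambda>x::plane. f ((fst x - p) / \<mu>) * g ((snd x - q) / h)"
  shows "integrable lborel \<phi>"
    and "integrable lborel (\<lambda>\<xi>. W \<xi> * (cmod (fourier \<phi> \<xi>))\<^sup>2)"
    and "(LINT \<xi>|lborel. W \<xi> * (cmod (fourier \<phi> \<xi>))\<^sup>2) \<le> N * (128 * B * C * J)\<^sup>2 * (\<mu> * h)"
proof -
  let ?f = "\<lambda>x. f ((x - p) / \<mu>)" and ?g = "\<lambda>x. g ((x - q) / h)"
  have cf: "continuous_on UNIV ?f" and cg: "continuous_on UNIV ?g"
    using \<mu> by (auto intro!: continuous_on_compose2[OF C_k_on_imp_continuous_on[OF f(1)[of 0]]]
        continuous_on_compose2[OF C_k_on_imp_continuous_on[OF g(1)[of 0]]] continuous_intros)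
  define R where "R = 2 * \<mu> + 2 * h + \<bar>p\<bar> + \<bar>q\<bar>"
  have sf: "?f x = 0" and sg: "?g x = 0" if "\<bar>x\<bar> > R" for x
  proof -
    have "2 * \<mu> \<le> \<bar>x - p\<bar>" "2 * h \<le> \<bar>x - q\<bar>" using that \<mu> by (auto simp: R_def)
    then show "?f x = 0" "?g x = 0" using \<mu> by (auto intro!: f(2) g(2) simp: pos_le_divide_eq)
  qed
  have ft: "fourier \<phi> \<xi> = fourier_real ?f (fst \<xi>) * fourier_real ?g (snd \<xi>)" for \<xi>
    unfolding \<phi>_def by (rule fourier_tensor_product[OF cf sf cg sg])
  have i1: "integrable lborel ?f" and i2: "integrable lborel ?g"
    by (rule integrable_continuous_compact_support[where K="{-R..R}"]; use cf cg sf sg in \<open>force simp: not_le\<close>)+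
  show "integrable lborel \<phi>" unfolding \<phi>_def by (rule integrable_product_lborel(1)[OF i1 i2])
  define I where "I a x = 1 / (1 + (a * x)\<^sup>2)" for a x :: real
  have Ii: "integrable lborel (I a)" "(LINT x|lborel. I a x) = J / a" if "a > 0" for a
  proof -
    show "integrable lborel (I a)"
      using lborel_integrable_real_affine[OF integrable_inverse_1_plus_square_lborel, of a 0] that
      by (simp add: I_def[abs_def])
    show "(LINT x|lborel. I a x) = J / a"
      using lborel_integral_real_affine[of a "\<lambda>x. 1 / (1 + x\<^sup>2)" 0] that by (simp add: I_def J_def field_simps)
  qed
  have pos: "1 + x\<^sup>2 > 0" for x :: real by (simp add: add_pos_nonneg)
  have N0: "N \<ge> 0" using order_trans[OF W(2) W(3)[of 0]] by simp
  define Z where "Z = N * (128 * B\<^sup>2 * \<mu>\<^sup>2) * (128 * C\<^sup>2 * h\<^sup>2)"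
  have bound: "W \<xi> * (cmod (fourier \<phi> \<xi>))\<^sup>2 \<le> Z * (I \<mu> (fst \<xi>) * I h (snd \<xi>))" for \<xi>
  proof -
    define a where "a = 1 + (\<mu> * fst \<xi>)\<^sup>2"
    define b where "b = 1 + (h * snd \<xi>)\<^sup>2"
    have ab: "a > 0" "b > 0" using pos by (auto simp: a_def b_def)
    have 1: "(cmod (fourier_real ?f (fst \<xi>)))\<^sup>2 \<le> \<mu>\<^sup>2 * (128 * B\<^sup>2 / a ^ 3)"
      unfolding fourier_real_affine[OF \<mu>(1)] power_mult_distrib[of \<mu> "cmod _"] a_def
      by (intro mult_left_mono fourier_real_decay f(1,3,4) f(2)[OF less_imp_le]) auto
    have 2: "(cmod (fourier_real ?g (snd \<xi>)))\<^sup>2 \<le> h\<^sup>2 * (128 * C\<^sup>2 / b ^ 3)"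
      unfolding fourier_real_affine[OF \<mu>(2)] power_mult_distrib[of h "cmod _"] b_def
      by (intro mult_left_mono fourier_real_decay g(1,3,4) g(2)[OF less_imp_le]) auto
    have "(cmod (fourier \<phi> \<xi>))\<^sup>2 \<le> (\<mu>\<^sup>2 * (128 * B\<^sup>2 / a ^ 3)) * (h\<^sup>2 * (128 * C\<^sup>2 / b ^ 3))"
      unfolding ft norm_mult power_mult_distrib[of "cmod _"] by (intro mult_mono 1 2) (use ab in auto)
    \<comment> \<open>The weight uses up two of the three powers of a and b. The remaining 1 / (a b)
      has integral J^2 / (\<mu> h), which turns \<mu>^2 h^2 into \<mu> h.\<close>
    then have "W \<xi> * (cmod (fourier \<phi> \<xi>))\<^sup>2 \<le> (N * (a\<^sup>2 * b\<^sup>2)) * ((\<mu>\<^sup>2 * (128 * B\<^sup>2 / a ^ 3)) * (h\<^sup>2 * (128 * C\<^sup>2 / b ^ 3)))"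
      using W(2,3)[of \<xi>] N0 by (intro mult_mono) (auto simp: a_def b_def)
    also have "\<dots> = Z * (1 / a * (1 / b))"
      using ab by (simp add: Z_def field_simps power2_eq_square power3_eq_cube)
    finally show ?thesis by (simp add: I_def a_def b_def)
  qed
  note pI = integrable_product_lborel[OF Ii(1)[OF \<mu>(1)] Ii(1)[OF \<mu>(2)]]
  have [measurable]: "fourier_real ?f \<in> borel_measurable borel" "fourier_real ?g \<in> borel_measurable borel" "W \<in> borel_measurable borel"
    using borel_measurable_fourier_real cf cg W(1) by blast+
  show i: "integrable lborel (\<lambda>\<xi>. W \<xi> * (cmod (fourier \<phi> \<xi>))\<^sup>2)"
  proof (rule Bochner_Integration.integrable_bound[OF integrable_mult_right[OF pI(1), of Z]])
    have "(\<lambda>\<xi>. W \<xi> * (cmod (fourier_real ?f (fst \<xi>) * fourier_real ?g (snd \<xi>)))\<^sup>2) \<in> borel_measurable (borel \<Otimes>\<^sub>M borel)"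
      unfolding borel_prod[symmetric] using W(1)[folded borel_prod] by measurable
    then show "(\<lambda>\<xi>. W \<xi> * (cmod (fourier \<phi> \<xi>))\<^sup>2) \<in> borel_measurable lborel"
      unfolding ft by (simp add: borel_prod)
    show "AE \<xi> in lborel. norm (W \<xi> * (cmod (fourier \<phi> \<xi>))\<^sup>2) \<le> norm (Z * (I \<mu> (fst \<xi>) * I h (snd \<xi>)))"
    proof (rule AE_I2)
      fix \<xi>
      have "norm (W \<xi> * (cmod (fourier \<phi> \<xi>))\<^sup>2) = W \<xi> * (cmod (fourier \<phi> \<xi>))\<^sup>2" using W(2) by simp
      also have "\<dots> \<le> norm (Z * (I \<mu> (fst \<xi>) * I h (snd \<xi>)))" by (rule order_trans[OF bound]) simp
      finally show "norm (W \<xi> * (cmod (fourier \<phi> \<xi>))\<^sup>2) \<le> norm (Z * (I \<mu> (fst \<xi>) * I h (snd \<xi>)))" .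
    qed
  qed
  have "(LINT \<xi>|lborel. W \<xi> * (cmod (fourier \<phi> \<xi>))\<^sup>2) \<le> (LINT \<xi>|lborel. Z * (I \<mu> (fst \<xi>) * I h (snd \<xi>)))"
    by (rule integral_mono[OF i integrable_mult_right[OF pI(1)] bound])
  also have "\<dots> = Z * (J / \<mu> * (J / h))"
    using pI(2) by (simp add: Ii(2) \<mu>)
  also have "\<dots> = N * (128 * B * C * J)\<^sup>2 * (\<mu> * h)"
    using \<mu> by (simp add: Z_def field_simps power2_eq_square)
  finally show "(LINT \<xi>|lborel. W \<xi> * (cmod (fourier \<phi> \<xi>))\<^sup>2) \<le> N * (128 * B * C * J)\<^sup>2 * (\<mu> * h)" .
qed

section \<open>A focusing simple wave\<close>

definition wave_density :: "real \<Rightarrow> real \<Rightarrow> real \<Rightarrow> real" where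
  "wave_density c \<theta> z = (1 + \<theta> * z / c) powr (1 / \<theta>)"

text \<open>The profile of scale \<eta> / 8 and this amplitude has least slope -8 a / \<eta>; the
  characteristic speed grows by 1 + \<theta> per unit of velocity. The amplitude makes the product
  equal to -1 / T, so the first crossing occurs at T.\<close>

definition focusing_amplitude :: "real \<Rightarrow> real \<Rightarrow> real \<Rightarrow> real" where
  "focusing_amplitude \<gamma> \<eta> T = \<eta> / 8 / ((1 + (\<gamma> - 1) / 2) * T)"

definition focusing_velocity :: "(real \<Rightarrow> real) \<Rightarrow> real \<Rightarrow> real \<Rightarrow> real \<Rightarrow> real \<Rightarrow> real" where
  "focusing_velocity F \<gamma> \<eta> T y = focusing_amplitude \<gamma> \<eta> T * F ((y - 2 * \<eta>) / (\<eta> / 8))"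

text \<open>The condition \<open>small\<close> gives 4 (1 + \<theta>) a <= c, which keeps the flow
  subsonic and the density away from vacuum.\<close>

locale focusing_wave =
  fixes A \<gamma> \<eta> T :: real and F :: "real \<Rightarrow> real"
  assumes A: "A > 0" and \<gamma>: "\<gamma> > 1" and \<eta>: "\<eta> > 0" and T: "T > 0"
    and F: "\<And>k. C_k_on k UNIV F" "\<And>z. \<bar>z\<bar> \<le> 1 \<Longrightarrow> F z = - z" "\<And>z. \<bar>z\<bar> \<ge> 2 \<Longrightarrow> F z = 0"
      "\<And>z. \<bar>F z\<bar> \<le> 2" "\<And>z. deriv F z \<ge> - 1"
    and small: "\<eta> \<le> 2 * sqrt (A * \<gamma>) * T"
begin

definition c where "c = sqrt (A * \<gamma>)"
definition \<theta> where "\<theta> = (\<gamma> - 1) / 2"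
definition a where "a = focusing_amplitude \<gamma> \<eta> T"
definition w\<^sub>0 where "w\<^sub>0 = focusing_velocity F \<gamma> \<eta> T"
text \<open>The centre of the initial disc. A signal that starts at x1 = 2 \<eta> with speed c has
  the same first coordinate at time T, so the focus occurs here.\<close>

definition x\<^sub>0 :: plane where "x\<^sub>0 = (c * T + 2 * \<eta>, 0)"

lemma c: "c > 0" using A \<gamma> by (simp add: c_def)
lemma \<theta>: "\<theta> > 0" using \<gamma> by (simp add: \<theta>_def)
lemma a: "a > 0" using \<eta> T \<theta> by (simp add: a_def focusing_amplitude_def \<theta>_def[symmetric])
lemma a_eq: "a * (1 + \<theta>) = \<eta> / 8 / T" using \<theta> T by (simp add: a_def focusing_amplitude_def \<theta>_def[symmetric])
lemma a_le: "4 * ((1 + \<theta>) * a) \<le> c"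
proof -
  have "(1 + \<theta>) * a = \<eta> / 8 / T" using a_eq by (simp add: mult.commute)
  moreover have "\<eta> / T \<le> 2 * c" using small T by (simp add: c_def pos_divide_le_eq)
  ultimately show ?thesis by simp
qed

lemma w\<^sub>0_eq: "w\<^sub>0 y = a * F ((y - 2 * \<eta>) / (\<eta> / 8))" by (simp add: w\<^sub>0_def a_def focusing_velocity_def)

lemma smooth_w\<^sub>0: "C_k_on k UNIV w\<^sub>0"
proof -
  have "C_k_on k UNIV (\<lambda>y. (8 / \<eta>) * y + (- 16))"
    by (intro C_k_on_add[OF open_UNIV _ C_k_on_const] C_k_on_mult[OF open_UNIV C_k_on_const] C_k_on_linear bounded_linear_ident open_UNIV)
  then have "C_k_on k UNIV (\<lambda>y. a * F ((8 / \<eta>) * y + (- 16)))"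
    by (intro C_k_on_mult[OF open_UNIV C_k_on_const] C_k_on_compose[OF open_UNIV open_UNIV F(1)]) auto
  moreover have "(8 / \<eta>) * y + (- 16) = (y - 2 * \<eta>) / (\<eta> / 8)" for y using \<eta> by (simp add: field_simps)
  ultimately show ?thesis by (simp add: w\<^sub>0_eq[abs_def])
qed

lemma abs_w\<^sub>0_le: "\<bar>w\<^sub>0 y\<bar> \<le> 2 * a"
  using mult_left_mono[OF F(4), of a] a by (simp add: w\<^sub>0_eq abs_mult)

lemma deriv_w\<^sub>0: "deriv w\<^sub>0 y = a * (8 / \<eta>) * deriv F ((y - 2 * \<eta>) / (\<eta> / 8))"
proof -
  have "((\<lambda>y. a * F ((y - 2 * \<eta>) / (\<eta> / 8))) has_real_derivative a * (deriv F ((y - 2 * \<eta>) / (\<eta> / 8)) * (8 / \<eta>))) (at y)"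
    by (intro DERIV_cmult DERIV_chain2[OF C_k_on_real_deriv(1)[OF open_UNIV F(1) UNIV_I]])
       (use \<eta> in \<open>auto intro!: derivative_eq_intros\<close>)
  from DERIV_imp_deriv[OF this] show ?thesis unfolding w\<^sub>0_eq[abs_def] by (simp only: mult_ac)
qed

lemma slope: "(1 + \<theta>) * (a * (8 / \<eta>)) = 1 / T"
  using a_eq \<eta> T by (simp add: field_simps)

lemma deriv_w\<^sub>0_ge: "(1 + \<theta>) * deriv w\<^sub>0 y \<ge> - 1 / T"
proof -
  have "(1 + \<theta>) * deriv w\<^sub>0 y = 1 / T * deriv F ((y - 2 * \<eta>) / (\<eta> / 8))"
    unfolding deriv_w\<^sub>0 slope[symmetric] by simp
  also have "\<dots> \<ge> 1 / T * (- 1)" using F(5) T by (intro mult_left_mono) auto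
  finally show ?thesis by simp
qed

lemma deriv_w\<^sub>0_bounded: obtains K where "\<And>y. \<bar>deriv w\<^sub>0 y\<bar> \<le> K"
proof -
  obtain K where K: "\<And>z. \<bar>deriv F z\<bar> \<le> K"
    using smooth_compact_support_bounds[of F 2, OF F(1)] F(3) by (metis less_imp_le)
  have "\<bar>deriv w\<^sub>0 y\<bar> \<le> a * (8 / \<eta>) * K" for y
    unfolding deriv_w\<^sub>0 abs_mult using a \<eta> K by (intro mult_mono) auto
  then show thesis by (rule that)
qed

lemma initial_region_eq: "initial_region A \<gamma> \<eta> T = cball x\<^sub>0 (c * T + \<eta>)"
proof -
  have "c * T + \<eta> > 0" using c T \<eta> by (simp add: add_pos_pos)
  then have "dist x x\<^sub>0 \<le> c * T + \<eta> \<longleftrightarrow> (fst x - c * T - 2 * \<eta>)\<^sup>2 + (snd x)\<^sup>2 \<le> (c * T + \<eta>)\<^sup>2" for x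
    by (cases x) (simp add: x\<^sub>0_def dist_Pair_Pair dist_real_def real_sqrt_le_iff' diff_diff_eq)
  then show ?thesis by (auto simp: initial_region_def c_def[symmetric] dist_commute mem_cball)
qed

end

text \<open>The conclusions of \<open>burgers_solution\<close> for m = 1 + \<theta> become
  assumptions, so that the existentially given wave can be named across lemmas;
  \<open>solution_exists\<close> discharges them.\<close>

locale focusing_solution = focusing_wave +
  fixes V :: "spacetime set" and w w\<^sub>1 :: "spacetime \<Rightarrow> real" and K :: real
  assumes V: "open V" "slab T \<subseteq> V" and wk: "\<And>k. C_k_on k V w"
    and dw: "\<And>p. p \<in> V \<Longrightarrow> (w has_derivative (\<lambda>v. w\<^sub>1 p * (fst (snd v) - (c + (1 + \<theta>) * w p) * fst v))) (at p)"
    and w_char: "\<And>t y x\<^sub>2. 0 \<le> t \<Longrightarrow> t < T \<Longrightarrow> w (t, (y + t * (c + (1 + \<theta>) * w\<^sub>0 y), x\<^sub>2)) = w\<^sub>0 y"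
    and w\<^sub>1_char: "\<And>t y x\<^sub>2. 0 \<le> t \<Longrightarrow> t < T \<Longrightarrow>
       w\<^sub>1 (t, (y + t * (c + (1 + \<theta>) * w\<^sub>0 y), x\<^sub>2)) = deriv w\<^sub>0 y / (1 + t * (1 + \<theta>) * deriv w\<^sub>0 y)"
    and w_le: "\<And>p. \<bar>w p\<bar> \<le> 2 * a"
    and w\<^sub>1_le: "\<And>t x. 0 \<le> t \<Longrightarrow> t < T \<Longrightarrow> \<bar>w\<^sub>1 (t, x)\<bar> \<le> K / (1 - t / T)"
    and planar: "\<And>t x\<^sub>1 x\<^sub>2 z\<^sub>2. w (t, (x\<^sub>1, x\<^sub>2)) = w (t, (x\<^sub>1, z\<^sub>2))"
begin

definition \<rho> where "\<rho> p = wave_density c \<theta> (w p)"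
definition u :: "spacetime \<Rightarrow> plane" where "u p = (w p, 0)"
abbreviation S :: "spacetime \<Rightarrow> real" where "S \<equiv> \<lambda>_. 0"
definition D where "D = domain_of_dependence A \<gamma> (initial_region A \<gamma> \<eta> T) T \<rho> u S"

lemma w_small: "(1 + \<theta>) * \<bar>w p\<bar> \<le> c / 2"
  using mult_left_mono[OF w_le[of p], of "1 + \<theta>"] \<theta> a_le by (simp add: algebra_simps)

lemma \<theta>w_small: "\<bar>\<theta> * w p\<bar> + \<bar>w p\<bar> \<le> c / 2"
  using w_small[of p] \<theta> by (simp add: abs_mult algebra_simps)

lemma density_base: "1 + \<theta> * w p / c \<ge> 1 / 2"
proof -
  have "\<theta> * w p \<ge> - (c / 2)" using \<theta>w_small[of p] by linarith
  then show ?thesis using c by (simp add: field_simps)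
qed

lemma density_base_pos: "1 + \<theta> * w p / c > 0" using density_base[of p] by linarith

lemma \<rho>_pos: "\<rho> p > 0" using density_base_pos[of p] by (simp add: \<rho>_def wave_density_def)

lemma sound_speed_eq: "sound_speed A \<gamma> (\<rho> p) 0 = c + \<theta> * w p"
  unfolding \<rho>_def wave_density_def c_def \<theta>_def
  by (rule sound_speed_simple_wave[OF A \<gamma> density_base_pos[unfolded c_def \<theta>_def]])

lemma smooth_\<rho>: "C_k_on k V \<rho>"
proof -
  have "C_k_on k V (\<lambda>p. 1 + (\<theta> / c) * w p)"
    by (intro C_k_on_add[OF V(1) C_k_on_const] C_k_on_mult[OF V(1) C_k_on_const] wk)
  then have "C_k_on k V (\<lambda>p. (1 + (\<theta> / c) * w p) powr (1 / \<theta>))"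
    by (intro C_k_on_compose[where g="\<lambda>x. x powr (1 / \<theta>)", OF V(1) _ C_k_on_powr]) (use density_base_pos in auto)
  then show ?thesis by (simp add: \<rho>_def[abs_def] wave_density_def)
qed

lemma smooth_u: "C_k_on k V u"
  unfolding u_def[abs_def] by (intro C_k_on_Pair V wk C_k_on_const)

lemma smooth_fields: "smooth_fields_on (slab T) \<rho> u S"
  unfolding smooth_fields_on_def smooth_on_def
  using V \<rho>_pos by (auto intro!: exI[of _ V] C_k_on_Pair smooth_\<rho> smooth_u)

lemma euler: "euler_on A \<gamma> V \<rho> u S"
  unfolding \<rho>_def[abs_def] u_def[abs_def] wave_density_def c_def \<theta>_def
  by (rule simple_wave_euler[OF A \<gamma> dw[unfolded c_def \<theta>_def] density_base_pos[unfolded c_def \<theta>_def]])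

lemma w_initial: "w (0, x) = w\<^sub>0 (fst x)"
  using w_char[of 0 "fst x" "snd x"] T by simp

text \<open>The excess over c adds up to \<eta> / 4 by time T, so the cone of
  \<open>cone_subset_D\<close> has radius more than 3 \<eta> / 4 at all times before T.\<close>

lemma speed_le: "norm (u p) + sound_speed A \<gamma> (\<rho> p) 0 \<le> c + \<eta> / (4 * T)"
proof -
  have "norm (u p) + sound_speed A \<gamma> (\<rho> p) 0 \<le> c + (1 + \<theta>) * \<bar>w p\<bar>"
    using abs_ge_self[of "\<theta> * w p"] \<theta> by (simp add: sound_speed_eq u_def norm_Pair abs_mult algebra_simps)
  also have "(1 + \<theta>) * \<bar>w p\<bar> \<le> (1 + \<theta>) * (2 * a)" using w_le \<theta> by (intro mult_left_mono) auto
  also have "\<dots> = \<eta> / (4 * T)" using a_eq by (simp add: field_simps)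
  finally show ?thesis by simp
qed

section \<open>Outer and inner bounds for the domain of dependence\<close>

lemma D_subset: "(t, x) \<in> D \<Longrightarrow> 0 \<le> t \<and> t < T \<and> x \<in> initial_region A \<gamma> \<eta> T"
proof -
  assume D: "(t, x) \<in> D"
  have "causal_curve u (\<lambda>p. sound_speed A \<gamma> (\<rho> p) (S p)) t (\<lambda>_. x)"
  proof (rule causal_curve_const)
    fix s
    show "norm (u (s, x)) \<le> sound_speed A \<gamma> (\<rho> (s, x)) (S (s, x))"
      using \<theta>w_small[of "(s, x)"] c abs_ge_minus_self[of "\<theta> * w (s, x)"] by (simp add: sound_speed_eq u_def norm_Pair)
  qed
  then show ?thesis using D by (auto simp: D_def domain_of_dependence_def)
qed

lemma cone_subset_D:
  assumes "0 \<le> t" "t < T" "dist x x\<^sub>0 \<le> c * T + \<eta> - (c + \<eta> / (4 * T)) * t"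
  shows "(t, x) \<in> D"
  unfolding D_def domain_of_dependence_def
proof (clarsimp simp: assms)
  fix z assume z: "causal_curve u (\<lambda>p. sound_speed A \<gamma> (\<rho> p) 0) t z" "x = z t"
  have "dist (z 0) (z t) \<le> (c + \<eta> / (4 * T)) * t"
    by (rule causal_curve_displacement[OF z(1) assms(1)]) (use speed_le c \<eta> T in auto)
  then have "dist (z 0) x\<^sub>0 \<le> c * T + \<eta>"
    using dist_triangle[of "z 0" x\<^sub>0 "z t"] assms(3)[unfolded z(2)] by linarith
  then show "z 0 \<in> initial_region A \<gamma> \<eta> T" by (simp add: initial_region_eq dist_commute)
qed

text \<open>The constant degenerates as t tends to T, but closedness of a slice refers to one t < T
  only.\<close>

lemma w_lipschitz:
  assumes "0 \<le> t" "t < T"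
  obtains L where "L \<ge> 0" "\<And>s x y. s \<in> {0..t} \<Longrightarrow> \<bar>w (s, x) - w (s, y)\<bar> \<le> L * dist x y"
proof -
  define L where "L = \<bar>K\<bar> / (1 - t / T)"
  have tT: "1 - t / T > 0" using assms by simp
  then have L: "L \<ge> 0" by (simp add: L_def)
  have "\<bar>w (s, x) - w (s, y)\<bar> \<le> L * dist x y" if s: "s \<in> {0..t}" for s x y
  proof -
    have "norm (w (s, x) - w (s, y)) \<le> L * norm (x - y)"
    proof (rule differentiable_bound[of UNIV "\<lambda>x. w (s, x)" "\<lambda>x v. w\<^sub>1 (s, x) * fst v"])
      fix x :: plane
      have "(s, x) \<in> V" using V(2) s assms by auto
      have "((\<lambda>x. w (s, x)) has_derivative (\<lambda>v. w\<^sub>1 (s, x) * (fst (snd (0::real, v)) - (c + (1 + \<theta>) * w (s, x)) * fst (0::real, v)))) (at x)"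
        by (rule has_derivative_compose[where f="\<lambda>x. (s, x)" and g=w, OF _ dw[OF \<open>(s, x) \<in> V\<close>]])
           (auto intro!: derivative_eq_intros)
      then show "((\<lambda>x. w (s, x)) has_derivative (\<lambda>v. w\<^sub>1 (s, x) * fst v)) (at x within UNIV)" by simp
      have "\<bar>w\<^sub>1 (s, x)\<bar> \<le> K / (1 - s / T)" using w\<^sub>1_le s assms by auto
      also have "\<dots> \<le> \<bar>K\<bar> / (1 - t / T)"
        using s T tT by (intro frac_le) (auto simp: divide_right_mono)
      finally have w1: "\<bar>w\<^sub>1 (s, x)\<bar> \<le> L" by (simp add: L_def)
      show "onorm (\<lambda>v::plane. w\<^sub>1 (s, x) * fst v) \<le> L"
      proof (rule onorm_bound[OF L])
        show "norm (w\<^sub>1 (s, x) * fst v) \<le> L * norm v" for v :: plane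
          using w1 L norm_fst_le[of "fst v" "snd v"] by (simp add: abs_mult mult_mono)
      qed
    qed auto
    then show ?thesis by (simp add: dist_norm)
  qed
  with L show thesis by (rule that)
qed

lemma compact_slice:
  assumes "0 \<le> t" "t < T"
  shows "compact (slice D t)"
proof -
  obtain L where L: "L \<ge> 0" "\<And>s x y. s \<in> {0..t} \<Longrightarrow> \<bar>w (s, x) - w (s, y)\<bar> \<le> L * dist x y"
    using w_lipschitz[OF assms] by metis
  have sub: "{0..t} \<times> UNIV \<subseteq> V" using V(2) assms by auto
  have cw: "continuous_on ({0..t} \<times> UNIV) w"
    by (rule continuous_on_subset[OF C_k_on_imp_continuous_on[OF wk] sub])
  have "closed (slice D t)"
    unfolding D_def
  proof (rule closed_slice_domain_of_dependence[where c="\<lambda>p. c + \<theta> * w p" and L="(1 + \<theta>) * L" and l="c / 2", OF assms])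
    show "(1 + \<theta>) * L \<ge> 0" using L(1) \<theta> by simp
    show "closed (initial_region A \<gamma> \<eta> T)" by (simp add: initial_region_eq)
    show "c + \<theta> * w p = sound_speed A \<gamma> (\<rho> p) (S p)" for p by (simp add: sound_speed_eq)
    show "continuous_on ({0..t} \<times> UNIV) u" unfolding u_def[abs_def] by (intro continuous_intros cw)
    show "continuous_on ({0..t} \<times> UNIV) (\<lambda>p. c + \<theta> * w p)" by (intro continuous_intros cw)
    show "c / 2 > 0" using c by simp
    show "c / 2 \<le> c + \<theta> * w (s, x)" for s x using \<theta>w_small[of "(s, x)"] by linarith
    fix s and x y :: plane assume s: "s \<in> {0..t}"
    have d: "0 \<le> L * dist x y" "0 \<le> \<theta> * (L * dist x y)" using L(1) \<theta> by simp_all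
    have "norm (u (s, x) - u (s, y)) \<le> L * dist x y" using L(2)[OF s, of x y] by (simp add: u_def norm_Pair)
    also have "\<dots> \<le> (1 + \<theta>) * L * dist x y" using d by (simp add: algebra_simps)
    finally show "norm (u (s, x) - u (s, y)) \<le> (1 + \<theta>) * L * dist x y" .
    have "\<bar>c + \<theta> * w (s, x) - (c + \<theta> * w (s, y))\<bar> = \<theta> * \<bar>w (s, x) - w (s, y)\<bar>"
      using \<theta> by (simp add: abs_mult flip: right_diff_distrib)
    also have "\<dots> \<le> \<theta> * (L * dist x y)" using L(2)[OF s] \<theta> by (intro mult_left_mono) auto
    also have "\<dots> \<le> (1 + \<theta>) * L * dist x y" using d by (simp add: algebra_simps)
    finally show "\<bar>c + \<theta> * w (s, x) - (c + \<theta> * w (s, y))\<bar> \<le> (1 + \<theta>) * L * dist x y" .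
  qed
  moreover have "bounded (slice D t)"
    by (rule bounded_subset[OF bounded_cball[of x\<^sub>0 "c * T + \<eta>"]])
       (use D_subset in \<open>auto simp: slice_def initial_region_eq[symmetric]\<close>)
  ultimately show ?thesis by (simp add: compact_eq_bounded_closed)
qed

text \<open>On the linear part of the profile the characteristic with foot 2 \<eta> + e is at 2
  \<eta> + c t + e (1 - t / T) at time t; all these lines meet at T. Solving d = e (1 - t / T) for e
  gives w and its derivative explicitly.\<close>

lemma focusing_part:
  assumes t: "0 \<le> t" "t < T" and d: "\<bar>d\<bar> < \<eta> / 8 * (1 - t / T)"
  shows "w (t, (2 * \<eta> + c * t + d, x\<^sub>2)) = - d / ((1 + \<theta>) * (T - t))"
    and "w\<^sub>1 (t, (2 * \<eta> + c * t + d, x\<^sub>2)) = - 1 / ((1 + \<theta>) * (T - t))"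
proof -
  define e where "e = d / (1 - t / T)"
  have tT: "1 - t / T > 0" using t by simp
  have e: "\<bar>e\<bar> < \<eta> / 8" using d tT by (simp add: e_def abs_divide pos_divide_less_eq)
  have F': "deriv F z = - 1" if "\<bar>z\<bar> < 1" for z
  proof -
    have "((\<lambda>z. - z) has_real_derivative - 1) (at z)" by (auto intro!: derivative_eq_intros)
    then have "(F has_real_derivative - 1) (at z)"
    proof (rule has_field_derivative_transform_within_open)
      show "open {x::real. \<bar>x\<bar> < 1}" by (intro open_Collect_less continuous_intros)
    qed (use that F(2) in auto)
    then show ?thesis by (rule DERIV_imp_deriv)
  qed
  have z: "\<bar>e / (\<eta> / 8)\<bar> < 1" using e \<eta> by (simp add: abs_divide field_simps)
  have w0: "(1 + \<theta>) * w\<^sub>0 (2 * \<eta> + e) = - e / T"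
  proof -
    have "(1 + \<theta>) * w\<^sub>0 (2 * \<eta> + e) = - ((1 + \<theta>) * (a * (8 / \<eta>))) * e"
      using F(2)[of "e / (\<eta> / 8)"] z by (simp add: w\<^sub>0_eq)
    then show ?thesis unfolding slope by simp
  qed
  have w0': "(1 + \<theta>) * deriv w\<^sub>0 (2 * \<eta> + e) = - 1 / T"
    using F'[OF z] slope by (simp add: deriv_w\<^sub>0)
  have pos: "2 * \<eta> + e + t * (c + (1 + \<theta>) * w\<^sub>0 (2 * \<eta> + e)) = 2 * \<eta> + c * t + d"
  proof -
    have "1 - t / T \<noteq> 0" using tT by linarith
    then have "e * (1 - t / T) = d" using e_def nonzero_eq_divide_eq by blast
    then show ?thesis unfolding w0 by (simp add: algebra_simps)
  qed
  have m: "1 + \<theta> > 0" using \<theta> by simp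
  have TT: "T * (1 - t / T) = T - t" using T by (simp add: field_simps)
  have "w (t, (2 * \<eta> + c * t + d, x\<^sub>2)) = w\<^sub>0 (2 * \<eta> + e)"
    using w_char[OF t, of "2 * \<eta> + e" x\<^sub>2] unfolding pos .
  also have "\<dots> = (- e / T) / (1 + \<theta>)" using m unfolding w0[symmetric] by simp
  also have "\<dots> = - d / ((1 + \<theta>) * (T * (1 - t / T)))" by (simp add: e_def)
  finally show "w (t, (2 * \<eta> + c * t + d, x\<^sub>2)) = - d / ((1 + \<theta>) * (T - t))" unfolding TT .
  have "w\<^sub>1 (t, (2 * \<eta> + c * t + d, x\<^sub>2)) = deriv w\<^sub>0 (2 * \<eta> + e) / (1 + t * ((1 + \<theta>) * deriv w\<^sub>0 (2 * \<eta> + e)))"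
    using w\<^sub>1_char[OF t, of "2 * \<eta> + e" x\<^sub>2] unfolding pos by (simp add: mult.assoc)
  also have "deriv w\<^sub>0 (2 * \<eta> + e) = (- 1 / T) / (1 + \<theta>)" using m unfolding w0'[symmetric] by simp
  also have "(- 1 / T) / (1 + \<theta>) / (1 + t * ((1 + \<theta>) * ((- 1 / T) / (1 + \<theta>)))) = - 1 / ((1 + \<theta>) * (T * (1 - t / T)))"
    using m by simp
  finally show "w\<^sub>1 (t, (2 * \<eta> + c * t + d, x\<^sub>2)) = - 1 / ((1 + \<theta>) * (T - t))" unfolding TT .
qed

text \<open>The margin \<eta> of the disc is spent as \<eta> / 8 on d, \<eta> / 2 on x2 and \<eta> /
  4 on the excess speed.\<close>

lemma focusing_part_in_cone:
  assumes t: "0 \<le> t" "t < T" and d: "\<bar>d\<bar> < \<eta> / 8 * (1 - t / T)" "\<bar>x\<^sub>2\<bar> \<le> \<eta> / 2"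
  shows "dist (2 * \<eta> + c * t + d, x\<^sub>2) x\<^sub>0 < c * T + \<eta> - (c + \<eta> / (4 * T)) * t"
proof -
  have "dist (2 * \<eta> + c * t + d, x\<^sub>2) x\<^sub>0 \<le> \<bar>c * (t - T) + d\<bar> + \<bar>x\<^sub>2\<bar>"
    unfolding x\<^sub>0_def dist_Pair_Pair dist_real_def
    using sqrt_sum_squares_le_sum_abs[of "\<bar>2 * \<eta> + c * t + d - (c * T + 2 * \<eta>)\<bar>" "\<bar>x\<^sub>2 - 0\<bar>"]
    by (simp add: algebra_simps)
  also have "\<dots> \<le> \<bar>c * (t - T)\<bar> + \<bar>d\<bar> + \<bar>x\<^sub>2\<bar>" by linarith
  also have "\<bar>c * (t - T)\<bar> = c * (T - t)" using c t by (simp add: abs_mult)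
  also have "\<bar>d\<bar> < \<eta> / 8"
  proof -
    have "\<eta> / 8 * (1 - t / T) \<le> \<eta> / 8 * 1" using t \<eta> T by (intro mult_left_mono) auto
    then show ?thesis using d by simp
  qed
  finally have "dist (2 * \<eta> + c * t + d, x\<^sub>2) x\<^sub>0 < c * (T - t) + \<eta> / 8 + \<eta> / 2" using d(2) by linarith
  moreover have "\<eta> / (4 * T) * t \<le> \<eta> / 4" using t \<eta> T by (simp add: field_simps)
  ultimately show ?thesis using \<eta> by (simp add: algebra_simps)
qed

end

section \<open>Blow-up of the focusing wave\<close>

text \<open>Compactness of K makes the integrand integrable, without which the norm would be 0 by
  convention; only then may the integral be restricted to a box.\<close>

lemma H1_norm_ge:
  fixes f :: "plane \<Rightarrow> real"
  assumes K: "compact K" and df: "\<And>x. (f has_derivative (\<lambda>v. g x * fst v)) (at x)"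
    and cg: "continuous_on K g" and box: "cbox a b \<subseteq> K" and k: "k \<ge> 0" "\<And>x. x \<in> cbox a b \<Longrightarrow> k \<le> \<bar>g x\<bar>"
  shows "sqrt (k\<^sup>2 * measure lborel (cbox a b)) \<le> H1_norm K f"
proof -
  have fr: "frechet_derivative f (at x) = (\<lambda>v. g x * fst v)" for x
    using frechet_derivative_at[OF df[of x]] by simp
  have cf: "continuous_on K f"
    using df has_derivative_continuous by (metis continuous_at_imp_continuous_on)
  have i: "set_integrable lborel K (\<lambda>x. (f x)\<^sup>2 + (g x)\<^sup>2)"
    unfolding set_integrable_def by (rule borel_integrable_compact[OF K]) (intro continuous_intros cf cg)
  have "k\<^sup>2 * measure lborel (cbox a b) = (LINT x:cbox a b|lborel. k\<^sup>2)"
    by (simp add: set_lebesgue_integral_def)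
  also have "\<dots> \<le> (LINT x:K|lborel. (f x)\<^sup>2 + (g x)\<^sup>2)"
    unfolding set_lebesgue_integral_def
  proof (rule integral_mono)
    show "integrable lborel (\<lambda>x. indicat_real (cbox a b) x *\<^sub>R k\<^sup>2)"
      by (rule borel_integrable_compact) auto
    show "integrable lborel (\<lambda>x. indicat_real K x *\<^sub>R ((f x)\<^sup>2 + (g x)\<^sup>2))"
      using i unfolding set_integrable_def .
    fix x
    show "indicat_real (cbox a b) x *\<^sub>R k\<^sup>2 \<le> indicat_real K x *\<^sub>R ((f x)\<^sup>2 + (g x)\<^sup>2)"
    proof (cases "x \<in> cbox a b")
      case True
      then have "k\<^sup>2 \<le> (g x)\<^sup>2" using k by (metis abs_le_square_iff abs_of_nonneg)
      then show ?thesis using True box by (auto simp: add_increasing)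
    qed simp
  qed
  finally show ?thesis unfolding H1_norm_def fr by simp
qed

lemma filterlim_sqrt_inverse_at_left:
  assumes "Q > 0"
  shows "filterlim (\<lambda>t. sqrt (Q / (T - t))) at_top (at_left (T :: real))"
proof -
  have "((\<lambda>t. T - t) \<longlongrightarrow> T - T) (at_left T)" by (intro tendsto_intros)
  then have "filterlim (\<lambda>t. T - t) (at_right 0) (at_left T)"
    unfolding filterlim_at by (auto simp: eventually_at_filter)
  from filterlim_compose[OF filterlim_inverse_at_top_right this]
  have "filterlim (\<lambda>t. Q * inverse (T - t)) at_top (at_left T)"
    by (rule filterlim_tendsto_pos_mult_at_top[OF tendsto_const assms])
  from filterlim_compose[OF sqrt_at_top this] show ?thesis by (simp add: divide_inverse)
qed

context focusing_solution
begin

lemma slab_time: "eventually (\<lambda>t. 0 \<le> t \<and> t < T) (at_left T)"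
  using eventually_at_left_real[OF T] by eventually_elim auto

lemma dw_slice:
  assumes "0 \<le> t" "t < T"
  shows "((\<lambda>x. w (t, x)) has_derivative (\<lambda>v. w\<^sub>1 (t, x) * fst v)) (at x)"
proof -
  have p: "(t, x) \<in> V" using V(2) assms by auto
  have "((\<lambda>x. w (t, x)) has_derivative (\<lambda>v. w\<^sub>1 (t, x) * (fst (snd (0::real, v)) - (c + (1 + \<theta>) * w (t, x)) * fst (0::real, v)))) (at x)"
    by (rule has_derivative_compose[where f="\<lambda>x. (t, x)" and g=w, OF _ dw[OF p]]) (auto intro!: derivative_eq_intros)
  then show ?thesis by simp
qed

lemma continuous_w\<^sub>1: "continuous_on V w\<^sub>1"
proof -
  have "C_k_on 1 V w" by (rule wk)
  from C_1_on_derivatives(3)[OF this V(1)] have "continuous_on V (D\<^sub>1 w)" .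
  moreover have "D\<^sub>1 w p = w\<^sub>1 p" if "p \<in> V" for p
    using frechet_derivative_at[OF dw[OF that], symmetric] by (simp add: D\<^sub>1_def)
  ultimately show ?thesis by (simp cong: continuous_on_cong)
qed

lemma shock:
  assumes "\<And>p. norm (u p, \<rho> p - 1, S p) \<le> \<kappa>"
  shows "shock_in D T \<kappa> \<rho> u S"
  unfolding shock_in_def
proof (intro conjI ballI allI)
  fix M :: real
  have "filterlim (\<lambda>t. sqrt (1 / (T - t))) at_top (at_left T)" by (rule filterlim_sqrt_inverse_at_left) simp
  then have "eventually (\<lambda>t. max 1 ((1 + \<theta>) * \<bar>M\<bar>) \<le> sqrt (1 / (T - t))) (at_left T)"
    unfolding filterlim_at_top by blast
  with slab_time
  show "\<forall>\<^sub>F t in at_left T. \<exists>x\<in>slice D t. M \<le> onorm (frechet_derivative (\<lambda>p. (\<rho> p, u p, S p)) (at (t, x)))"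
  proof eventually_elim
    case (elim t)
    then have t: "0 \<le> t" "t < T" by auto
    \<comment> \<open>The growth to infinity is available for the square root; as r >= 1, it passes
      to r^2 = 1 / (T - t).\<close>
    define r where "r = sqrt (1 / (T - t))"
    have r: "1 \<le> r" "(1 + \<theta>) * \<bar>M\<bar> \<le> r" using elim by (auto simp: r_def)
    have "r * r = 1 / (T - t)" using t by (simp add: r_def)
    moreover have "1 * r \<le> r * r" using r by (intro mult_right_mono) auto
    ultimately have "(1 + \<theta>) * \<bar>M\<bar> \<le> 1 / (T - t)" using r by linarith
    moreover have "1 + \<theta> > 0" using \<theta> by simp
    ultimately have "\<bar>M\<bar> \<le> 1 / (T - t) / (1 + \<theta>)" by (subst pos_le_divide_eq) (simp_all only: mult.commute)
    then have M: "\<bar>M\<bar> \<le> 1 / ((1 + \<theta>) * (T - t))" by (simp add: mult.commute)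
    define x :: plane where "x = (2 * \<eta> + c * t, 0)"
    have pos: "\<bar>0\<bar> < \<eta> / 8 * (1 - t / T)" using t \<eta> by simp
    have w1: "w\<^sub>1 (t, x) = - 1 / ((1 + \<theta>) * (T - t))"
      using focusing_part(2)[OF t pos, of 0] by (simp add: x_def)
    have "x \<in> slice D t"
      using focusing_part_in_cone[OF t pos, of 0] \<eta>
      by (auto simp: slice_def x_def intro!: cone_subset_D t)
    moreover have "M \<le> onorm (frechet_derivative (\<lambda>p. (\<rho> p, u p, S p)) (at (t, x)))"
    proof -
      have p: "(t, x) \<in> V" using V(2) t by auto
      have "(\<rho> has_derivative frechet_derivative \<rho> (at (t, x))) (at (t, x))"
        by (rule C_k_on_has_derivative[OF smooth_\<rho> V(1) p])
      then have d: "((\<lambda>p. (\<rho> p, u p, S p)) has_derivative (\<lambda>v. (frechet_derivative \<rho> (at (t, x)) v,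
          (w\<^sub>1 (t, x) * (fst (snd v) - (c + (1 + \<theta>) * w (t, x)) * fst v), 0), 0))) (at (t, x))" (is "(_ has_derivative ?f) _")
        unfolding u_def by (intro has_derivative_Pair dw[OF p] has_derivative_const)
      \<comment> \<open>Testing the derivative in the x1 direction isolates the slope of the first
        velocity component.\<close>
      define e :: spacetime where "e = (0, 1, 0)"
      have "norm (?f e) \<le> onorm ?f * norm e" by (rule onorm[OF has_derivative_bounded_linear[OF d]])
      moreover have "norm e = 1" by (simp add: e_def norm_Pair)
      moreover have "\<bar>w\<^sub>1 (t, x)\<bar> \<le> norm (?f e)"
        using norm_snd_le[of "(w\<^sub>1 (t, x), 0 :: real)" "frechet_derivative \<rho> (at (t, x)) e"]
        by (simp add: e_def norm_Pair)
      ultimately have "\<bar>w\<^sub>1 (t, x)\<bar> \<le> onorm ?f" by simp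
      then show ?thesis
        using M \<theta> t unfolding frechet_derivative_at[OF d, symmetric] w1 by (simp add: abs_mult)
    qed
    ultimately show ?case by blast
  qed
qed (rule assms)

text \<open>The focusing strip has width proportional to T - t, while the squared slope grows like
  (T - t)^(-2); the integral is at least of order 1 / (T - t). The chain rule factor b lets one
  estimate serve velocity and density.\<close>

lemma H1_norm_slice_ge:
  assumes t: "0 \<le> t" "t < T"
    and df: "\<And>x. (f has_derivative (\<lambda>v. b x * w\<^sub>1 (t, x) * fst v)) (at x)"
    and cb: "continuous_on UNIV b" and k: "k > 0" "\<And>x. k \<le> b x"
  shows "sqrt (k\<^sup>2 * \<eta>\<^sup>2 / (8 * T * (1 + \<theta>)\<^sup>2) / (T - t)) \<le> H1_norm (slice D t) f"
proof -
  \<comment> \<open>Half of the admissible half width, so that a closed box satisfies the strict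
    inequality of \<open>focusing_part\<close>.\<close>
  define d where "d = \<eta> / 16 * (1 - t / T)"
  have d: "d > 0" using t \<eta> by (simp add: d_def)
  let ?p = "(2 * \<eta> + c * t - d, - (\<eta> / 2)) :: plane" and ?q = "(2 * \<eta> + c * t + d, \<eta> / 2) :: plane"
  have box: "\<exists>s y. x = (2 * \<eta> + c * t + s, y) \<and> \<bar>s\<bar> < \<eta> / 8 * (1 - t / T) \<and> \<bar>y\<bar> \<le> \<eta> / 2" if "x \<in> cbox ?p ?q" for x
  proof (intro exI conjI)
    show "x = (2 * \<eta> + c * t + (fst x - 2 * \<eta> - c * t), snd x)" by (cases x) simp
    have "\<bar>fst x - 2 * \<eta> - c * t\<bar> \<le> d" using that by (cases x) (auto simp: cbox_Pair_eq abs_le_iff)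
    also have "d < \<eta> / 8 * (1 - t / T)" using d by (simp add: d_def)
    finally show "\<bar>fst x - 2 * \<eta> - c * t\<bar> < \<eta> / 8 * (1 - t / T)" .
    show "\<bar>snd x\<bar> \<le> \<eta> / 2" using that by (cases x) (auto simp: cbox_Pair_eq abs_le_iff)
  qed
  have "sqrt ((k / ((1 + \<theta>) * (T - t)))\<^sup>2 * measure lborel (cbox ?p ?q)) \<le> H1_norm (slice D t) f"
  proof (rule H1_norm_ge[OF compact_slice[OF t] df])
    have "continuous_on UNIV (\<lambda>x. w\<^sub>1 (t, x))"
      by (rule continuous_on_compose2[OF continuous_w\<^sub>1]) (use V(2) t in \<open>auto intro!: continuous_intros\<close>)
    then show "continuous_on (slice D t) (\<lambda>x. b x * w\<^sub>1 (t, x))"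
      by (rule continuous_on_mult[OF continuous_on_subset[OF cb subset_UNIV] continuous_on_subset[OF _ subset_UNIV]])
    show "cbox ?p ?q \<subseteq> slice D t"
    proof
      fix x assume "x \<in> cbox ?p ?q"
      from box[OF this] have "dist x x\<^sub>0 < c * T + \<eta> - (c + \<eta> / (4 * T)) * t"
        using focusing_part_in_cone[OF t] by blast
      from cone_subset_D[OF t less_imp_le[OF this]] show "x \<in> slice D t" by (simp add: slice_def)
    qed
    show "0 \<le> k / ((1 + \<theta>) * (T - t))" using k \<theta> t by simp
    fix x assume "x \<in> cbox ?p ?q"
    then have "w\<^sub>1 (t, x) = - 1 / ((1 + \<theta>) * (T - t))" using box focusing_part(2)[OF t] by blast
    moreover have "k / ((1 + \<theta>) * (T - t)) \<le> b x / ((1 + \<theta>) * (T - t))"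
      using k(2) \<theta> t by (intro divide_right_mono) auto
    moreover have "b x > 0" using k(1) k(2)[of x] by linarith
    ultimately show "k / ((1 + \<theta>) * (T - t)) \<le> \<bar>b x * w\<^sub>1 (t, x)\<bar>"
      using \<theta> t by (simp add: abs_mult)
  qed
  also have "measure lborel (cbox ?p ?q) = \<eta>\<^sup>2 * (T - t) / (8 * T)"
    using d \<eta> T by (simp add: content_Pair d_def field_simps power2_eq_square)
  also have "(k / ((1 + \<theta>) * (T - t)))\<^sup>2 * (\<eta>\<^sup>2 * (T - t) / (8 * T)) = k\<^sup>2 * \<eta>\<^sup>2 / (8 * T * (1 + \<theta>)\<^sup>2) / (T - t)"
    using t \<theta> by (simp add: power2_eq_square divide_simps)
  finally show ?thesis .
qed

lemma H1_blowup:
  assumes "k > 0" "\<And>t x. 0 \<le> t \<Longrightarrow> t < T \<Longrightarrow> ((\<lambda>x. f (t, x)) has_derivative (\<lambda>v. b (t, x) * w\<^sub>1 (t, x) * fst v)) (at x)"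
    and "continuous_on V b" "\<And>p. k \<le> b p"
  shows "filterlim (\<lambda>t. H1_norm (slice D t) (\<lambda>x. f (t, x))) at_top (at_left T)"
proof (rule filterlim_at_top_mono)
  show "filterlim (\<lambda>t. sqrt (k\<^sup>2 * \<eta>\<^sup>2 / (8 * T * (1 + \<theta>)\<^sup>2) / (T - t))) at_top (at_left T)"
    by (rule filterlim_sqrt_inverse_at_left) (use assms(1) \<eta> T \<theta> in simp)
  show "\<forall>\<^sub>F t in at_left T. sqrt (k\<^sup>2 * \<eta>\<^sup>2 / (8 * T * (1 + \<theta>)\<^sup>2) / (T - t)) \<le> H1_norm (slice D t) (\<lambda>x. f (t, x))"
    using slab_time
  proof eventually_elim
    case (elim t)
    then have t: "0 \<le> t" "t < T" by auto
    show ?case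
    proof (rule H1_norm_slice_ge[OF t, where b="\<lambda>x. b (t, x)"])
      show "continuous_on UNIV (\<lambda>x. b (t, x))"
        by (rule continuous_on_compose2[OF assms(3)]) (use V(2) t in \<open>auto intro!: continuous_intros\<close>)
    qed (use assms t in auto)
  qed
qed

lemma H1_blowup_velocity: "filterlim (\<lambda>t. H1_norm (slice D t) (\<lambda>x. fst (u (t, x)))) at_top (at_left T)"
  unfolding u_def fst_conv
  by (rule H1_blowup[where k=1 and b="\<lambda>_. 1"]) (use dw_slice in auto)

lemma H1_blowup_density: "filterlim (\<lambda>t. H1_norm (slice D t) (\<lambda>x. \<rho> (t, x))) at_top (at_left T)"
\<comment> \<open>Since 1 + \<theta> w / c >= 1/2, the density is at least (1/2)^(1/\<theta>); the
  sound speed is at most 2 c.\<close>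
proof (rule H1_blowup[where k="(1 / 2) powr (1 / \<theta>) / (2 * c)" and b="\<lambda>p. \<rho> p / (c + \<theta> * w p)"])
  show "(1 / 2) powr (1 / \<theta>) / (2 * c) > 0" using c by simp
  have cw: "0 < c + \<theta> * w p" "c + \<theta> * w p \<le> 2 * c" for p using \<theta>w_small[of p] c by linarith+
  show "continuous_on V (\<lambda>p. \<rho> p / (c + \<theta> * w p))"
  proof (intro continuous_intros)
    show "continuous_on V \<rho>" "continuous_on V w" by (rule C_k_on_imp_continuous_on, rule smooth_\<rho> wk)+
    show "\<forall>p\<in>V. c + \<theta> * w p \<noteq> 0" using cw(1) by (metis less_irrefl)
  qed
  show "(1 / 2) powr (1 / \<theta>) / (2 * c) \<le> \<rho> p / (c + \<theta> * w p)" for p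
  proof (rule frac_le)
    show "(1 / 2) powr (1 / \<theta>) \<le> \<rho> p"
      unfolding \<rho>_def wave_density_def by (rule powr_mono2) (use \<theta> density_base in auto)
  qed (use cw \<rho>_pos[of p] in \<open>auto simp: less_imp_le\<close>)
  show "((\<lambda>x. \<rho> (t, x)) has_derivative (\<lambda>v. \<rho> (t, x) / (c + \<theta> * w (t, x)) * w\<^sub>1 (t, x) * fst v)) (at x)"
    if "0 \<le> t" "t < T" for t x
    using wave_density_has_derivative[OF \<theta> c density_base_pos dw_slice[OF that]]
    by (simp add: \<rho>_def wave_density_def mult.assoc)
qed

lemma no_smooth_continuation:
  assumes T': "T' > T" and sol: "cauchy_solution A \<gamma> T' r\<^sub>0 v\<^sub>0 s\<^sub>0 \<rho>' u' S'"
    and data: "\<And>x. x \<in> initial_region A \<gamma> \<eta> T \<Longrightarrow> r\<^sub>0 x = \<rho> (0, x) \<and> v\<^sub>0 x = u (0, x) \<and> s\<^sub>0 x = 0"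
  shows False
proof -
  obtain V' where V': "open V'" "slab T' \<subseteq> V'" "\<And>k. C_k_on k V' (\<lambda>p. (\<rho>' p, u' p, S' p))"
    using sol unfolding cauchy_solution_def smooth_fields_on_def smooth_on_def by blast
  have pos': "\<rho>' p > 0" if "p \<in> slab T'" for p
    using sol that unfolding cauchy_solution_def smooth_fields_on_def by blast
  have k': "C_k_on k V' \<rho>'" "C_k_on k V' u'" "C_k_on k V' S'" for k
    using C_k_on_compose_linear[OF bounded_linear_fst V'(1) V'(3)]
      C_k_on_compose_linear[OF bounded_linear_fst V'(1) C_k_on_compose_linear[OF bounded_linear_snd V'(1) V'(3)]]
      C_k_on_compose_linear[OF bounded_linear_snd V'(1) C_k_on_compose_linear[OF bounded_linear_snd V'(1) V'(3)]]
    by simp_all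
  have ini: "\<rho>' (0, x) = r\<^sub>0 x \<and> u' (0, x) = v\<^sub>0 x \<and> S' (0, x) = s\<^sub>0 x" for x
    using sol unfolding cauchy_solution_def by blast
  \<comment> \<open>Positivity of the density is given on the slab only, whereas the uniqueness
    lemma asks for it on an open set; continuity supplies one.\<close>
  define P where "P = V' \<inter> \<rho>' -` {0<..}"
  have P: "open P" unfolding P_def
    by (intro continuous_open_preimage C_k_on_imp_continuous_on[OF k'(1)] V') auto
  \<comment> \<open>Uniqueness is applied on [0, t] for each t < T separately, since the wave is
    smooth only before T.\<close>
  have agree: "fst (u' (t, x)) = w (t, x)"
    if t: "0 < t" "t < T" and x: "dist x x\<^sub>0 < c * T + \<eta> - (c + \<eta> / (4 * T)) * t" for t x
  proof -
    have "fst (u' (t, x)) = fst (u (t, x))"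
    proof (rule euler_local_uniqueness[where V="V \<inter> P" and \<rho>=\<rho> and \<rho>'=\<rho>' and S'=S' and t\<^sub>1=t and r="c * T + \<eta>"
          and M="c + \<eta> / (4 * T)" and x\<^sub>0=x\<^sub>0 and A=A and \<gamma>=\<gamma>])
      show "0 \<le> c + \<eta> / (4 * T)" using c \<eta> T by simp
      show "0 < c * T + \<eta> - (c + \<eta> / (4 * T)) * t" using x zero_le_dist[of x x\<^sub>0] by linarith
      show "open (V \<inter> P)" using V P by blast
      have sub: "{0..t} \<times> UNIV \<subseteq> slab T" "{0..t} \<times> UNIV \<subseteq> slab T'" using t T' by auto
      then show "{0..t} \<times> UNIV \<subseteq> V \<inter> P"
        using V(2) V'(2) pos' by (auto simp: P_def subset_iff)
      show "C_k_on 1 (V \<inter> P) \<rho>" "C_k_on 1 (V \<inter> P) u"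
        by (rule C_k_on_subset[OF _ Int_lower1], rule smooth_\<rho> smooth_u)+
      show "C_k_on 1 (V \<inter> P) \<rho>'" "C_k_on 1 (V \<inter> P) u'" "C_k_on 1 (V \<inter> P) S'"
        by (rule C_k_on_subset, rule k', simp add: P_def le_infI2)+
      show "\<rho> p > 0" for p by (rule \<rho>_pos)
      show "\<rho>' p > 0" if "p \<in> V \<inter> P" for p using that by (simp add: P_def)
      show "euler_on A \<gamma> ({0..t} \<times> UNIV) \<rho> u (\<lambda>_. 0)" using euler sub(1) V(2) unfolding euler_on_def by blast
      show "euler_on A \<gamma> ({0..t} \<times> UNIV) \<rho>' u' S'"
        using sol sub(2) unfolding cauchy_solution_def euler_on_def by blast
      show "norm (u p) + sound_speed A \<gamma> (\<rho> p) 0 \<le> c + \<eta> / (4 * T)" for p by (rule speed_le)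
      show "\<rho>' (0, x) = \<rho> (0, x) \<and> u' (0, x) = u (0, x) \<and> S' (0, x) = 0" if "dist x x\<^sub>0 \<le> c * T + \<eta>" for x
        using data[of x] that ini[of x] by (simp add: initial_region_eq dist_commute)
    qed (use A \<gamma> t x in auto)
    then show ?thesis by (simp add: u_def)
  qed
  define f where "f p = fst (u' p)" for p
  define z :: spacetime where "z = (T, (2 * \<eta> + c * T, 0))"
  have "z \<in> V'" using V'(2) T T' by (auto simp: z_def)
  moreover have "continuous_on V' f"
    unfolding f_def[abs_def] by (intro continuous_intros C_k_on_imp_continuous_on[OF k'(2)])
  ultimately have fz: "isCont f z" using V'(1) continuous_on_eq_continuous_at by blast
  \<comment> \<open>The focus is approached along the characteristics of the linear part, labelled
    by l in (-1, 1). On each of them w has the constant value -l a, so a continuous f would take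
    different values at z.\<close>
  have lim: "((\<lambda>t. f (t, (2 * \<eta> + c * t + l * (\<eta> / 8 * (1 - t / T)), 0))) \<longlongrightarrow> f z) (at_left T)" for l
  proof -
    have "((\<lambda>t. (t, (2 * \<eta> + c * t + l * (\<eta> / 8 * (1 - t / T)), 0::real))) \<longlongrightarrow>
        (T, (2 * \<eta> + c * T + l * (\<eta> / 8 * (1 - T / T)), 0))) (at_left T)"
      using T by (intro tendsto_intros) auto
    then have "((\<lambda>t. (t, (2 * \<eta> + c * t + l * (\<eta> / 8 * (1 - t / T)), 0::real))) \<longlongrightarrow> z) (at_left T)"
      using T by (simp add: z_def)
    from isCont_tendsto_compose[OF fz this] show ?thesis .
  qed
  have val: "eventually (\<lambda>t. f (t, (2 * \<eta> + c * t + l * (\<eta> / 8 * (1 - t / T)), 0)) = - l * a) (at_left T)"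
    if l: "\<bar>l\<bar> < 1" for l
    using eventually_at_left_real[OF T]
  proof eventually_elim
    case (elim t)
    then have t: "0 < t" "t < T" by auto
    let ?d = "l * (\<eta> / 8 * (1 - t / T))"
    have pos: "\<eta> / 8 * (1 - t / T) > 0" using t \<eta> by simp
    have d: "\<bar>?d\<bar> < \<eta> / 8 * (1 - t / T)"
      using mult_strict_right_mono[OF l pos] unfolding abs_mult_pos[OF less_imp_le[OF pos]] mult_1 .
    have "f (t, (2 * \<eta> + c * t + ?d, 0)) = w (t, (2 * \<eta> + c * t + ?d, 0))"
      unfolding f_def by (rule agree[OF t focusing_part_in_cone[OF _ _ d]]) (use t \<eta> in auto)
    also have "\<dots> = - ?d / ((1 + \<theta>) * (T - t))"
      by (rule focusing_part(1)[OF _ _ d]) (use t in auto)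
    also have "- ?d / ((1 + \<theta>) * (T - t)) = - l * a"
    proof -
      have "1 - t / T = (T - t) / T" using T by (simp add: diff_divide_distrib)
      then have "- ?d / ((1 + \<theta>) * (T - t)) = - l * (\<eta> / 8 / T / (1 + \<theta>)) * ((T - t) / (T - t))"
        by simp
      also have "\<eta> / 8 / T / (1 + \<theta>) = a" using \<theta> unfolding a_eq[symmetric] by simp
      finally show ?thesis using t by simp
    qed
    finally show ?case .
  qed
  have "f z = - l * a" if "\<bar>l\<bar> < 1" for l
    by (rule tendsto_unique[OF trivial_limit_at_left_real lim[of l] tendsto_eventually[OF val[OF that]]])
  from this[of 0] this[of "1 / 2"] show False using a by simp
qed

end

section \<open>Sobolev bounds for the data\<close>

text \<open>Here y is a Fourier weight and a its counterpart in frequencies rescaled by \<mu>. The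
  rescaling costs \<mu>^(-2 s), and s <= 2 with a >= 1 permits a^s to be rounded up to a^2.\<close>

lemma powr_weight_le:
  fixes \<mu> s a y :: real
  assumes "0 < \<mu>" "0 \<le> s" "s \<le> 2" "1 \<le> a" "0 \<le> y" "\<mu>\<^sup>2 * y \<le> a"
  shows "y powr s \<le> \<mu> powr (- 2 * s) * a\<^sup>2"
proof -
  have "y \<le> \<mu> powr (- 2) * a"
    using assms by (simp add: powr_minus_divide powr_numeral field_simps)
  then have "y powr s \<le> (\<mu> powr (- 2) * a) powr s" by (rule powr_mono2[OF assms(2,5)])
  also have "\<dots> = \<mu> powr (- 2 * s) * a powr s" using assms by (simp add: powr_mult powr_powr)
  also have "\<dots> \<le> \<mu> powr (- 2 * s) * a powr 2"
    by (intro mult_left_mono powr_mono) (use assms in auto)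
  finally show ?thesis using assms by (simp add: powr_numeral)
qed

text \<open>All s derivatives are charged to the smaller scale \<mu> <= h. The factor h^(-2
  \<epsilon>) >= 1 brings the bound to the form of the anisotropic one, so that both norms share one
  computation.\<close>

lemma isotropic_weight_le:
  assumes "0 < \<mu>" "\<mu> \<le> h" "h \<le> 1" "0 \<le> s" "s \<le> 2" "0 \<le> \<epsilon>"
  shows "isotropic_weight s \<xi> \<le> \<mu> powr (- 2 * s) * h powr (- 2 * \<epsilon>) * ((1 + (\<mu> * fst \<xi>)\<^sup>2)\<^sup>2 * (1 + (h * snd \<xi>)\<^sup>2)\<^sup>2)"
proof -
  let ?a = "1 + (\<mu> * fst \<xi>)\<^sup>2" and ?b = "1 + (h * snd \<xi>)\<^sup>2"
  have "(norm \<xi>)\<^sup>2 = (fst \<xi>)\<^sup>2 + (snd \<xi>)\<^sup>2" by (simp add: norm_prod_def)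
  moreover have "\<mu>\<^sup>2 \<le> 1" "\<mu>\<^sup>2 \<le> h\<^sup>2" using assms by (auto simp: power_le_one power_mono)
  then have "\<mu>\<^sup>2 * (1 + ((fst \<xi>)\<^sup>2 + (snd \<xi>)\<^sup>2)) \<le> 1 + (\<mu> * fst \<xi>)\<^sup>2 + (h * snd \<xi>)\<^sup>2"
    by (simp add: power_mult_distrib distrib_left mult_right_mono add_mono)
  moreover have "1 + (\<mu> * fst \<xi>)\<^sup>2 + (h * snd \<xi>)\<^sup>2 \<le> ?a * ?b" by (simp add: algebra_simps)
  moreover have "1 * 1 \<le> ?a * ?b" by (intro mult_mono) auto
  ultimately have "isotropic_weight s \<xi> \<le> \<mu> powr (- 2 * s) * (?a * ?b)\<^sup>2"
    unfolding isotropic_weight_def using assms by (intro powr_weight_le) auto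
  also have "\<dots> = \<mu> powr (- 2 * s) * 1 * (?a\<^sup>2 * ?b\<^sup>2)" by (simp add: power_mult_distrib)
  also have "\<dots> \<le> \<mu> powr (- 2 * s) * h powr (- 2 * \<epsilon>) * (?a\<^sup>2 * ?b\<^sup>2)"
  proof (intro mult_right_mono mult_left_mono)
    show "1 \<le> h powr (- 2 * \<epsilon>)" using assms powr_mono2'[of "- 2 * \<epsilon>" h 1] by simp
  qed auto
  finally show ?thesis .
qed

lemma anisotropic_weight_le:
  assumes "0 < \<mu>" "\<mu> \<le> 1" "0 < h" "h \<le> 1" "0 \<le> s" "s \<le> 2" "0 \<le> \<epsilon>" "\<epsilon> \<le> 2"
  shows "anisotropic_weight s \<epsilon> \<xi> \<le> \<mu> powr (- 2 * s) * h powr (- 2 * \<epsilon>) * ((1 + (\<mu> * fst \<xi>)\<^sup>2)\<^sup>2 * (1 + (h * snd \<xi>)\<^sup>2)\<^sup>2)"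
proof -
  have *: "r\<^sup>2 * (1 + x\<^sup>2) \<le> 1 + (r * x)\<^sup>2" if "0 < r" "r \<le> 1" for r x :: real
    using that by (simp add: power_mult_distrib distrib_left power_le_one)
  have "(1 + (fst \<xi>)\<^sup>2) powr s \<le> \<mu> powr (- 2 * s) * (1 + (\<mu> * fst \<xi>)\<^sup>2)\<^sup>2"
    using assms * by (intro powr_weight_le) auto
  moreover have "(1 + (snd \<xi>)\<^sup>2) powr \<epsilon> \<le> h powr (- 2 * \<epsilon>) * (1 + (h * snd \<xi>)\<^sup>2)\<^sup>2"
    using assms * by (intro powr_weight_le) auto
  ultimately have "anisotropic_weight s \<epsilon> \<xi> \<le> (\<mu> powr (- 2 * s) * (1 + (\<mu> * fst \<xi>)\<^sup>2)\<^sup>2) * (h powr (- 2 * \<epsilon>) * (1 + (h * snd \<xi>)\<^sup>2)\<^sup>2)"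
    unfolding anisotropic_weight_def by (intro mult_mono) auto
  then show ?thesis by (simp add: mult_ac)
qed

lemma borel_measurable_weights:
  "isotropic_weight s \<in> borel_measurable borel" "anisotropic_weight s \<epsilon> \<in> borel_measurable borel"
proof -
  have "1 + (norm (\<xi> :: plane))\<^sup>2 \<noteq> 0" "1 + (fst (\<xi> :: plane))\<^sup>2 \<noteq> 0" "1 + (snd (\<xi> :: plane))\<^sup>2 \<noteq> 0" for \<xi>
    by (metis add_pos_nonneg less_irrefl zero_le_power2 zero_less_one)+
  then show "isotropic_weight s \<in> borel_measurable borel" "anisotropic_weight s \<epsilon> \<in> borel_measurable borel"
    unfolding isotropic_weight_def[abs_def] anisotropic_weight_def[abs_def]
    by (auto intro!: borel_measurable_continuous_onI continuous_intros)
qed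

lemma sobolev_real:
  fixes \<phi> :: "plane \<Rightarrow> real"
  shows "in_sobolev W \<phi> \<longleftrightarrow> integrable lborel \<phi> \<and> integrable lborel (\<lambda>\<xi>. W \<xi> * (cmod (fourier \<phi> \<xi>))\<^sup>2)"
    and "sobolev_norm W \<phi> = sqrt (LINT \<xi>|lborel. W \<xi> * (cmod (fourier \<phi> \<xi>))\<^sup>2)"
  by (simp_all add: in_sobolev_def sobolev_norm_def)

lemma sobolev_first_component:
  fixes \<phi> :: "plane \<Rightarrow> real"
  shows "in_sobolev W \<phi> \<Longrightarrow> in_sobolev W (\<lambda>x. (\<phi> x, 0 :: real))"
    and "sobolev_norm W (\<lambda>x. (\<phi> x, 0 :: real)) = sobolev_norm W \<phi>"
proof -
  have basis: "(Basis :: plane set) = {(1, 0), (0, 1)}" by (auto simp: Basis_prod_def)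
  have 0: "fourier (\<lambda>_. 0) \<xi> = 0" for \<xi> by (simp add: fourier_def)
  show "in_sobolev W (\<lambda>x. (\<phi> x, 0 :: real))" if "in_sobolev W \<phi>"
  proof -
    have "integrable lborel \<phi>" using that by (simp add: sobolev_real)
    then have "integrable lborel (\<lambda>x. \<phi> x *\<^sub>R (1 :: real, 0 :: real))" by (rule integrable_scaleR_left)
    then show ?thesis using that by (simp add: in_sobolev_def basis 0)
  qed
  show "sobolev_norm W (\<lambda>x. (\<phi> x, 0 :: real)) = sobolev_norm W \<phi>"
    by (simp add: sobolev_norm_def basis 0)
qed

lemma sobolev_zero: "in_sobolev W (\<lambda>_. 0 :: real)" "sobolev_norm W (\<lambda>_. 0 :: real) = 0"
  by (simp_all add: sobolev_real fourier_def)

text \<open>One constant for all small amplitudes: G(a F) is O(a) together with its third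
  derivative, as if G were linear. This treats the density, a nonlinear function of the velocity, on
  the same footing as the velocity, where G is the identity.\<close>

definition amplitude_bound :: "(real \<Rightarrow> real) \<Rightarrow> (real \<Rightarrow> real) \<Rightarrow> real \<Rightarrow> real \<Rightarrow> bool" where
  "amplitude_bound F G r B \<longleftrightarrow> B \<ge> 0 \<and> (\<forall>z. \<bar>z\<bar> \<le> r \<longrightarrow> \<bar>G z\<bar> \<le> B * \<bar>z\<bar>) \<and>
    (\<forall>a. 0 < a \<longrightarrow> a \<le> 1 \<longrightarrow> 2 * a \<le> r \<longrightarrow>
      (\<forall>k. C_k_on k UNIV (\<lambda>z. G (a * F z))) \<and> (\<forall>z. \<bar>G (a * F z)\<bar> \<le> B * a) \<and>
      (\<forall>z. \<bar>deriv (deriv (deriv (\<lambda>z. G (a * F z)))) z\<bar> \<le> B * a))"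

lemma amplitude_boundD:
  assumes "amplitude_bound F G r B"
  shows "B \<ge> 0" "\<bar>z\<bar> \<le> r \<Longrightarrow> \<bar>G z\<bar> \<le> B * \<bar>z\<bar>"
    "0 < a \<Longrightarrow> a \<le> 1 \<Longrightarrow> 2 * a \<le> r \<Longrightarrow> \<bar>G (a * F z)\<bar> \<le> B * a"
    "0 < a \<Longrightarrow> a \<le> 1 \<Longrightarrow> 2 * a \<le> r \<Longrightarrow> \<bar>deriv (deriv (deriv (\<lambda>z. G (a * F z)))) z\<bar> \<le> B * a"
    "0 < a \<Longrightarrow> a \<le> 1 \<Longrightarrow> 2 * a \<le> r \<Longrightarrow> C_k_on k UNIV (\<lambda>z. G (a * F z))"
  using assms unfolding amplitude_bound_def by simp_all

text \<open>In the third derivative of G(a F) each term carries at least one factor a, and a^2 and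
  a^3 are at most a because a <= 1. The values are O(a) by the mean value theorem, as G(0) =
  0.\<close>

lemma composition_bounds:
  fixes F G :: "real \<Rightarrow> real"
  assumes F: "\<And>k. C_k_on k UNIV F" "\<And>x. \<bar>x\<bar> \<ge> 2 \<Longrightarrow> F x = 0" "\<And>x. \<bar>F x\<bar> \<le> 2"
    and G: "open W" "\<And>k. C_k_on k W G" "{- r..r} \<subseteq> W" "G 0 = 0" and "r > 0"
  shows "\<exists>B. amplitude_bound F G r B"
proof -
  obtain f where f: "\<And>x. \<bar>F x\<bar> \<le> f" "\<And>x. \<bar>deriv F x\<bar> \<le> f" "\<And>x. \<bar>deriv (deriv F) x\<bar> \<le> f"
    "\<And>x. \<bar>deriv (deriv (deriv F)) x\<bar> \<le> f"
    using smooth_compact_support_bounds[of F 2, OF F(1)] F(2) by (metis less_imp_le)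
  have f0: "f \<ge> 0" using f(1)[of 0] by linarith
  have Fk: "C_k_on k UNIV (deriv F)" "C_k_on k UNIV (deriv (deriv F))" for k
    by (intro C_k_on_real_deriv(2)[OF open_UNIV] F)+
  have Gk: "C_k_on k W (deriv G)" "C_k_on k W (deriv (deriv G))" "C_k_on k W (deriv (deriv (deriv G)))" for k
    by (intro C_k_on_real_deriv(2)[OF G(1)] G)+
  have cG: "continuous_on {- r..r} g" if "g \<in> {deriv G, deriv (deriv G), deriv (deriv (deriv G))}" for g
    using that C_k_on_imp_continuous_on[OF Gk(1)[of 0]] C_k_on_imp_continuous_on[OF Gk(2)[of 0]]
      C_k_on_imp_continuous_on[OF Gk(3)[of 0]] G(3) by (auto intro: continuous_on_subset)
  have "finite {deriv G, deriv (deriv G), deriv (deriv (deriv G))}" by simp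
  from finite_family_bounded_on_compact[OF compact_Icc this cG]
  obtain b where b: "\<And>g x. g \<in> {deriv G, deriv (deriv G), deriv (deriv (deriv G))} \<Longrightarrow> x \<in> {- r..r} \<Longrightarrow> \<bar>g x\<bar> \<le> b"
    by metis
  have b0: "b \<ge> 0" using b[of "deriv G" 0] \<open>r > 0\<close> abs_ge_zero[of "deriv G 0"] by (simp del: abs_ge_zero)
  \<comment> \<open>The first three summands belong to the third derivative, 2 b to the values
    because |F| <= 2, and b to the Lipschitz bound of G.\<close>
  define B where "B = b * f ^ 3 + 3 * b * f\<^sup>2 + b * f + 2 * b + b"
  have B: "B \<ge> 0" "b \<le> B" "2 * b \<le> B" "b * f ^ 3 + 3 * b * f\<^sup>2 + b * f \<le> B"
    using b0 f0 by (simp_all add: B_def)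
  have lip: "\<bar>G z\<bar> \<le> b * \<bar>z\<bar>" if "\<bar>z\<bar> \<le> r" for z
  proof -
    have "norm (G z - G 0) \<le> b * norm (z - 0)"
    proof (rule field_differentiable_bound)
      show "convex {- r..r}" by (rule convex_closed_interval)
      show "(G has_field_derivative deriv G x) (at x within {- r..r})" if "x \<in> {- r..r}" for x
        by (rule has_field_derivative_at_within[OF C_k_on_real_deriv(1)[OF G(1) G(2) subsetD[OF G(3) that]]])
      show "norm (deriv G x) \<le> b" if "x \<in> {- r..r}" for x using b[OF _ that, of "deriv G"] by simp
    qed (use that \<open>r > 0\<close> in \<open>auto simp: abs_le_iff\<close>)
    then show ?thesis by (simp add: G(4))
  qed
  have "amplitude_bound F G r B"
    unfolding amplitude_bound_def
  proof (intro conjI allI impI B(1))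
    show "\<bar>G z\<bar> \<le> B * \<bar>z\<bar>" if "\<bar>z\<bar> \<le> r" for z
      using lip[OF that] mult_right_mono[OF B(2), of "\<bar>z\<bar>"] by simp
    fix a :: real assume a: "0 < a" "2 * a \<le> r" and a1: "a \<le> 1"
    have aF: "\<bar>a * F z\<bar> \<le> 2 * a" for z using mult_left_mono[OF F(3)[of z], of a] a by (simp add: abs_mult)
    have aFr: "a * F z \<in> {- r..r}" for z using order_trans[OF aF[of z] a(2)] unfolding abs_le_iff atLeastAtMost_iff by linarith
    have ak: "C_k_on k UNIV (\<lambda>z. a * F z)" for k by (intro C_k_on_mult open_UNIV C_k_on_const F)
    show "C_k_on k UNIV (\<lambda>z. G (a * F z))" for k
      by (rule C_k_on_compose[OF open_UNIV G(1,2) ak]) (use aFr G(3) in blast)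
    show "\<bar>G (a * F z)\<bar> \<le> B * a" for z
    proof -
      have "\<bar>G (a * F z)\<bar> \<le> b * \<bar>a * F z\<bar>" using aFr[of z] by (intro lip) (auto simp: abs_le_iff)
      also have "\<dots> \<le> b * (2 * a)" by (rule mult_left_mono[OF aF b0])
      also have "\<dots> \<le> B * a" using mult_right_mono[OF B(3), of a] a by simp
      finally show ?thesis .
    qed
    show "\<bar>deriv (deriv (deriv (\<lambda>z. G (a * F z)))) z\<bar> \<le> B * a" for z
    proof -
      note DF = C_k_on_real_deriv(1)[OF open_UNIV F(1) UNIV_I]
        C_k_on_real_deriv(1)[OF open_UNIV Fk(1) UNIV_I] C_k_on_real_deriv(1)[OF open_UNIV Fk(2) UNIV_I]
      have W: "a * F z \<in> W" for z using aFr G(3) by blast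
      have ch: "((\<lambda>z. g (a * F z)) has_real_derivative deriv g (a * F z) * (a * deriv F z)) (at z)"
        if "\<And>k. C_k_on k W g" for g :: "real \<Rightarrow> real" and z
        by (rule DERIV_chain2[where g="\<lambda>z. a * F z", OF C_k_on_real_deriv(1)[OF G(1) that W] DERIV_cmult[OF DF(1)]])
      have 1: "deriv (\<lambda>z. G (a * F z)) = (\<lambda>z. deriv G (a * F z) * (a * deriv F z))"
        by (intro ext DERIV_imp_deriv ch G(2))
      have 2: "deriv (\<lambda>z. deriv G (a * F z) * (a * deriv F z)) =
          (\<lambda>z. deriv (deriv G) (a * F z) * (a * deriv F z) * (a * deriv F z) + deriv G (a * F z) * (a * deriv (deriv F) z))"
        by (intro ext DERIV_imp_deriv) (auto intro!: derivative_eq_intros ch Gk DF)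
      have 3: "deriv (\<lambda>z. deriv (deriv G) (a * F z) * (a * deriv F z) * (a * deriv F z) + deriv G (a * F z) * (a * deriv (deriv F) z)) z =
          deriv (deriv (deriv G)) (a * F z) * (a * deriv F z) ^ 3
          + 3 * deriv (deriv G) (a * F z) * ((a * deriv F z) * (a * deriv (deriv F) z))
          + deriv G (a * F z) * (a * deriv (deriv (deriv F)) z)"
        by (intro DERIV_imp_deriv) (auto intro!: derivative_eq_intros ch Gk DF simp: algebra_simps power3_eq_cube)
      have bd: "\<bar>a * deriv F z\<bar> \<le> a * f" "\<bar>a * deriv (deriv F) z\<bar> \<le> a * f" "\<bar>a * deriv (deriv (deriv F)) z\<bar> \<le> a * f"
        using f a by (simp_all add: abs_mult mult_left_mono)
      have bG: "\<bar>deriv G (a * F z)\<bar> \<le> b" "\<bar>deriv (deriv G) (a * F z)\<bar> \<le> b" "\<bar>deriv (deriv (deriv G)) (a * F z)\<bar> \<le> b"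
        using b[OF _ aFr, of "deriv G"] b[OF _ aFr, of "deriv (deriv G)"] b[OF _ aFr, of "deriv (deriv (deriv G))"] by auto
      have af: "a * f \<ge> 0" using a f0 by simp
      have t1: "\<bar>deriv (deriv (deriv G)) (a * F z) * (a * deriv F z) ^ 3\<bar> \<le> b * (a * f) ^ 3"
        unfolding abs_mult[of _ "_ ^ 3"] power_abs by (intro mult_mono bG power_mono bd) (use b0 af in auto)
      have t2: "\<bar>deriv (deriv G) (a * F z) * ((a * deriv F z) * (a * deriv (deriv F) z))\<bar> \<le> b * ((a * f) * (a * f))"
        unfolding abs_mult[of "deriv (deriv G) _"] abs_mult[of "a * deriv F z"]
        by (intro mult_mono bG bd) (use b0 af in auto)
      have t3: "\<bar>deriv G (a * F z) * (a * deriv (deriv (deriv F)) z)\<bar> \<le> b * (a * f)"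
        unfolding abs_mult[of "deriv G _"] by (intro mult_mono bG bd) (use b0 af in auto)
      have "a ^ 3 \<le> a" "a\<^sup>2 \<le> a" using a a1 power_decreasing[of 1 3 a] power_decreasing[of 1 2 a] by auto
      then have "b * (a * f) ^ 3 \<le> b * f ^ 3 * a" "b * ((a * f) * (a * f)) \<le> b * f\<^sup>2 * a"
        using b0 f0 mult_left_mono[of "a ^ 3" a "b * f ^ 3"] mult_left_mono[of "a\<^sup>2" a "b * f\<^sup>2"]
        by (simp_all add: power_mult_distrib power2_eq_square mult_ac)
      then have "\<bar>deriv (deriv (deriv (\<lambda>z. G (a * F z)))) z\<bar> \<le> b * f ^ 3 * a + 3 * (b * f\<^sup>2 * a) + b * (a * f)"
        unfolding 1 2 3 using t1 t2 t3 by linarith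
      also have "\<dots> = (b * f ^ 3 + 3 * b * f\<^sup>2 + b * f) * a" by (simp add: algebra_simps)
      also have "\<dots> \<le> B * a" using B(4) a by (intro mult_right_mono) auto
      finally show ?thesis .
    qed
  qed
  then show ?thesis ..
qed

section \<open>Ill-posedness\<close>

context focusing_wave
begin

lemma solution_exists: obtains V w w\<^sub>1 K where "focusing_solution A \<gamma> \<eta> T F V w w\<^sub>1 K"
proof -
  obtain K where K: "\<And>y. \<bar>deriv w\<^sub>0 y\<bar> \<le> K" using deriv_w\<^sub>0_bounded by metis
  have m: "1 + \<theta> > 0" using \<theta> by simp
  show thesis
  proof (rule burgers_solution[OF smooth_w\<^sub>0 m T abs_w\<^sub>0_le deriv_w\<^sub>0_ge K, of c])
    fix V w w\<^sub>1
    assume *: "open V" "slab T \<subseteq> V" "\<And>k. C_k_on k V w"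
      "\<And>p. p \<in> V \<Longrightarrow> (w has_derivative (\<lambda>v. w\<^sub>1 p * (fst (snd v) - (c + (1 + \<theta>) * w p) * fst v))) (at p)"
      "\<And>t y x\<^sub>2. 0 \<le> t \<Longrightarrow> t < T \<Longrightarrow> w (t, (y + t * (c + (1 + \<theta>) * w\<^sub>0 y), x\<^sub>2)) = w\<^sub>0 y"
      "\<And>t y x\<^sub>2. 0 \<le> t \<Longrightarrow> t < T \<Longrightarrow>
       w\<^sub>1 (t, (y + t * (c + (1 + \<theta>) * w\<^sub>0 y), x\<^sub>2)) = deriv w\<^sub>0 y / (1 + t * (1 + \<theta>) * deriv w\<^sub>0 y)"
      "\<And>p. \<bar>w p\<bar> \<le> 2 * a" "\<And>t x. 0 \<le> t \<Longrightarrow> t < T \<Longrightarrow> \<bar>w\<^sub>1 (t, x)\<bar> \<le> K / (1 - t / T)"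
      "\<And>t x\<^sub>1 x\<^sub>2 z\<^sub>2. w (t, (x\<^sub>1, x\<^sub>2)) = w (t, (x\<^sub>1, z\<^sub>2))"
    have "focusing_solution A \<gamma> \<eta> T F V w w\<^sub>1 K"
      by unfold_locales (fact *)+
    then show thesis by (rule that)
  qed
qed

end

text \<open>The data are prescribed in the initial region only, which leaves the cut-off elsewhere
  free. Nonexistence of a continuation concerns the actual data, through their values in this
  region.\<close>

lemma shock_formation:
  fixes A \<gamma> \<eta> T :: real and r\<^sub>0 s\<^sub>0 :: "plane \<Rightarrow> real" and v\<^sub>0 :: "plane \<Rightarrow> plane"
  assumes wave: "focusing_wave A \<gamma> \<eta> T F"
    and data: "\<And>x. x \<in> initial_region A \<gamma> \<eta> T \<Longrightarrow>
      r\<^sub>0 x = wave_density (sqrt (A * \<gamma>)) ((\<gamma> - 1) / 2) (focusing_velocity F \<gamma> \<eta> T (fst x)) \<and>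
      v\<^sub>0 x = (focusing_velocity F \<gamma> \<eta> T (fst x), 0) \<and> s\<^sub>0 x = 0"
    and \<kappa>: "\<And>z. \<bar>z\<bar> \<le> 2 * focusing_amplitude \<gamma> \<eta> T \<Longrightarrow>
      norm ((z, 0 :: real), wave_density (sqrt (A * \<gamma>)) ((\<gamma> - 1) / 2) z - 1, 0 :: real) \<le> \<kappa>"
  shows "\<exists>\<rho> u S D.
      D = domain_of_dependence A \<gamma> (initial_region A \<gamma> \<eta> T) T \<rho> u S \<and>
      solution_in_domain_of_dependence A \<gamma> (initial_region A \<gamma> \<eta> T) T r\<^sub>0 v\<^sub>0 s\<^sub>0 \<rho> u S \<and>
      shock_in D T \<kappa> \<rho> u S \<and>
      (\<forall>t\<in>{0..<T}. planar_symmetric_on (slice D t) (\<lambda>x. (\<rho> (t, x), u (t, x), S (t, x)))) \<and>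
      filterlim (\<lambda>t. H1_norm (slice D t) (\<lambda>x. fst (u (t, x)))) at_top (at_left T) \<and>
      filterlim (\<lambda>t. H1_norm (slice D t) (\<lambda>x. \<rho> (t, x))) at_top (at_left T)"
      (is "\<exists>\<rho> u S D. ?shock \<rho> u S D")
    and "\<not> (\<exists>T'>T. \<exists>\<rho>' u' S'. cauchy_solution A \<gamma> T' r\<^sub>0 v\<^sub>0 s\<^sub>0 \<rho>' u' S')"
proof -
  interpret focusing_wave A \<gamma> \<eta> T F by (rule wave)
  obtain V w w\<^sub>1 K where "focusing_solution A \<gamma> \<eta> T F V w w\<^sub>1 K" by (rule solution_exists)
  then interpret focusing_solution A \<gamma> \<eta> T F V w w\<^sub>1 K .
  have data': "r\<^sub>0 x = \<rho> (0, x) \<and> v\<^sub>0 x = u (0, x) \<and> s\<^sub>0 x = 0" if "x \<in> initial_region A \<gamma> \<eta> T" for x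
    using data[OF that] by (simp add: \<rho>_def u_def w_initial w\<^sub>0_def c_def \<theta>_def)
  show "\<exists>\<rho> u S D. ?shock \<rho> u S D"
  proof (intro exI conjI)
    show "D = domain_of_dependence A \<gamma> (initial_region A \<gamma> \<eta> T) T \<rho> u S" by (rule D_def)
    have "D \<subseteq> V" using D_subset V(2) by force
    then have "euler_on A \<gamma> D \<rho> u S" using euler unfolding euler_on_def by blast
    then show "solution_in_domain_of_dependence A \<gamma> (initial_region A \<gamma> \<eta> T) T r\<^sub>0 v\<^sub>0 s\<^sub>0 \<rho> u S"
      unfolding solution_in_domain_of_dependence_def D_def[symmetric] using smooth_fields data' by simp
    show "shock_in D T \<kappa> \<rho> u S"
    proof (rule shock)
      show "norm (u p, \<rho> p - 1, S p) \<le> \<kappa>" for p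
        using \<kappa>[of "w p"] w_le[of p] by (simp add: u_def \<rho>_def a_def c_def \<theta>_def)
    qed
    have "w (t, x) = w (t, y)" if "fst x = fst y" for t x y
      using planar[of t "fst x" "snd x" "snd y"] that by (cases x, cases y) simp
    then show "\<forall>t\<in>{0..<T}. planar_symmetric_on (slice D t) (\<lambda>x. (\<rho> (t, x), u (t, x), S (t, x)))"
      unfolding planar_symmetric_on_def \<rho>_def u_def by metis
  qed (rule H1_blowup_velocity H1_blowup_density)+
  show "\<not> (\<exists>T'>T. \<exists>\<rho>' u' S'. cauchy_solution A \<gamma> T' r\<^sub>0 v\<^sub>0 s\<^sub>0 \<rho>' u' S')"
    using no_smooth_continuation data' by blast
qed

lemma wave_density_smooth:
  assumes "c > 0" "\<theta> > 0"
  shows "open {z. 1 + \<theta> * z / c > 0}" "C_k_on k {z. 1 + \<theta> * z / c > 0} (\<lambda>z. wave_density c \<theta> z - 1)"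
    "{- (c / (2 * (1 + \<theta>)))..c / (2 * (1 + \<theta>))} \<subseteq> {z. 1 + \<theta> * z / c > 0}"
proof -
  let ?W = "{z. 1 + \<theta> * z / c > 0}"
  show W: "open ?W" by (intro open_Collect_less continuous_intros) (use assms in auto)
  have "C_k_on k ?W (\<lambda>z. 1 + (\<theta> / c) * z)"
    by (intro C_k_on_add[OF W C_k_on_const] C_k_on_mult[OF W C_k_on_const] C_k_on_linear bounded_linear_ident W)
  then have "C_k_on k ?W (\<lambda>z. (1 + (\<theta> / c) * z) powr (1 / \<theta>))"
    by (intro C_k_on_compose[where g="\<lambda>x. x powr (1 / \<theta>)", OF W _ C_k_on_powr]) auto
  from C_k_on_add[OF W this C_k_on_const[of _ _ "- 1"]]
  show "C_k_on k ?W (\<lambda>z. wave_density c \<theta> z - 1)" by (simp add: wave_density_def)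
  show "{- (c / (2 * (1 + \<theta>)))..c / (2 * (1 + \<theta>))} \<subseteq> ?W"
  proof
    fix z assume "z \<in> {- (c / (2 * (1 + \<theta>)))..c / (2 * (1 + \<theta>))}"
    then have "\<theta> * z \<ge> \<theta> * (- (c / (2 * (1 + \<theta>))))" using assms by (intro mult_left_mono) auto
    moreover have "\<theta> * (c / (2 * (1 + \<theta>))) < c" using assms by (simp add: pos_divide_less_eq add_pos_pos algebra_simps)
    ultimately have "\<theta> * z > - c" by simp
    then show "z \<in> ?W" using assms by (simp add: pos_less_divide_eq[symmetric] field_simps)
  qed
qed

text \<open>Over the support of the wave the half height of the initial region is at most
  \<open>2 sqrt ((c + 1) \<eta> T)\<close>, so that a cut-off in \<open>x\<^sub>2\<close> at this height does not affect it.\<close>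

lemma initial_region_height:
  assumes "(x\<^sub>1, x\<^sub>2) \<in> initial_region A \<gamma> \<eta> T" "\<bar>x\<^sub>1 - 2 * \<eta>\<bar> \<le> \<eta> / 4" "0 < \<eta>" "\<eta> \<le> T" "A * \<gamma> \<ge> 0"
  shows "\<bar>x\<^sub>2\<bar> \<le> 2 * sqrt ((sqrt (A * \<gamma>) + 1) * (\<eta> * T))"
proof -
  define c where "c = sqrt (A * \<gamma>)"
  have c: "c \<ge> 0" using assms(5) by (simp add: c_def)
  have cT: "c * T \<ge> 0" using c assms(3,4) by simp
  define e where "e = x\<^sub>1 - 2 * \<eta>"
  have e: "\<bar>e\<bar> \<le> \<eta> / 4" using assms(2) by (simp add: e_def)
  have "x\<^sub>2\<^sup>2 \<le> (c * T + \<eta>)\<^sup>2 - (e - c * T)\<^sup>2"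
    using assms(1) by (simp add: initial_region_def c_def e_def algebra_simps)
  \<comment> \<open>Near the left end of the disc the first factor, the distance from that end, is
    of order \<eta>, and the second is of order T.\<close>
  also have "\<dots> = (\<eta> + e) * (2 * (c * T) + \<eta> - e)" by (simp add: power2_eq_square algebra_simps)
  also have "\<dots> \<le> (5 / 4 * \<eta>) * (2 * (c * T) + 5 / 4 * T)"
    using e assms(3,4) cT by (intro mult_mono) (auto simp: abs_le_iff)
  also have "\<dots> = (\<eta> * T) * (5 / 2 * c + 25 / 16)" by (simp add: algebra_simps)
  also have "\<dots> \<le> (\<eta> * T) * (4 * (c + 1))" using c assms(3,4) by (intro mult_left_mono) auto
  also have "\<dots> = 4 * ((c + 1) * (\<eta> * T))" by simp
  finally have "sqrt (x\<^sub>2\<^sup>2) \<le> sqrt (4 * ((c + 1) * (\<eta> * T)))" by (rule real_sqrt_le_mono)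
  then show ?thesis by (simp add: c_def real_sqrt_mult)
qed

theorem theorem1p2:
  fixes A \<gamma> :: real
  assumes "A > 0" and "\<gamma> > 1"
  shows "\<exists>\<epsilon>\<^sub>0>0. \<forall>\<epsilon>. 0 < \<epsilon> \<and> \<epsilon> < \<epsilon>\<^sub>0 \<longrightarrow>
    (\<forall>X \<in> {isotropic_weight (7/4 - \<epsilon>), anisotropic_weight (7/4 - \<epsilon>) \<epsilon>}.
      \<exists>\<eta>\<^sub>0>0. \<exists>(\<rho>\<^sub>0 :: real \<Rightarrow> plane \<Rightarrow> real) (u\<^sub>0 :: real \<Rightarrow> plane \<Rightarrow> plane)
        (S\<^sub>0 :: real \<Rightarrow> plane \<Rightarrow> real) (T :: real \<Rightarrow> real) (\<kappa> :: real \<Rightarrow> real).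
        (\<forall>\<eta>\<in>{0<..<\<eta>\<^sub>0}.
           smooth_on UNIV (\<lambda>x. (\<rho>\<^sub>0 \<eta> x, u\<^sub>0 \<eta> x, S\<^sub>0 \<eta> x)) \<and>
           (\<forall>x. \<rho>\<^sub>0 \<eta> x > 0) \<and>
           compactly_supported (\<lambda>x. (\<rho>\<^sub>0 \<eta> x - 1, u\<^sub>0 \<eta> x, S\<^sub>0 \<eta> x)) \<and>
           in_sobolev X (\<lambda>x. \<rho>\<^sub>0 \<eta> x - 1) \<and> in_sobolev X (u\<^sub>0 \<eta>) \<and> in_sobolev X (S\<^sub>0 \<eta>)) \<and>
        ((\<lambda>\<eta>. sobolev_norm X (\<lambda>x. \<rho>\<^sub>0 \<eta> x - 1) + sobolev_norm X (u\<^sub>0 \<eta>) + sobolev_norm X (S\<^sub>0 \<eta>))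
           \<longlongrightarrow> 0) (at_right 0) \<and>
        (T \<longlongrightarrow> 0) (at_right 0) \<and>
        (\<kappa> \<longlongrightarrow> 0) (at_right 0) \<and>
        (\<forall>\<eta>\<in>{0<..<\<eta>\<^sub>0}.
           T \<eta> > 0 \<and>
           planar_symmetric_on (initial_region A \<gamma> \<eta> (T \<eta>)) (\<lambda>x. (\<rho>\<^sub>0 \<eta> x, u\<^sub>0 \<eta> x, S\<^sub>0 \<eta> x)) \<and>
           (\<exists>\<rho> u S D.
              D = domain_of_dependence A \<gamma> (initial_region A \<gamma> \<eta> (T \<eta>)) (T \<eta>) \<rho> u S \<and>
              solution_in_domain_of_dependence A \<gamma> (initial_region A \<gamma> \<eta> (T \<eta>)) (T \<eta>)
                (\<rho>\<^sub>0 \<eta>) (u\<^sub>0 \<eta>) (S\<^sub>0 \<eta>) \<rho> u S \<and>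
              shock_in D (T \<eta>) (\<kappa> \<eta>) \<rho> u S \<and>
              (\<forall>t\<in>{0..<T \<eta>}.
                 planar_symmetric_on (slice D t) (\<lambda>x. (\<rho> (t, x), u (t, x), S (t, x)))) \<and>
              filterlim (\<lambda>t. H1_norm (slice D t) (\<lambda>x. fst (u (t, x)))) at_top (at_left (T \<eta>)) \<and>
              filterlim (\<lambda>t. H1_norm (slice D t) (\<lambda>x. \<rho> (t, x))) at_top (at_left (T \<eta>))) \<and>
           \<not> (\<exists>T'>T \<eta>. \<exists>\<rho>' u' S'.
                cauchy_solution A \<gamma> T' (\<rho>\<^sub>0 \<eta>) (u\<^sub>0 \<eta>) (S\<^sub>0 \<eta>) \<rho>' u' S')))"
proof -
  let "\<exists>\<epsilon>\<^sub>0>0. \<forall>\<epsilon>. 0 < \<epsilon> \<and> \<epsilon> < \<epsilon>\<^sub>0 \<longrightarrow> (\<forall>X\<in>?W \<epsilon>. \<exists>\<eta>\<^sub>0>0. ?ill_posed X \<eta>\<^sub>0)" = ?thesis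
  show ?thesis
  \<comment> \<open>The threshold 1/4 keeps s = 7/4 - \<epsilon> in [0, 2], as the weight bounds
    require, and makes the final exponent \<open>e\<close> positive.\<close>
  proof (rule exI[of _ "1 / 4"], intro conjI allI impI ballI)
    show "(0::real) < 1 / 4" by simp
    fix \<epsilon> :: real and X
    assume "0 < \<epsilon> \<and> \<epsilon> < 1 / 4" and X: "X \<in> {isotropic_weight (7/4 - \<epsilon>), anisotropic_weight (7/4 - \<epsilon>) \<epsilon>}"
    then have \<epsilon>: "0 < \<epsilon>" "\<epsilon> < 1 / 4" by auto
    define s where "s = 7 / 4 - \<epsilon>"
    define c where "c = sqrt (A * \<gamma>)"
    define \<theta> where "\<theta> = (\<gamma> - 1) / 2"
    have c: "c > 0" and \<theta>: "\<theta> > 0" using assms by (auto simp: c_def \<theta>_def)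
    obtain F :: "real \<Rightarrow> real" where F: "\<And>k. C_k_on k UNIV F" "\<And>z. \<bar>z\<bar> \<le> 1 \<Longrightarrow> F z = - z"
      "\<And>z. \<bar>z\<bar> \<ge> 2 \<Longrightarrow> F z = 0" "\<And>z. \<bar>F z\<bar> \<le> 2" "\<And>z. deriv F z \<ge> - 1"
      using wave_profile_exists by metis
    obtain \<psi> \<psi>' :: "real \<Rightarrow> real" where \<psi>: "\<And>k. C_k_on k UNIV \<psi>" "\<And>z. \<bar>z\<bar> \<le> 1 \<Longrightarrow> \<psi> z = 1" "\<And>z. \<bar>z\<bar> \<ge> 2 \<Longrightarrow> \<psi> z = 0"
      "\<And>z. 0 \<le> \<psi> z" "\<And>z. \<psi> z \<le> 1"
      using bump_exists by metis
    define G where "G z = wave_density c \<theta> z - 1" for z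
    \<comment> \<open>For the amplitude a, the condition 2 a <= r reads 4 (1 + \<theta>) a <= c. It
      keeps the range of the wave where G is smooth and the density positive, and it implies
      \<open>small\<close>.\<close>
    define r where "r = c / (2 * (1 + \<theta>))"
    have r: "r > 0" using c \<theta> by (simp add: r_def)
    have G0: "G 0 = 0" by (simp add: G_def wave_density_def)
    note Gs = wave_density_smooth[OF c \<theta>, folded G_def r_def]
    obtain B\<^sub>1 where "amplitude_bound F (G) r B\<^sub>1"
      using composition_bounds[OF F(1,3,4) Gs(1,2,3) G0 r] by (rule exE)
    note B\<^sub>1 = amplitude_boundD[OF this]
    have id: "C_k_on k UNIV (\<lambda>z::real. z)" for k by (intro C_k_on_linear bounded_linear_ident open_UNIV)
    obtain B\<^sub>2 where "amplitude_bound F (\<lambda>z. z) r B\<^sub>2"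
      using composition_bounds[OF F(1,3,4) open_UNIV id subset_UNIV refl r] by (rule exE)
    note B\<^sub>2 = amplitude_boundD[OF this]
    obtain C where C: "\<And>z. \<bar>\<psi> z\<bar> \<le> C" "\<And>z. \<bar>deriv (deriv (deriv \<psi>)) z\<bar> \<le> C"
      using smooth_compact_support_bounds[of \<psi> 2, OF \<psi>(1)] \<psi>(3) by (metis less_imp_le)

    \<comment> \<open>Choice of scales and initial data\<close>
    define T where "T \<eta> = \<eta> powr (\<epsilon> / 2)" for \<eta> :: real
    define a where "a \<eta> = focusing_amplitude \<gamma> \<eta> (T \<eta>)" for \<eta>
    \<comment> \<open>The bound of \<open>initial_region_height\<close>. By the summand 1 it is also
      at least the width \<eta> / 8, as the isotropic weight bound requires.\<close>
    define h where "h \<eta> = 2 * sqrt ((c + 1) * (\<eta> * T \<eta>))" for \<eta>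
    define w\<^sub>0 where "w\<^sub>0 \<eta> = focusing_velocity F \<gamma> \<eta> (T \<eta>)" for \<eta>
    define \<rho>\<^sub>0 where "\<rho>\<^sub>0 \<eta> x = 1 + G (w\<^sub>0 \<eta> (fst x)) * \<psi> (snd x / h \<eta>)" for \<eta> and x :: plane
    define u\<^sub>0 where "u\<^sub>0 \<eta> x = (w\<^sub>0 \<eta> (fst x) * \<psi> (snd x / h \<eta>), 0 :: real)" for \<eta> and x :: plane
    \<comment> \<open>The velocity is at most 2 a and the density deviation at most
      \<open>B\<^sub>1\<close> times that.\<close>
    define \<kappa> where "\<kappa> \<eta> = (1 + B\<^sub>1) * (2 * a \<eta>)" for \<eta>
    have a_powr: "a \<eta> = 1 / (8 * (1 + \<theta>)) * \<eta> powr (1 - \<epsilon> / 2)" if "\<eta> > 0" for \<eta>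
      using that by (simp add: a_def focusing_amplitude_def T_def \<theta>_def[symmetric] powr_diff)
    have h_powr: "h \<eta> = 2 * sqrt (c + 1) * \<eta> powr ((1 + \<epsilon> / 2) / 2)" if "\<eta> > 0" for \<eta>
    proof -
      have "\<eta> * T \<eta> = \<eta> powr (1 + \<epsilon> / 2)" using that by (simp add: T_def powr_add)
      moreover have "sqrt (\<eta> powr (1 + \<epsilon> / 2)) = \<eta> powr ((1 + \<epsilon> / 2) / 2)"
        by (simp add: powr_half_sqrt[symmetric] powr_powr)
      ultimately show ?thesis by (simp add: h_def real_sqrt_mult)
    qed
    have to0: "((\<lambda>\<eta>. k * \<eta> powr e) \<longlongrightarrow> 0) (at_right (0::real))" if "e > 0" for k e
    proof -
      have "((\<lambda>\<eta>. k * \<eta> powr e) \<longlongrightarrow> k * 0) (at_right (0::real))"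
        by (intro tendsto_mult tendsto_const tendsto_zero_powrI[OF tendsto_ident_at tendsto_const _ that])
           (auto simp: eventually_at_filter)
      then show ?thesis by simp
    qed
    have T0: "(T \<longlongrightarrow> 0) (at_right 0)" using to0[of "\<epsilon> / 2" 1] \<epsilon> by (simp add: T_def[abs_def])
    have a0: "(a \<longlongrightarrow> 0) (at_right 0)"
      by (rule Lim_transform_eventually[OF to0[of "1 - \<epsilon> / 2" "1 / (8 * (1 + \<theta>))"]])
         (use \<epsilon> a_powr in \<open>auto simp: eventually_at_filter\<close>)
    have h0: "(h \<longlongrightarrow> 0) (at_right 0)"
      by (rule Lim_transform_eventually[OF to0[of "(1 + \<epsilon> / 2) / 2" "2 * sqrt (c + 1)"]])
         (use \<epsilon> h_powr in \<open>auto simp: eventually_at_filter\<close>)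
    have "\<forall>\<^sub>F \<eta> in at_right 0. a \<eta> < min 1 (r / 2)" by (rule order_tendstoD(2)[OF a0]) (use r in simp)
    moreover have "\<forall>\<^sub>F \<eta> in at_right 0. h \<eta> < 1" by (rule order_tendstoD(2)[OF h0]) simp
    ultimately have "\<forall>\<^sub>F \<eta> in at_right 0. a \<eta> < min 1 (r / 2) \<and> h \<eta> < 1" by (rule eventually_conj)
    then obtain \<eta>\<^sub>1 where \<eta>\<^sub>1: "\<eta>\<^sub>1 > 0" "\<And>\<eta>. 0 < \<eta> \<Longrightarrow> \<eta> < \<eta>\<^sub>1 \<Longrightarrow> a \<eta> < min 1 (r / 2) \<and> h \<eta> < 1"
      unfolding eventually_at_right_field by auto
    define \<eta>\<^sub>0 where "\<eta>\<^sub>0 = min 1 \<eta>\<^sub>1"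
    have \<eta>\<^sub>0: "\<eta>\<^sub>0 > 0" using \<eta>\<^sub>1 by (simp add: \<eta>\<^sub>0_def)
    have small: "0 < T \<eta>" "\<eta> \<le> T \<eta>" "0 < a \<eta>" "a \<eta> \<le> 1" "2 * a \<eta> \<le> r" "0 < h \<eta>" "h \<eta> \<le> 1" "\<eta> / 8 \<le> h \<eta>" "\<eta> \<le> 2 * c * T \<eta>"
      if "\<eta> \<in> {0<..<\<eta>\<^sub>0}" for \<eta>
    proof -
      have \<eta>: "0 < \<eta>" "\<eta> < 1" "\<eta> < \<eta>\<^sub>1" using that by (auto simp: \<eta>\<^sub>0_def)
      show T: "0 < T \<eta>" using \<eta> by (simp add: T_def)
      show "\<eta> \<le> T \<eta>" using powr_mono'[of "\<epsilon> / 2" 1 \<eta>] \<eta> \<epsilon> by (simp add: T_def)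
      show a: "0 < a \<eta>" using \<eta> T \<theta> by (simp add: a_def focusing_amplitude_def \<theta>_def[symmetric])
      show "a \<eta> \<le> 1" "2 * a \<eta> \<le> r" "h \<eta> \<le> 1" using \<eta>\<^sub>1(2)[OF \<eta>(1,3)] by auto
      show "0 < h \<eta>" using \<eta> T c by (simp add: h_def)
      have "\<eta>\<^sup>2 \<le> (c + 1) * (\<eta> * T \<eta>)"
        using mult_mono[of 1 "c + 1" "\<eta> * \<eta>" "\<eta> * T \<eta>"] c \<eta> \<open>\<eta> \<le> T \<eta>\<close> by (simp add: power2_eq_square)
      then have "\<eta> \<le> sqrt ((c + 1) * (\<eta> * T \<eta>))" by (rule real_le_rsqrt)
      then show "\<eta> / 8 \<le> h \<eta>" using \<eta> by (simp add: h_def)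
      have m: "1 + \<theta> > 0" using \<theta> by simp
      have "8 * ((1 + \<theta>) * a \<eta>) = \<eta> / T \<eta>"
        using T m by (simp add: a_def focusing_amplitude_def \<theta>_def[symmetric])
      moreover have "2 * a \<eta> * (2 * (1 + \<theta>)) \<le> c"
        using \<open>2 * a \<eta> \<le> r\<close> m by (simp add: r_def pos_le_divide_eq)
      then have "4 * ((1 + \<theta>) * a \<eta>) \<le> c" by (simp add: mult_ac)
      ultimately have "\<eta> / T \<eta> \<le> 2 * c" by linarith
      then show "\<eta> \<le> 2 * c * T \<eta>" using T by (simp add: pos_divide_le_eq)
    qed
    have w\<^sub>0_eq: "w\<^sub>0 \<eta> y = a \<eta> * F ((y - 2 * \<eta>) / (\<eta> / 8))" for \<eta> y
      by (simp add: w\<^sub>0_def a_def focusing_velocity_def)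
    have wave: "focusing_wave A \<gamma> \<eta> (T \<eta>) F" if "\<eta> \<in> {0<..<\<eta>\<^sub>0}" for \<eta>
      by unfold_locales (use assms that small[OF that] F in \<open>auto simp: c_def\<close>)

    \<comment> \<open>Sobolev norms of the data\<close>
    define J where "J = (LINT x|lborel. 1 / (1 + (x::real)\<^sup>2))"
    define N where "N \<eta> = (\<eta> / 8) powr (- 2 * s) * h \<eta> powr (- 2 * \<epsilon>)" for \<eta>
    have X_le: "X \<xi> \<le> N \<eta> * ((1 + (\<eta> / 8 * fst \<xi>)\<^sup>2)\<^sup>2 * (1 + (h \<eta> * snd \<xi>)\<^sup>2)\<^sup>2)" if "\<eta> \<in> {0<..<\<eta>\<^sub>0}" for \<eta> \<xi>
      using X isotropic_weight_le[of "\<eta> / 8" "h \<eta>" s \<epsilon> \<xi>] anisotropic_weight_le[of "\<eta> / 8" "h \<eta>" s \<epsilon> \<xi>]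
        small[OF that] that \<epsilon> by (auto simp: N_def s_def \<eta>\<^sub>0_def)
    have X_meas: "X \<in> borel_measurable borel" and X_nonneg: "\<And>\<xi>. 0 \<le> X \<xi>"
      using X borel_measurable_weights by (auto simp: isotropic_weight_def anisotropic_weight_def)
    have r0: "\<rho>\<^sub>0 \<eta> x - 1 = G (a \<eta> * F ((fst x - 2 * \<eta>) / (\<eta> / 8))) * \<psi> ((snd x - 0) / h \<eta>)" for \<eta> x
      by (simp add: \<rho>\<^sub>0_def w\<^sub>0_eq)
    have u0: "u\<^sub>0 \<eta> = (\<lambda>x. (a \<eta> * F ((fst x - 2 * \<eta>) / (\<eta> / 8)) * \<psi> ((snd x - 0) / h \<eta>), 0))" for \<eta>
      by (simp add: u\<^sub>0_def w\<^sub>0_eq fun_eq_iff)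
    have sob: "in_sobolev X (\<lambda>x. \<rho>\<^sub>0 \<eta> x - 1)" "in_sobolev X (u\<^sub>0 \<eta>)"
      "sobolev_norm X (\<lambda>x. \<rho>\<^sub>0 \<eta> x - 1) \<le> sqrt (N \<eta> * (128 * (B\<^sub>1 * a \<eta>) * C * J)\<^sup>2 * (\<eta> / 8 * h \<eta>))"
      "sobolev_norm X (u\<^sub>0 \<eta>) \<le> sqrt (N \<eta> * (128 * (B\<^sub>2 * a \<eta>) * C * J)\<^sup>2 * (\<eta> / 8 * h \<eta>))"
      if \<eta>: "\<eta> \<in> {0<..<\<eta>\<^sub>0}" for \<eta>
    proof -
      note sm = small[OF \<eta>]
      have \<mu>: "\<eta> / 8 > 0" using \<eta> by simp
      have z1: "G (a \<eta> * F x) = 0" "a \<eta> * F x = 0" if "\<bar>x\<bar> \<ge> 2" for x using F(3)[OF that] G0 by simp_all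
      note R = sobolev_tensor_product[OF B\<^sub>1(5)[OF sm(3,4,5)] z1(1) B\<^sub>1(3)[OF sm(3,4,5)] B\<^sub>1(4)[OF sm(3,4,5)]
          \<psi>(1,3) C \<mu> sm(6) X_meas X_nonneg X_le[OF \<eta>], of "2 * \<eta>" 0, folded r0 J_def]
      note U = sobolev_tensor_product[OF B\<^sub>2(5)[OF sm(3,4,5)] z1(2) B\<^sub>2(3)[OF sm(3,4,5)] B\<^sub>2(4)[OF sm(3,4,5)]
          \<psi>(1,3) C \<mu> sm(6) X_meas X_nonneg X_le[OF \<eta>], of "2 * \<eta>" 0, folded J_def]
      show "in_sobolev X (\<lambda>x. \<rho>\<^sub>0 \<eta> x - 1)" unfolding sobolev_real using R(1,2) by blast
      show "in_sobolev X (u\<^sub>0 \<eta>)" unfolding u0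
        by (rule sobolev_first_component(1)) (unfold sobolev_real, use U(1,2) in blast)
      show "sobolev_norm X (\<lambda>x. \<rho>\<^sub>0 \<eta> x - 1) \<le> sqrt (N \<eta> * (128 * (B\<^sub>1 * a \<eta>) * C * J)\<^sup>2 * (\<eta> / 8 * h \<eta>))"
        unfolding sobolev_real by (rule real_sqrt_le_mono[OF R(3)])
      show "sobolev_norm X (u\<^sub>0 \<eta>) \<le> sqrt (N \<eta> * (128 * (B\<^sub>2 * a \<eta>) * C * J)\<^sup>2 * (\<eta> / 8 * h \<eta>))"
        unfolding u0 sobolev_first_component(2) sobolev_real by (rule real_sqrt_le_mono[OF U(3)])
    qed
    define e where "e = \<epsilon> * (1 - 2 * \<epsilon>) / 4"
    have e: "e > 0" using \<epsilon> by (simp add: e_def)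
    define Q where "Q = (1 / (8 * (1 + \<theta>)))\<^sup>2 * (1 / 8) powr (1 - 2 * s) * (2 * sqrt (c + 1)) powr (1 - 2 * \<epsilon>)"
    \<comment> \<open>The exponent collects squared amplitude, width and height. Its part free of
      \<epsilon> is 2 + (1 - 7/2) + 1/2 = 0, which singles out 7/4; the rest is
      \<open>e\<close>.\<close>
    have amplitude: "(a \<eta>)\<^sup>2 * (N \<eta> * (\<eta> / 8 * h \<eta>)) = Q * \<eta> powr e" if \<eta>: "\<eta> \<in> {0<..<\<eta>\<^sub>0}" for \<eta>
    proof -
      have p: "0 < \<eta>" "0 < h \<eta>" using \<eta> small[OF \<eta>] by auto
      have "N \<eta> * (\<eta> / 8 * h \<eta>) = (\<eta> / 8) powr (1 - 2 * s) * h \<eta> powr (1 - 2 * \<epsilon>)"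
        using p by (simp add: N_def powr_diff powr_minus_divide)
      also have "(\<eta> / 8) powr (1 - 2 * s) = (1 / 8) powr (1 - 2 * s) * \<eta> powr (1 - 2 * s)"
        using p powr_mult[of "1 / 8" \<eta> "1 - 2 * s"] by simp
      also have "h \<eta> powr (1 - 2 * \<epsilon>) = (2 * sqrt (c + 1)) powr (1 - 2 * \<epsilon>) * \<eta> powr ((1 + \<epsilon> / 2) / 2 * (1 - 2 * \<epsilon>))"
        using p c by (simp add: h_powr powr_mult powr_powr)
      finally have "(a \<eta>)\<^sup>2 * (N \<eta> * (\<eta> / 8 * h \<eta>)) =
         Q * (\<eta> powr (1 - \<epsilon> / 2) * \<eta> powr (1 - \<epsilon> / 2) * \<eta> powr (1 - 2 * s) * \<eta> powr ((1 + \<epsilon> / 2) / 2 * (1 - 2 * \<epsilon>)))"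
        using p by (simp add: a_powr Q_def power2_eq_square)
      also have "\<eta> powr (1 - \<epsilon> / 2) * \<eta> powr (1 - \<epsilon> / 2) * \<eta> powr (1 - 2 * s) * \<eta> powr ((1 + \<epsilon> / 2) / 2 * (1 - 2 * \<epsilon>)) =
         \<eta> powr (1 - \<epsilon> / 2 + (1 - \<epsilon> / 2) + (1 - 2 * s) + (1 + \<epsilon> / 2) / 2 * (1 - 2 * \<epsilon>))"
        by (simp only: powr_add)
      also have "1 - \<epsilon> / 2 + (1 - \<epsilon> / 2) + (1 - 2 * s) + (1 + \<epsilon> / 2) / 2 * (1 - 2 * \<epsilon>) = e"
        by (simp add: s_def e_def field_simps)
      finally show ?thesis .
    qed
    have norms0: "((\<lambda>\<eta>. sobolev_norm X (\<lambda>x. \<rho>\<^sub>0 \<eta> x - 1) + sobolev_norm X (u\<^sub>0 \<eta>) + sobolev_norm X (\<lambda>_. 0 :: real)) \<longlongrightarrow> 0) (at_right 0)"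
    proof (rule tendsto_sandwich)
      let ?K = "\<lambda>B. (128 * B * C * J)\<^sup>2 * Q"
      have near: "\<forall>\<^sub>F \<eta> in at_right 0. \<eta> \<in> {0<..<\<eta>\<^sub>0}" using eventually_at_right_real[OF \<eta>\<^sub>0] .
      have eq: "N \<eta> * (128 * (B * a \<eta>) * C * J)\<^sup>2 * (\<eta> / 8 * h \<eta>) = ?K B * \<eta> powr e" if "\<eta> \<in> {0<..<\<eta>\<^sub>0}" for \<eta> B
        using amplitude[OF that] by (simp add: power_mult_distrib mult_ac)
      show "\<forall>\<^sub>F \<eta> in at_right 0. sobolev_norm X (\<lambda>x. \<rho>\<^sub>0 \<eta> x - 1) + sobolev_norm X (u\<^sub>0 \<eta>) + sobolev_norm X (\<lambda>_. 0 :: real)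
          \<le> sqrt (?K B\<^sub>1 * \<eta> powr e) + sqrt (?K B\<^sub>2 * \<eta> powr e)"
        using near
      proof eventually_elim
        case (elim \<eta>)
        show ?case using sob(3,4)[OF elim] unfolding eq[OF elim] sobolev_zero by linarith
      qed
      show "\<forall>\<^sub>F \<eta> in at_right 0. 0 \<le> sobolev_norm X (\<lambda>x. \<rho>\<^sub>0 \<eta> x - 1) + sobolev_norm X (u\<^sub>0 \<eta>) + sobolev_norm X (\<lambda>_. 0 :: real)"
        unfolding sobolev_norm_def
        by (intro always_eventually allI add_nonneg_nonneg real_sqrt_ge_zero sum_nonneg Bochner_Integration.integral_nonneg mult_nonneg_nonneg X_nonneg) auto
      have "((\<lambda>\<eta>. sqrt (?K B\<^sub>1 * \<eta> powr e) + sqrt (?K B\<^sub>2 * \<eta> powr e)) \<longlongrightarrow> sqrt 0 + sqrt 0) (at_right 0)"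
        by (intro tendsto_add tendsto_real_sqrt to0 e)
      then show "((\<lambda>\<eta>. sqrt (?K B\<^sub>1 * \<eta> powr e) + sqrt (?K B\<^sub>2 * \<eta> powr e)) \<longlongrightarrow> 0) (at_right 0)" by simp
    qed simp
    have \<kappa>0: "(\<kappa> \<longlongrightarrow> 0) (at_right 0)"
      using tendsto_mult[OF tendsto_const tendsto_mult[OF tendsto_const a0], of "1 + B\<^sub>1" 2] by (simp add: \<kappa>_def[abs_def])

    \<comment> \<open>Regularity, positivity and planar symmetry of the data\<close>
    have w_le: "\<bar>w\<^sub>0 \<eta> y\<bar> \<le> r" if "\<eta> \<in> {0<..<\<eta>\<^sub>0}" for \<eta> y
      using mult_left_mono[OF F(4), of "a \<eta>"] small(3,5)[OF that] by (simp add: w\<^sub>0_eq abs_mult order_trans[rotated])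
    have data_regular: "smooth_on UNIV (\<lambda>x. (\<rho>\<^sub>0 \<eta> x, u\<^sub>0 \<eta> x, 0 :: real))" "\<And>x. \<rho>\<^sub>0 \<eta> x > 0"
      "compactly_supported (\<lambda>x. (\<rho>\<^sub>0 \<eta> x - 1, u\<^sub>0 \<eta> x, 0 :: real))" if \<eta>: "\<eta> \<in> {0<..<\<eta>\<^sub>0}" for \<eta>
    proof -
      note sm = small[OF \<eta>]
      have lin: "C_k_on k UNIV (\<lambda>x::plane. (8 / \<eta>) * fst x + (- 16))" "C_k_on k UNIV (\<lambda>x::plane. (1 / h \<eta>) * snd x)" for k
        by (intro C_k_on_add[OF open_UNIV _ C_k_on_const] C_k_on_mult[OF open_UNIV C_k_on_const]
            C_k_on_linear bounded_linear_fst bounded_linear_snd open_UNIV)+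
      have arg: "(8 / \<eta>) * y + (- 16) = (y - 2 * \<eta>) / (\<eta> / 8)" for y using \<eta> by (simp add: field_simps)
      have g: "C_k_on k UNIV (\<lambda>x::plane. g ((fst x - 2 * \<eta>) / (\<eta> / 8)) * \<psi> (snd x / h \<eta>))"
        if "\<And>k. C_k_on k UNIV g" for g :: "real \<Rightarrow> real" and k
        using C_k_on_mult[OF open_UNIV C_k_on_compose[OF open_UNIV open_UNIV that lin(1) subset_UNIV]
            C_k_on_compose[OF open_UNIV open_UNIV \<psi>(1) lin(2) subset_UNIV]] unfolding arg by simp
      have "C_k_on k UNIV (\<lambda>x. (\<rho>\<^sub>0 \<eta> x, u\<^sub>0 \<eta> x, 0 :: real))" for k
        unfolding \<rho>\<^sub>0_def u\<^sub>0_def w\<^sub>0_eq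
        by (intro C_k_on_Pair[OF open_UNIV] C_k_on_add[OF open_UNIV C_k_on_const] C_k_on_const
            g[of "\<lambda>z. G (a \<eta> * F z)"] g[of "\<lambda>z. a \<eta> * F z"] B\<^sub>1(5)[OF sm(3,4,5)] B\<^sub>2(5)[OF sm(3,4,5)])
      then show "smooth_on UNIV (\<lambda>x. (\<rho>\<^sub>0 \<eta> x, u\<^sub>0 \<eta> x, 0 :: real))"
        unfolding smooth_on_def by (intro exI[of _ UNIV]) simp
      show "\<rho>\<^sub>0 \<eta> x > 0" for x
      proof -
        have "G (w\<^sub>0 \<eta> (fst x)) > - 1"
          using subsetD[OF Gs(3), of "w\<^sub>0 \<eta> (fst x)"] w_le[OF \<eta>, of "fst x"]
          by (simp add: G_def wave_density_def abs_le_iff minus_le_iff)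
        \<comment> \<open>The density is a convex combination of the equilibrium value 1 and the
          positive density of the wave.\<close>
        then have "(1 - \<psi> (snd x / h \<eta>)) + (1 + G (w\<^sub>0 \<eta> (fst x))) * \<psi> (snd x / h \<eta>) > 0"
          using \<psi>(4,5)[of "snd x / h \<eta>"]
          by (cases "\<psi> (snd x / h \<eta>) = 0") (auto intro!: add_nonneg_pos)
        then show ?thesis by (simp add: \<rho>\<^sub>0_def algebra_simps)
      qed
      have zero: "(\<rho>\<^sub>0 \<eta> x - 1, u\<^sub>0 \<eta> x, 0 :: real) = 0" if "x \<notin> cbox (0, - 2 * h \<eta>) (4 * \<eta>, 2 * h \<eta>)" for x
      proof -
        have "\<bar>snd x / h \<eta>\<bar> \<ge> 2 \<or> \<bar>(fst x - 2 * \<eta>) / (\<eta> / 8)\<bar> \<ge> 2"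
          using that sm(6) \<eta> by (cases x) (auto simp: cbox_Pair_eq abs_divide pos_le_divide_eq)
        then show ?thesis
          using F(3) \<psi>(3) G0 by (auto simp: \<rho>\<^sub>0_def u\<^sub>0_def w\<^sub>0_eq zero_prod_def)
      qed
      then have "{x. (\<rho>\<^sub>0 \<eta> x - 1, u\<^sub>0 \<eta> x, 0 :: real) \<noteq> 0} \<subseteq> cbox (0, - 2 * h \<eta>) (4 * \<eta>, 2 * h \<eta>)" by blast
      then show "compactly_supported (\<lambda>x. (\<rho>\<^sub>0 \<eta> x - 1, u\<^sub>0 \<eta> x, 0 :: real))"
        unfolding compactly_supported_def compact_closure by (rule bounded_subset[OF bounded_cbox])
    qed
    have data_planar: "\<rho>\<^sub>0 \<eta> x = wave_density c \<theta> (w\<^sub>0 \<eta> (fst x)) \<and> u\<^sub>0 \<eta> x = (w\<^sub>0 \<eta> (fst x), 0)"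
      if \<eta>: "\<eta> \<in> {0<..<\<eta>\<^sub>0}" and x: "x \<in> initial_region A \<gamma> \<eta> (T \<eta>)" for \<eta> x
    \<comment> \<open>Over the support of the wave the disc is low enough for the cut-off to be 1;
      elsewhere the wave vanishes and the data are at equilibrium for any cut-off.\<close>
    proof (cases "\<bar>fst x - 2 * \<eta>\<bar> \<le> \<eta> / 4")
      case True
      have "\<bar>snd x\<bar> \<le> h \<eta>"
        using initial_region_height[of "fst x" "snd x" A \<gamma> \<eta> "T \<eta>"] x True \<eta> small[OF \<eta>] assms
        by (simp add: h_def c_def)
      then have "\<psi> (snd x / h \<eta>) = 1" using small(6)[OF \<eta>] by (intro \<psi>(2)) (simp add: abs_divide)
      then show ?thesis by (simp add: \<rho>\<^sub>0_def u\<^sub>0_def G_def)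
    next
      case False
      have q: "\<eta> / 8 > 0" using \<eta> by simp
      have "2 \<le> \<bar>fst x - 2 * \<eta>\<bar> / (\<eta> / 8)" by (subst pos_le_divide_eq[OF q]) (use False in simp)
      also have "\<dots> = \<bar>(fst x - 2 * \<eta>) / (\<eta> / 8)\<bar>" using q by (simp only: abs_divide abs_of_pos)
      finally have "w\<^sub>0 \<eta> (fst x) = 0" unfolding w\<^sub>0_eq by (simp only: F(3) mult_zero_right)
      then show ?thesis using G0 by (simp add: \<rho>\<^sub>0_def u\<^sub>0_def G_def)
    qed
    have close: "norm ((z, 0 :: real), wave_density c \<theta> z - 1, 0 :: real) \<le> \<kappa> \<eta>"
      if \<eta>: "\<eta> \<in> {0<..<\<eta>\<^sub>0}" and z: "\<bar>z\<bar> \<le> 2 * a \<eta>" for \<eta> z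
    proof -
      have "norm ((z, 0 :: real), G z, 0 :: real) \<le> norm (z, 0 :: real) + norm (G z, 0 :: real)"
        using norm_Pair_le[of "(z, 0 :: real)" "(G z, 0 :: real)"] .
      also have "\<dots> = \<bar>z\<bar> + \<bar>G z\<bar>" by (simp add: norm_Pair)
      also have "\<dots> \<le> (1 + B\<^sub>1) * \<bar>z\<bar>" using B\<^sub>1(2)[of z] z small(5)[OF \<eta>] by (simp add: algebra_simps)
      also have "\<dots> \<le> \<kappa> \<eta>" unfolding \<kappa>_def using z B\<^sub>1(1) by (intro mult_left_mono) auto
      finally show ?thesis by (simp add: G_def)
    qed
    have planar: "planar_symmetric_on (initial_region A \<gamma> \<eta> (T \<eta>)) (\<lambda>x. (\<rho>\<^sub>0 \<eta> x, u\<^sub>0 \<eta> x, 0 :: real))"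
      if "\<eta> \<in> {0<..<\<eta>\<^sub>0}" for \<eta>
      unfolding planar_symmetric_on_def using data_planar[OF that] by simp
    {
      fix \<eta> assume \<eta>: "\<eta> \<in> {0<..<\<eta>\<^sub>0}"
      have data: "\<rho>\<^sub>0 \<eta> x = wave_density (sqrt (A * \<gamma>)) ((\<gamma> - 1) / 2) (focusing_velocity F \<gamma> \<eta> (T \<eta>) (fst x)) \<and>
          u\<^sub>0 \<eta> x = (focusing_velocity F \<gamma> \<eta> (T \<eta>) (fst x), 0) \<and> (0 :: real) = 0"
        if "x \<in> initial_region A \<gamma> \<eta> (T \<eta>)" for x
        using data_planar[OF \<eta> that] by (simp add: c_def \<theta>_def w\<^sub>0_def)
      note shock_formation[OF wave[OF \<eta>] data close[OF \<eta>, unfolded c_def \<theta>_def a_def]]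
    } note shock = this
    show "\<exists>\<eta>\<^sub>0>0. ?ill_posed X \<eta>\<^sub>0"
    proof (rule exI[of _ \<eta>\<^sub>0], rule conjI[OF \<eta>\<^sub>0], rule exI[of _ \<rho>\<^sub>0], rule exI[of _ u\<^sub>0], rule exI[of _ "\<lambda>_ _. 0"],
        rule exI[of _ T], rule exI[of _ \<kappa>], intro conjI ballI allI)
    qed (rule norms0 T0 \<kappa>0 sobolev_zero(1) | erule data_regular sob(1,2) small(1) planar shock | assumption)+
  qed
qed

end
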